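(* Let $d\ge 1$ and $\mathbf{u}_0 \in \boldsymbol{\mathcal{S}} = \oplus_{k=1}^d \mathcal{S}(\mathbb{R}^d)$. The $\boldsymbol{\mathcal{S}}$-valued local solution to Burgers' equation $$\mathbf{u}(t) = \mathbf{u}_0 + \int_0^t \left( \tfrac{1}{2}\Delta \mathbf{u}(s) + \mathbf{u}(s)\cdot\nabla \mathbf{u}(s)\right) ds$$ is unique in the following sense: if $(\hat{\mathbf{u}},\tau_1)$ and $(\hat{\mathbf{v}},\tau_2)$ are two $\boldsymbol{\mathcal{S}}$-valued local solutions with the same initial value $\mathbf{u}_0$, then $\hat{\mathbf{u}}(t)=\hat{\mathbf{v}}(t)$ for all $t<\tau_1\wedge\tau_2$.
   Context: $\mathcal{S}=\mathcal{S}(\mathbb{R}^d)$ is the (real) Schwartz space. For a non-negative integer $p$ and $\phi,\psi\in\mathcal{S}$ put $$\langle \phi,\psi\rangle_p := \sum_{|\alpha|+|\beta|\le 2p}\int_{\mathbb{R}^d} x^\alpha\partial^\beta\phi(x)\, x^\alpha\partial^\beta\psi(x)\,dx$$ (sum over multi-indices $\alpha,\beta\in\mathbb{Z}_+^d$), with norm $\|\cdot\|_p$. The Hermite-Sobolev space $\mathcal{S}_p$ is the completion of $\mathcal{S}$ in $\|\cdot\|_p$, viewed as a subspace of $L^2(\mathbb{R}^d)$. $\boldsymbol{\mathcal{S}}:=\oplus_{k=1}^d\mathcal{S}$ and $\boldsymbol{\mathcal{S}}_p:=\oplus_{k=1}^d\mathcal{S}_p$, with $\langle\mathbf{u},\mathbf{v}\rangle_p:=\sum_{j=1}^d\langle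 u_j,v_j\rangle_p$ and $\|\mathbf{u}\|_p^2:=\sum_{j=1}^d\|u_j\|_p^2$. For vector fields, $\mathbf{u}\cdot\nabla\mathbf{v}:=\sum_{j=1}^d u_j\,\partial_j\mathbf{v}$, and $\Delta$ acts componentwise. Definition. Let $p$ be an integer with $p-1\ge\frac{d+1}{2}$ and $\mathbf{u}_0\in\boldsymbol{\mathcal{S}}_p$. A pair $(\mathbf{u},\tau)$ is an $\boldsymbol{\mathcal{S}}_p$-valued local solution with initial value $\mathbf{u}_0$ if: (1) $\tau>0$; (2) $\mathbf{u}:[0,\tau)\to\boldsymbol{\mathcal{S}}_p$ is continuous; (3) the function $t\mapsto \frac12\Delta\mathbf{u}(t)+\mathbf{u}(t)\cdot\nabla\mathbf{u}(t)$ on $[0,\tau)$ is Bochner integrable in $\boldsymbol{\mathcal{S}}_{p-1}$; (4) the integral equation $\mathbf{u}(t)=\mathbf{u}_0+\int_0^t(\frac12\Delta\mathbf{u}(s)+\mathbf{u}(s)\cdot\nabla\mathbf{u}(s))\,ds$ holds in $\boldsymbol{\mathcal{S}}_{p-1}$ for all $t<\tau$. The pair $(\mathbf{u},\tau)$ is an $\boldsymbol{\mathcal{S}}$-valued local solution if it is an $\boldsymbol{\mathcal{S}}_p$-valued local solution for all integers $p$ with $p-1\ge\frac{d+1}{2}$ (with the same $\mathbf{u}$ and $\tau$). *)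

theory Defs
  imports "HOL-Analysis.Analysis"
begin

section \<open>Partial derivatives and Schwartz functions\<close>

definition partial_deriv :: "'n::finite \<Rightarrow> (real^'n \<Rightarrow> real) \<Rightarrow> real^'n \<Rightarrow> real" where
  "partial_deriv j f x = deriv (\<lambda>s. f (x + s *\<^sub>R axis j 1)) 0"

definition partials :: "'n::finite list \<Rightarrow> (real^'n \<Rightarrow> real) \<Rightarrow> real^'n \<Rightarrow> real" where
  "partials js f = foldr partial_deriv js f"

text \<open>All iterated partial derivatives exist and are (Frechet) differentiable everywhere; they are
  then in particular continuous, so this is the class of infinitely differentiable functions.\<close>

definition smooth :: "(real^'n::finite \<Rightarrow> real) \<Rightarrow> bool" where
  "smooth f \<longleftrightarrow> (\<forall>js. partials js f differentiable_on UNIV)"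

text \<open>A multi-index is a function \<open>'n \<Rightarrow> nat\<close>, where \<open>'n\<close> indexes the \<open>CARD('n)\<close> coordinates.
  In \<open>multi_deriv\<close> the derivatives are taken in an arbitrary but fixed order, which is immaterial for
  smooth functions by the symmetry of mixed partial derivatives.\<close>

definition multi_deriv :: "('n::finite \<Rightarrow> nat) \<Rightarrow> (real^'n \<Rightarrow> real) \<Rightarrow> real^'n \<Rightarrow> real" where
  "multi_deriv \<beta> = partials (SOME js. \<forall>j. count_list js j = \<beta> j)"

definition multi_power :: "real^'n::finite \<Rightarrow> ('n \<Rightarrow> nat) \<Rightarrow> real" where
  "multi_power x \<alpha> = (\<Prod>j\<in>UNIV. (x $ j) ^ \<alpha> j)"

definition schwartz :: "(real^'n::finite \<Rightarrow> real) set" where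
  "schwartz = {f. smooth f \<and> (\<forall>\<alpha> \<beta>. bounded (range (\<lambda>x. multi_power x \<alpha> * multi_deriv \<beta> f x)))}"

definition multi_index_pairs :: "nat \<Rightarrow> (('n::finite \<Rightarrow> nat) \<times> ('n \<Rightarrow> nat)) set" where
  "multi_index_pairs m = {(\<alpha>, \<beta>). (\<Sum>j\<in>UNIV. \<alpha> j) + (\<Sum>j\<in>UNIV. \<beta> j) \<le> m}"

lemma finite_multi_index_pairs: "finite (multi_index_pairs m :: (('n::finite \<Rightarrow> nat) \<times> ('n \<Rightarrow> nat)) set)"
proof -
  let ?B = "{\<alpha> :: 'n \<Rightarrow> nat. \<forall>j. \<alpha> j \<in> {..m}}"
  have fin: "finite ?B"
    using finite_set_of_finite_funs[of "UNIV :: 'n set" "{..m}" 0] by simp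
  have bound: "\<alpha> \<in> ?B" if "sum \<alpha> UNIV \<le> m" for \<alpha> :: "'n \<Rightarrow> nat"
    using that member_le_sum[of _ UNIV \<alpha>] by (auto intro: order_trans)
  have "multi_index_pairs m \<subseteq> ?B \<times> ?B"
  proof
    fix z :: "('n \<Rightarrow> nat) \<times> ('n \<Rightarrow> nat)"
    assume "z \<in> multi_index_pairs m"
    then have "sum (fst z) UNIV \<le> m" "sum (snd z) UNIV \<le> m"
      by (auto simp: multi_index_pairs_def)
    then show "z \<in> ?B \<times> ?B"
      using bound[of "fst z"] bound[of "snd z"] by (simp add: mem_Times_iff)
  qed
  then show ?thesis
    using fin by (meson finite_SigmaI finite_subset)
qed

lemma multi_index_list_exists:
  fixes \<beta> :: "'n::finite \<Rightarrow> nat"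
  shows "\<exists>js. \<forall>j. count_list js j = \<beta> j"
proof -
  have "finite A \<Longrightarrow> \<exists>js. \<forall>j. count_list js j = (if j \<in> A then \<beta> j else 0)" for A :: "'n set"
  proof (induction A rule: finite_induct)
    case empty
    show ?case by (intro exI[of _ "[]"]) simp
  next
    case (insert a A)
    then obtain js where js: "\<forall>j. count_list js j = (if j \<in> A then \<beta> j else 0)"
      by blast
    have rep: "count_list (replicate k a) j = (if j = a then k else 0)" for k j
      by (induction k) auto
    show ?case
      by (intro exI[of _ "replicate (\<beta> a) a @ js"]) (use js insert.hyps rep in auto)
  qed
  from this[of UNIV] show ?thesis by simp
qed

definition schwartz_inner :: "nat \<Rightarrow> (real^'n::finite \<Rightarrow> real) \<Rightarrow> (real^'n \<Rightarrow> real) \<Rightarrow> real" where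
  "schwartz_inner p \<phi> \<psi> = (\<Sum>(\<alpha>, \<beta>)\<in>multi_index_pairs (2 * p).
     LINT x|lborel. (multi_power x \<alpha> * multi_deriv \<beta> \<phi> x) * (multi_power x \<alpha> * multi_deriv \<beta> \<psi> x))"

definition schwartz_norm :: "nat \<Rightarrow> (real^'n::finite \<Rightarrow> real) \<Rightarrow> real" where
  "schwartz_norm p \<phi> = sqrt (schwartz_inner p \<phi> \<phi>)"


section \<open>Measurable functions modulo almost everywhere equality\<close>

definition mfun_eq :: "(real^'n::finite \<Rightarrow> real) \<Rightarrow> (real^'n \<Rightarrow> real) \<Rightarrow> bool" where
  "mfun_eq f g \<longleftrightarrow> f \<in> borel_measurable borel \<and> g \<in> borel_measurable borel \<and> (AE x in lborel. f x = g x)"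

quotient_type (overloaded) 'n mfun = "real^'n::finite \<Rightarrow> real" / partial: mfun_eq
proof (rule part_equivpI)
  show "\<exists>f :: real^'n \<Rightarrow> real. mfun_eq f f"
    by (intro exI[of _ "\<lambda>_. 0"]) (simp add: mfun_eq_def)
  show "symp (mfun_eq :: (real^'n \<Rightarrow> real) \<Rightarrow> _)"
    by (auto simp: symp_def mfun_eq_def)
  show "transp (mfun_eq :: (real^'n \<Rightarrow> real) \<Rightarrow> _)"
    unfolding transp_def mfun_eq_def by (auto elim: AE_mp)
qed

instantiation mfun :: (finite) "{real_vector, comm_ring}"
begin

lift_definition zero_mfun :: "'a mfun" is "\<lambda>_. 0"
  by (simp add: mfun_eq_def)

lift_definition plus_mfun :: "'a mfun \<Rightarrow> 'a mfun \<Rightarrow> 'a mfun" is "\<lambda>f g x. f x + g x"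
  unfolding mfun_eq_def by auto

lift_definition minus_mfun :: "'a mfun \<Rightarrow> 'a mfun \<Rightarrow> 'a mfun" is "\<lambda>f g x. f x - g x"
  unfolding mfun_eq_def by auto

lift_definition uminus_mfun :: "'a mfun \<Rightarrow> 'a mfun" is "\<lambda>f x. - f x"
  unfolding mfun_eq_def by auto

lift_definition times_mfun :: "'a mfun \<Rightarrow> 'a mfun \<Rightarrow> 'a mfun" is "\<lambda>f g x. f x * g x"
  unfolding mfun_eq_def by auto

lift_definition scaleR_mfun :: "real \<Rightarrow> 'a mfun \<Rightarrow> 'a mfun" is "\<lambda>c f x. c * f x"
  unfolding mfun_eq_def by auto

instance
  by standard (transfer; auto simp: mfun_eq_def algebra_simps)+

end

text \<open>The class of a function; only meaningful for Borel measurable arguments.\<close>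

abbreviation mfun_of :: "(real^'n::finite \<Rightarrow> real) \<Rightarrow> 'n mfun" where
  "mfun_of \<equiv> abs_mfun"

lift_definition square_integrable :: "'n::finite mfun \<Rightarrow> bool" is
  "\<lambda>f. integrable lborel (\<lambda>x. (f x)\<^sup>2)"
  unfolding mfun_eq_def by (intro integrable_cong_AE) auto

definition L2 :: "'n::finite mfun set" where
  "L2 = {u. square_integrable u}"

lift_definition L2_inner :: "'n::finite mfun \<Rightarrow> 'n mfun \<Rightarrow> real" is
  "\<lambda>f g. LINT x|lborel. f x * g x"
  unfolding mfun_eq_def by (intro integral_cong_AE) auto

definition L2_norm :: "'n::finite mfun \<Rightarrow> real" where
  "L2_norm u = sqrt (L2_inner u u)"


section \<open>Hermite-Sobolev spaces\<close>

text \<open>The completion of the Schwartz space in \<open>schwartz_norm p\<close>, realised inside \<open>L2\<close>: since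
  \<open>schwartz_norm p\<close> dominates the \<open>L2\<close> norm, a Cauchy sequence of Schwartz functions converges
  in \<open>L2\<close>, and its limit determines the element of the completion. The inner product is the
  extension by continuity of \<open>schwartz_inner p\<close>; it is meaningful for elements of
  \<open>hermite_sobolev p\<close> only.\<close>

definition hs_approximates :: "nat \<Rightarrow> (nat \<Rightarrow> real^'n::finite \<Rightarrow> real) \<Rightarrow> 'n mfun \<Rightarrow> bool" where
  "hs_approximates p \<phi> u \<longleftrightarrow>
     (\<forall>n. \<phi> n \<in> schwartz) \<and>
     (\<forall>e>0. \<exists>N. \<forall>m\<ge>N. \<forall>n\<ge>N. schwartz_norm p (\<lambda>x. \<phi> m x - \<phi> n x) < e) \<and>
     u \<in> L2 \<and> (\<lambda>n. L2_norm (mfun_of (\<phi> n) - u)) \<longlonglongrightarrow> 0"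

definition hermite_sobolev :: "nat \<Rightarrow> 'n::finite mfun set" where
  "hermite_sobolev p = {u. \<exists>\<phi>. hs_approximates p \<phi> u}"

definition hs_inner :: "nat \<Rightarrow> 'n::finite mfun \<Rightarrow> 'n mfun \<Rightarrow> real" where
  "hs_inner p u v = (THE r. \<forall>\<phi> \<psi>. hs_approximates p \<phi> u \<longrightarrow> hs_approximates p \<psi> v \<longrightarrow>
     (\<lambda>n. schwartz_inner p (\<phi> n) (\<psi> n)) \<longlonglongrightarrow> r)"

text \<open>The direct sums of \<open>CARD('n)\<close> copies: vector fields are vectors of (classes of) functions.\<close>

definition schwartz_vec :: "('n::finite mfun ^ 'n) set" where
  "schwartz_vec = {u. \<forall>k. u $ k \<in> mfun_of ` schwartz}"

definition hermite_sobolev_vec :: "nat \<Rightarrow> ('n::finite mfun ^ 'n) set" where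
  "hermite_sobolev_vec p = {u. \<forall>k. u $ k \<in> hermite_sobolev p}"

definition hs_inner_vec :: "nat \<Rightarrow> 'n::finite mfun ^ 'n \<Rightarrow> 'n mfun ^ 'n \<Rightarrow> real" where
  "hs_inner_vec p u v = (\<Sum>j\<in>UNIV. hs_inner p (u $ j) (v $ j))"

definition hs_norm_vec :: "nat \<Rightarrow> 'n::finite mfun ^ 'n \<Rightarrow> real" where
  "hs_norm_vec p u = sqrt (hs_inner_vec p u u)"


section \<open>The Burgers nonlinearity\<close>

text \<open>The distributional derivative, for an element of \<open>L2\<close> whose derivative lies in \<open>L2\<close> again; it
  maps \<open>hermite_sobolev (Suc p)\<close> to \<open>hermite_sobolev p\<close>. Note that \<open>hermite_sobolev 0\<close> is \<open>L2\<close>,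
  because the Schwartz functions are dense in \<open>L2\<close>.\<close>

definition dist_partial :: "'n::finite \<Rightarrow> 'n mfun \<Rightarrow> 'n mfun" where
  "dist_partial j u = (THE g. g \<in> hermite_sobolev 0 \<and>
     (\<forall>\<phi>\<in>schwartz. L2_inner g (mfun_of \<phi>) = - L2_inner u (mfun_of (partial_deriv j \<phi>))))"

definition laplacian :: "'n::finite mfun ^ 'n \<Rightarrow> 'n mfun ^ 'n" where
  "laplacian u = (\<chi> k. \<Sum>j\<in>UNIV. dist_partial j (dist_partial j (u $ k)))"

definition advection :: "'n::finite mfun ^ 'n \<Rightarrow> 'n mfun ^ 'n \<Rightarrow> 'n mfun ^ 'n" where
  "advection u v = (\<chi> k. \<Sum>j\<in>UNIV. u $ j * dist_partial j (v $ k))"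

definition burgers_rhs :: "'n::finite mfun ^ 'n \<Rightarrow> 'n mfun ^ 'n" where
  "burgers_rhs u = (1/2) *\<^sub>R laplacian u + advection u u"


section \<open>Bochner integral in a normed subspace\<close>

text \<open>The spaces of integration depend on the number \<open>p\<close>, so they cannot be types and the
  type-class based Bochner integral of the library does not apply. The following is the usual
  definition, for functions with values in a subspace \<open>X\<close> that is normed by \<open>N\<close>: \<open>f\<close> is the almost
  everywhere limit of simple functions \<open>s i\<close>, with \<open>N (f - s i)\<close> tending to 0 in mean, and the
  integrals of the \<open>s i\<close> tend to \<open>x\<close>. It is to be used for complete measures \<open>M\<close>, for which
  \<open>N (f - s i)\<close> is measurable.\<close>

definition has_bochner_integral_in ::
  "'b::real_vector set \<Rightarrow> ('b \<Rightarrow> real) \<Rightarrow> 'a measure \<Rightarrow> ('a \<Rightarrow> 'b) \<Rightarrow> 'b \<Rightarrow> bool" where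
  "has_bochner_integral_in X N M f x \<longleftrightarrow>
     (\<forall>t\<in>space M. f t \<in> X) \<and> x \<in> X \<and>
     (\<exists>s. (\<forall>i. Bochner_Integration.simple_bochner_integrable M (s i) \<and> (\<forall>t\<in>space M. s i t \<in> X)) \<and>
        (AE t in M. (\<lambda>i. N (f t - s i t)) \<longlonglongrightarrow> 0) \<and>
        (\<lambda>i. \<integral>\<^sup>+t. ennreal (N (f t - s i t)) \<partial>M) \<longlonglongrightarrow> 0 \<and>
        (\<lambda>i. N (Bochner_Integration.simple_bochner_integral M (s i) - x)) \<longlonglongrightarrow> 0)"

definition bochner_integrable_in ::
  "'b::real_vector set \<Rightarrow> ('b \<Rightarrow> real) \<Rightarrow> 'a measure \<Rightarrow> ('a \<Rightarrow> 'b) \<Rightarrow> bool" where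
  "bochner_integrable_in X N M f \<longleftrightarrow> (\<exists>x. has_bochner_integral_in X N M f x)"


section \<open>Local solutions\<close>

definition admissible_order :: "'n::finite itself \<Rightarrow> nat \<Rightarrow> bool" where
  "admissible_order _ p \<longleftrightarrow> real p - 1 \<ge> (real CARD('n) + 1) / 2"

text \<open>The notion is meant for orders with \<open>admissible_order TYPE('n) p\<close>, so that \<open>p \<ge> 2\<close> and \<open>p - 1\<close> is
  not truncated. Only the values of \<open>u\<close> on \<open>{0..<\<tau>}\<close> matter. The integral equation is expressed as:
  \<open>u t - u0\<close> is the Bochner integral over \<open>{0..t}\<close>.\<close>

definition hs_local_solution ::
  "nat \<Rightarrow> 'n::finite mfun ^ 'n \<Rightarrow> (real \<Rightarrow> 'n mfun ^ 'n) \<Rightarrow> real \<Rightarrow> bool" where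
  "hs_local_solution p u0 u \<tau> \<longleftrightarrow>
     u0 \<in> hermite_sobolev_vec p \<and>
     \<tau> > 0 \<and>
     (\<forall>t\<in>{0..<\<tau>}. u t \<in> hermite_sobolev_vec p) \<and>
     (\<forall>t\<in>{0..<\<tau>}. ((\<lambda>s. hs_norm_vec p (u s - u t)) \<longlongrightarrow> 0) (at t within {0..<\<tau>})) \<and>
     bochner_integrable_in (hermite_sobolev_vec (p - 1)) (hs_norm_vec (p - 1))
       (lebesgue_on {0..<\<tau>}) (\<lambda>t. burgers_rhs (u t)) \<and>
     (\<forall>t\<in>{0..<\<tau>}. has_bochner_integral_in (hermite_sobolev_vec (p - 1)) (hs_norm_vec (p - 1))
       (lebesgue_on {0..t}) (\<lambda>s. burgers_rhs (u s)) (u t - u0))"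

definition schwartz_local_solution ::
  "'n::finite mfun ^ 'n \<Rightarrow> (real \<Rightarrow> 'n mfun ^ 'n) \<Rightarrow> real \<Rightarrow> bool" where
  "schwartz_local_solution u0 u \<tau> \<longleftrightarrow>
     (\<forall>p. admissible_order TYPE('n) p \<longrightarrow> hs_local_solution p u0 u \<tau>)"

end

theory Submission
  imports Defs
begin

text \<open>The difference \<open>w = u - v\<close> of two solutions satisfies
\<open>w' = 1/2 \<Delta>w + w \<cdot> \<nabla>u + v \<cdot> \<nabla>w\<close> with \<open>w(0) = 0\<close>, and uniqueness is the classical \<open>L\<^sup>2\<close> energy
argument: in \<open>1/2 d/dt \<parallel>w\<parallel>\<^sup>2 = \<langle>w, w'\<rangle>\<close> the Laplacian contributes \<open>- 1/2 \<parallel>\<nabla>w\<parallel>\<^sup>2\<close>, the second term is at most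
a constant times \<open>\<parallel>w\<parallel>\<^sup>2\<close> because \<open>\<nabla>u\<close> is bounded, and the third is split by Young's inequality into a part
absorbed by \<open>- 1/2 \<parallel>\<nabla>w\<parallel>\<^sup>2\<close> and another multiple of \<open>\<parallel>w\<parallel>\<^sup>2\<close>. Gronwall's inequality then gives
\<open>w = 0\<close>. The estimate is \<open>burgers_energy_estimate\<close>, its integration in time is \<open>energy_gronwall\<close>.

What makes this rigorous is that a solution with values in every Hermite-Sobolev space takes its
values in the classes of Schwartz functions: the Schwartz space is the intersection of the
Hermite-Sobolev spaces (\<open>hermite_sobolev_Inter\<close>). On Schwartz functions the distributional
derivative is the classical one (\<open>dist_partial_schwartz\<close>), so the right-hand side of the equation can be
computed pointwise and integrated by parts. Two facts about the norms support this. They are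
closable in \<open>L\<^sup>2\<close> (\<open>schwartz_norm_closable\<close>), so that the inner product of a
Hermite-Sobolev space does not depend on the approximating sequences; and they dominate the
supremum norm (\<open>schwartz_sobolev\<close>), which yields the pointwise limits, and the bounds on
\<open>u\<close>, \<open>v\<close> and \<open>\<nabla>u\<close>, uniformly on compact time intervals by continuity in time.

The integral equation lives in a Bochner integral over a normed subspace. It is used only after testing
with a fixed Schwartz vector field, which turns it into an identity between real integrals
(\<open>has_bochner_integral_in_functional\<close>, \<open>schwartz_local_solution_weak\<close>).\<close>

section \<open>Partial derivatives of smooth functions\<close>

lemma partials_Nil [simp]: "partials [] f = f"
  and partials_Cons [simp]: "partials (j # js) f = partial_deriv j (partials js f)"
  by (simp_all add: partials_def)

lemma partials_append: "partials (is @ js) f = partials is (partials js f)"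
  by (simp add: partials_def)

lemma smooth_partials: "smooth f \<Longrightarrow> smooth (partials js f)"
  unfolding smooth_def by (metis partials_append)

lemma smooth_partial_deriv: "smooth f \<Longrightarrow> smooth (partial_deriv j f)"
  using smooth_partials[of f "[j]"] by simp

lemma smooth_imp_differentiable: "smooth f \<Longrightarrow> f differentiable (at x)"
  unfolding smooth_def differentiable_on_def by (metis UNIV_I partials_Nil)

lemma has_derivative_imp_derivative_along_axis:
  assumes "(f has_derivative D) (at (x + s *\<^sub>R axis j 1))"
  shows "((\<lambda>s. f (x + s *\<^sub>R axis j 1)) has_real_derivative D (axis j 1)) (at s)"
proof -
  have "((\<lambda>s. f (x + s *\<^sub>R axis j 1)) has_derivative (\<lambda>h. D (h *\<^sub>R axis j 1))) (at s)"
    by (rule has_derivative_compose[of "\<lambda>s. x + s *\<^sub>R axis j 1" _ s UNIV f D, simplified])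
      (use assms in \<open>auto intro!: derivative_eq_intros\<close>)
  moreover have "D (h *\<^sub>R axis j 1) = D (axis j 1) * h" for h
    using linear_scale[OF has_derivative_linear[OF assms]] by simp
  ultimately show ?thesis
    by (simp add: has_field_derivative_def)
qed

lemma partial_deriv_eq_derivative:
  assumes "(f has_derivative D) (at x)"
  shows "partial_deriv j f x = D (axis j 1)"
  unfolding partial_deriv_def
  by (rule DERIV_imp_deriv, rule has_derivative_imp_derivative_along_axis) (use assms in simp)

lemma has_derivative_along_axis:
  assumes "f differentiable (at (x + s *\<^sub>R axis j 1))"
  shows "((\<lambda>s. f (x + s *\<^sub>R axis j 1)) has_real_derivative partial_deriv j f (x + s *\<^sub>R axis j 1)) (at s)"
proof -
  obtain D where "(f has_derivative D) (at (x + s *\<^sub>R axis j 1))"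
    using assms by (auto simp: differentiable_def)
  from has_derivative_imp_derivative_along_axis[OF this] partial_deriv_eq_derivative[OF this, of j]
  show ?thesis by simp
qed

lemma has_derivative_partials:
  assumes "f differentiable (at x)"
  shows "(f has_derivative (\<lambda>h. \<Sum>j\<in>UNIV. h $ j * partial_deriv j f x)) (at x)"
proof -
  obtain D where D: "(f has_derivative D) (at x)"
    using assms by (auto simp: differentiable_def)
  note lin = has_derivative_linear[OF D]
  have "D h = (\<Sum>j\<in>UNIV. h $ j * partial_deriv j f x)" for h
  proof -
    have "D h = D (\<Sum>j\<in>UNIV. h $ j *\<^sub>R axis j 1)"
      by (simp add: basis_expansion flip: scalar_mult_eq_scaleR)
    also have "\<dots> = (\<Sum>j\<in>UNIV. h $ j * D (axis j 1))"
      by (simp add: linear_sum[OF lin] linear_scale[OF lin])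
    finally show ?thesis
      by (simp add: partial_deriv_eq_derivative[OF D])
  qed
  then have "D = (\<lambda>h. \<Sum>j\<in>UNIV. h $ j * partial_deriv j f x)"
    by blast
  with D show ?thesis
    by simp
qed

lemma partial_deriv_add:
  assumes "\<And>x. f differentiable (at x)" "\<And>x. g differentiable (at x)"
  shows "partial_deriv j (\<lambda>x. f x + g x) = (\<lambda>x. partial_deriv j f x + partial_deriv j g x)"
proof
  fix x
  show "partial_deriv j (\<lambda>x. f x + g x) x = partial_deriv j f x + partial_deriv j g x"
    using partial_deriv_eq_derivative[OF has_derivative_add[OF has_derivative_partials[OF assms(1)[of x]]
          has_derivative_partials[OF assms(2)[of x]]], of j]
    by (simp add: axis_def if_distrib[of "\<lambda>c. c * _"] cong: if_cong)
qed

lemma partial_deriv_cmult: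
  assumes "\<And>x. f differentiable (at x)"
  shows "partial_deriv j (\<lambda>x. c * f x) = (\<lambda>x. c * partial_deriv j f x)"
proof
  fix x
  show "partial_deriv j (\<lambda>x. c * f x) x = c * partial_deriv j f x"
    using partial_deriv_eq_derivative[OF has_derivative_mult_right[OF has_derivative_partials[OF assms(1)[of x]]], of j]
    by (simp add: axis_def if_distrib[of "\<lambda>c. c * _"] cong: if_cong)
qed

lemma partial_deriv_mult:
  assumes "\<And>x. f differentiable (at x)" "\<And>x. g differentiable (at x)"
  shows "partial_deriv j (\<lambda>x. f x * g x) = (\<lambda>x. f x * partial_deriv j g x + partial_deriv j f x * g x)"
proof
  fix x
  show "partial_deriv j (\<lambda>x. f x * g x) x = f x * partial_deriv j g x + partial_deriv j f x * g x"
    using partial_deriv_eq_derivative[OF has_derivative_mult[OF has_derivative_partials[OF assms(1)[of x]]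
          has_derivative_partials[OF assms(2)[of x]]], of j]
    by (simp add: axis_def if_distrib[of "\<lambda>c. c * _"] cong: if_cong)
qed

lemma partial_deriv_coordinate: "partial_deriv j (\<lambda>x::real^'n::finite. x $ i) = (\<lambda>x. if i = j then 1 else 0)"
proof
  fix x :: "real^'n"
  have "((\<lambda>x::real^'n. x $ i) has_derivative (\<lambda>h. h $ i)) (at x)"
    by (intro bounded_linear_imp_has_derivative bounded_linear_vec_nth)
  from partial_deriv_eq_derivative[OF this]
  show "partial_deriv j (\<lambda>x::real^'n. x $ i) x = (if i = j then 1 else 0)"
    by (auto simp: axis_def)
qed

lemma coordinate_differentiable: "(\<lambda>x::real^'n::finite. x $ i) differentiable (at x)"
  by (intro bounded_linear_imp_differentiable bounded_linear_vec_nth)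

text \<open>The mean value theorem is applied to the increment in direction \<open>j\<close> as a function of the step in
direction \<open>i\<close>, and then once more in direction \<open>j\<close>.\<close>

lemma second_difference_mean_value:
  fixes f :: "real^'n::finite \<Rightarrow> real"
  assumes "smooth f" "h > 0"
  obtains a b where "0 < a" "a < h" "0 < b" "b < h"
    "f (x + h *\<^sub>R axis i 1 + h *\<^sub>R axis j 1) - f (x + h *\<^sub>R axis i 1) - f (x + h *\<^sub>R axis j 1) + f x
       = h\<^sup>2 * partial_deriv j (partial_deriv i f) (x + a *\<^sub>R axis i 1 + b *\<^sub>R axis j 1)"
proof -
  let ?e = "axis i 1 :: real^'n" and ?d = "axis j 1 :: real^'n"
  define \<phi> where "\<phi> s = f (x + h *\<^sub>R ?d + s *\<^sub>R ?e) - f (x + s *\<^sub>R ?e)" for s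
  have der: "(\<phi> has_real_derivative partial_deriv i f (x + h *\<^sub>R ?d + s *\<^sub>R ?e) - partial_deriv i f (x + s *\<^sub>R ?e)) (at s)" for s
    unfolding \<phi>_def
    by (intro DERIV_diff has_derivative_along_axis smooth_imp_differentiable assms)
  obtain a where a: "0 < a" "a < h" "\<phi> h - \<phi> 0 = h * (partial_deriv i f (x + h *\<^sub>R ?d + a *\<^sub>R ?e) - partial_deriv i f (x + a *\<^sub>R ?e))"
    using MVT2[OF \<open>h > 0\<close>, of \<phi>, OF der] by auto
  define \<psi> where "\<psi> s = partial_deriv i f (x + a *\<^sub>R ?e + s *\<^sub>R ?d)" for s
  have der2: "(\<psi> has_real_derivative partial_deriv j (partial_deriv i f) (x + a *\<^sub>R ?e + s *\<^sub>R ?d)) (at s)" for s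
    unfolding \<psi>_def
    by (intro has_derivative_along_axis smooth_imp_differentiable smooth_partial_deriv assms)
  obtain b where b: "0 < b" "b < h" "\<psi> h - \<psi> 0 = h * partial_deriv j (partial_deriv i f) (x + a *\<^sub>R ?e + b *\<^sub>R ?d)"
    using MVT2[OF \<open>h > 0\<close>, of \<psi>, OF der2] by auto
  show ?thesis
  proof (rule that[OF a(1,2) b(1,2)])
    have "f (x + h *\<^sub>R ?e + h *\<^sub>R ?d) - f (x + h *\<^sub>R ?e) - f (x + h *\<^sub>R ?d) + f x = \<phi> h - \<phi> 0"
      by (simp add: \<phi>_def add.commute add.left_commute)
    also have "\<dots> = h * (\<psi> h - \<psi> 0)"
      using a(3) by (simp add: \<psi>_def add.commute add.left_commute)
    also have "\<dots> = h\<^sup>2 * partial_deriv j (partial_deriv i f) (x + a *\<^sub>R ?e + b *\<^sub>R ?d)"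
      using b(3) by (simp add: power2_eq_square)
    finally show "f (x + h *\<^sub>R ?e + h *\<^sub>R ?d) - f (x + h *\<^sub>R ?e) - f (x + h *\<^sub>R ?d) + f x = \<dots>" .
  qed
qed

lemma second_difference_limit:
  fixes f :: "real^'n::finite \<Rightarrow> real"
  assumes "smooth f"
  shows "((\<lambda>h. (f (x + h *\<^sub>R axis i 1 + h *\<^sub>R axis j 1) - f (x + h *\<^sub>R axis i 1) - f (x + h *\<^sub>R axis j 1) + f x) / h\<^sup>2)
     \<longlongrightarrow> partial_deriv j (partial_deriv i f) x) (at_right 0)"
proof -
  let ?e = "axis i 1 :: real^'n" and ?d = "axis j 1 :: real^'n"
  let ?q = "\<lambda>h. (f (x + h *\<^sub>R ?e + h *\<^sub>R ?d) - f (x + h *\<^sub>R ?e) - f (x + h *\<^sub>R ?d) + f x) / h\<^sup>2"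
  let ?g = "partial_deriv j (partial_deriv i f)"
  have "\<exists>y. h > 0 \<longrightarrow> (?q h = ?g y \<and> norm (y - x) \<le> 2 * h)" for h
  proof (cases "h > 0")
    case True
    then obtain a b where ab: "0 < a" "a < h" "0 < b" "b < h" 
     "f (x + h *\<^sub>R ?e + h *\<^sub>R ?d) - f (x + h *\<^sub>R ?e) - f (x + h *\<^sub>R ?d) + f x = h\<^sup>2 * ?g (x + a *\<^sub>R ?e + b *\<^sub>R ?d)"
      using second_difference_mean_value[OF assms, of h x i j] by metis
    have "norm (a *\<^sub>R ?e + b *\<^sub>R ?d) \<le> \<bar>a\<bar> + \<bar>b\<bar>"
      by (rule norm_triangle_le) simp
    with ab True show ?thesis
      by (intro exI[of _ "x + a *\<^sub>R ?e + b *\<^sub>R ?d"]) (simp add: add.assoc)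
  qed auto
  then obtain y where y: "\<And>h. h > 0 \<Longrightarrow> ?q h = ?g (y h)" "\<And>h. h > 0 \<Longrightarrow> norm (y h - x) \<le> 2 * h"
    by metis
  have "((\<lambda>h. y h - x) \<longlongrightarrow> 0) (at_right 0)"
  proof (rule Lim_null_comparison)
    show "\<forall>\<^sub>F h in at_right 0. norm (y h - x) \<le> 2 * h"
      using y(2) by (simp add: eventually_at_filter)
    show "((\<lambda>h. 2 * h) \<longlongrightarrow> 0) (at_right (0::real))"
      by (auto intro!: tendsto_eq_intros)
  qed
  then have "(y \<longlongrightarrow> x) (at_right 0)"
    by (simp add: LIM_zero_iff)
  moreover have "isCont ?g x"
    by (intro differentiable_imp_continuous_within smooth_imp_differentiable smooth_partial_deriv assms)
  ultimately have "((\<lambda>h. ?g (y h)) \<longlongrightarrow> ?g x) (at_right 0)"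
    by (rule isCont_tendsto_compose[rotated])
  then show ?thesis
    by (rule Lim_transform_eventually) (use y(1) in \<open>simp add: eventually_at_filter\<close>)
qed

text \<open>The second difference quotient does not depend on the order of the two directions, so both mixed
derivatives are its limit.\<close>

lemma partial_deriv_commute:
  assumes "smooth f"
  shows "partial_deriv i (partial_deriv j f) = partial_deriv j (partial_deriv i f)"
proof
  fix x
  have "((\<lambda>h. (f (x + h *\<^sub>R axis i 1 + h *\<^sub>R axis j 1) - f (x + h *\<^sub>R axis i 1) - f (x + h *\<^sub>R axis j 1) + f x) / h\<^sup>2)
     \<longlongrightarrow> partial_deriv i (partial_deriv j f) x) (at_right 0)"
    using second_difference_limit[OF assms, of x j i] by (simp add: algebra_simps)
  from tendsto_unique[OF _ this second_difference_limit[OF assms]]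
  show "partial_deriv i (partial_deriv j f) x = partial_deriv j (partial_deriv i f) x"
    by simp
qed

lemma partials_permute:
  assumes "smooth f" "mset is = mset js"
  shows "partials is f = partials js f"
  using assms(2)
proof (induction "is" arbitrary: js)
  case (Cons i "is")
  then have "i \<in> set js"
    by (metis list.set_intros(1) mset_eq_setD)
  then obtain as bs where js: "js = as @ i # bs"
    by (meson split_list)
  have front: "partials (as @ i # bs) f = partials (i # as @ bs) f"
  proof (induction as)
    case (Cons a as)
    then show ?case
      using partial_deriv_commute[OF smooth_partials[OF assms(1), of "as @ bs"]] by simp
  qed simp
  have "partials is f = partials (as @ bs) f"
    using Cons js by auto
  with front js show ?case by simp
qed simp

text \<open>Since the order of differentiation is immaterial, the list chosen inside \<open>multi_deriv\<close> may be replaced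
by any list with the same multiplicities.\<close>

lemma partials_eq_multi_deriv:
  assumes "smooth f"
  shows "partials js f = multi_deriv (count_list js) f"
proof -
  have "\<forall>j. count_list (SOME is. \<forall>j. count_list is j = count_list js j) j = count_list js j"
    by (rule someI_ex) auto
  then have "mset js = mset (SOME is. \<forall>j. count_list is j = count_list js j)"
    by (intro multiset_eqI) (simp add: count_mset)
  then show ?thesis
    unfolding multi_deriv_def by (rule partials_permute[OF assms])
qed

lemma multi_deriv_eq_partials:
  "\<exists>js. (\<forall>j. count_list js j = \<beta> j) \<and> multi_deriv \<beta> = partials js"
  unfolding multi_deriv_def using someI_ex[OF multi_index_list_exists[of \<beta>]] by blast

section \<open>Schwartz functions\<close>

lemma multi_power_Suc: "multi_power x (\<alpha>(i := Suc (\<alpha> i))) = x $ i * multi_power x \<alpha>"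
proof -
  have "(\<Prod>j\<in>UNIV - {i}. (x $ j) ^ (\<alpha>(i := Suc (\<alpha> i))) j) = (\<Prod>j\<in>UNIV - {i}. (x $ j) ^ \<alpha> j)"
    by (intro prod.cong) auto
  then show ?thesis
    unfolding multi_power_def by (subst (1 2) prod.remove[of UNIV i]) auto
qed

lemma multi_power_0 [simp]: "multi_power x (\<lambda>_. 0) = 1"
  by (simp add: multi_power_def)

lemma schwartz_smooth: "f \<in> schwartz \<Longrightarrow> smooth f"
  by (simp add: schwartz_def)

lemma schwartz_differentiable: "f \<in> schwartz \<Longrightarrow> f differentiable (at x)"
  by (simp add: schwartz_smooth smooth_imp_differentiable)

text \<open>The Schwartz space is the largest set of differentiable, rapidly decreasing functions that is closed
under partial derivatives. The closure properties below exhibit such a set, and then only the rules for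
first derivatives enter.\<close>

lemma schwartz_coinduct:
  fixes f :: "real^'n::finite \<Rightarrow> real"
  assumes "f \<in> A"
    and diff: "\<And>g x. g \<in> A \<Longrightarrow> g differentiable (at x)"
    and deriv: "\<And>g j. g \<in> A \<Longrightarrow> partial_deriv j g \<in> A"
    and decay: "\<And>g \<alpha>. g \<in> A \<Longrightarrow> bounded (range (\<lambda>x. multi_power x \<alpha> * g x))"
  shows "f \<in> schwartz"
proof -
  have A: "partials js f \<in> A" for js
    by (induction js) (auto simp: assms(1) deriv)
  moreover have "multi_deriv \<beta> f \<in> A" for \<beta>
    using A multi_deriv_eq_partials[of \<beta>] by metis
  ultimately show ?thesis
    unfolding schwartz_def smooth_def differentiable_on_def
    using decay diff differentiable_at_withinI by blast
qed

lemma schwartz_partials: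
  assumes "f \<in> schwartz"
  shows "partials js f \<in> schwartz"
proof -
  have "bounded (range (\<lambda>x. multi_power x \<alpha> * multi_deriv \<beta> (partials js f) x))" for \<alpha> \<beta>
  proof -
    obtain "is" where "multi_deriv \<beta> = partials is"
      using multi_deriv_eq_partials by blast
    then have "multi_deriv \<beta> (partials js f) = multi_deriv (count_list (is @ js)) f"
      using partials_eq_multi_deriv[OF schwartz_smooth[OF assms], of "is @ js"]
      by (simp add: partials_append)
    then show ?thesis
      using assms by (simp only: schwartz_def mem_Collect_eq)
  qed
  then show ?thesis
    using smooth_partials[OF schwartz_smooth[OF assms]] by (simp add: schwartz_def)
qed

lemma schwartz_partial_deriv: "f \<in> schwartz \<Longrightarrow> partial_deriv j f \<in> schwartz"
  using schwartz_partials[of f "[j]"] by simp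

lemma schwartz_multi_deriv: "f \<in> schwartz \<Longrightarrow> multi_deriv \<beta> f \<in> schwartz"
  using multi_deriv_eq_partials[of \<beta>] schwartz_partials by metis

lemma schwartz_bounded_multi_power:
  assumes "f \<in> schwartz"
  shows "bounded (range (\<lambda>x. multi_power x \<alpha> * f x))"
proof -
  have "bounded (range (\<lambda>x. multi_power x \<alpha> * multi_deriv (count_list []) f x))"
    using assms unfolding schwartz_def by blast
  then show ?thesis
    unfolding partials_eq_multi_deriv[OF schwartz_smooth[OF assms], symmetric] partials_Nil .
qed

lemma schwartz_linear_combination:
  fixes f g :: "real^'n::finite \<Rightarrow> real"
  assumes "f \<in> schwartz" "g \<in> schwartz"
  shows "(\<lambda>x. a * f x + b * g x) \<in> schwartz"
proof (rule schwartz_coinduct)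
  let ?A = "{\<lambda>x::real^'n. a * f x + b * g x |f g. f \<in> schwartz \<and> g \<in> schwartz}"
  show "(\<lambda>x. a * f x + b * g x) \<in> ?A"
    using assms by blast
  fix h :: "real^'n \<Rightarrow> real" assume "h \<in> ?A"
  then obtain f g where h: "h = (\<lambda>x. a * f x + b * g x)" and S: "f \<in> schwartz" "g \<in> schwartz"
    by blast
  note d = S[THEN schwartz_differentiable]
  show "h differentiable (at x)" for x
    unfolding h by (intro differentiable_add differentiable_mult differentiable_const d)
  have "partial_deriv j h = (\<lambda>x. a * partial_deriv j f x + b * partial_deriv j g x)" for j
    unfolding h
    by (subst partial_deriv_add) (intro differentiable_mult differentiable_const d, simp_all add: partial_deriv_cmult d)
  then show "partial_deriv j h \<in> ?A" for j
    by (intro CollectI exI[of _ "partial_deriv j f"] exI[of _ "partial_deriv j g"] conjI schwartz_partial_deriv S)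
  show "bounded (range (\<lambda>x. multi_power x \<alpha> * h x))" for \<alpha>
    using bounded_plus_comp[OF bounded_scaleR_comp[OF schwartz_bounded_multi_power[OF S(1)], of a \<alpha>]
        bounded_scaleR_comp[OF schwartz_bounded_multi_power[OF S(2)], of b \<alpha>]]
    by (simp add: h distrib_left mult.left_commute)
qed

lemma schwartz_add: "f \<in> schwartz \<Longrightarrow> g \<in> schwartz \<Longrightarrow> (\<lambda>x. f x + g x) \<in> schwartz"
  using schwartz_linear_combination[of f g 1 1] by simp

lemma schwartz_cmult: "f \<in> schwartz \<Longrightarrow> (\<lambda>x. c * f x) \<in> schwartz"
  using schwartz_linear_combination[of f f c 0] by simp

lemma schwartz_diff: "f \<in> schwartz \<Longrightarrow> g \<in> schwartz \<Longrightarrow> (\<lambda>x. f x - g x) \<in> schwartz"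
  using schwartz_linear_combination[of f g 1 "-1"] by simp

lemma partial_deriv_diff_schwartz:
  assumes "f \<in> schwartz" "g \<in> schwartz"
  shows "partial_deriv j (\<lambda>x. f x - g x) = (\<lambda>x. partial_deriv j f x - partial_deriv j g x)"
  using partial_deriv_add[OF schwartz_differentiable[OF assms(1)] schwartz_differentiable[OF schwartz_cmult[OF assms(2), of "-1"]], of j]
    partial_deriv_cmult[OF schwartz_differentiable[OF assms(2)], of j "-1"]
  by simp

lemma schwartz_0: "(\<lambda>x. 0) \<in> schwartz"
proof (rule schwartz_coinduct[of _ "{\<lambda>x. 0}"])
  show "partial_deriv j g \<in> {\<lambda>x. 0}" if "g \<in> {\<lambda>x. 0}" for j and g :: "real^'n \<Rightarrow> real"
    using that by (simp add: partial_deriv_def fun_eq_iff)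
qed auto

lemma schwartz_coordinate_mult:
  fixes f :: "real^'n::finite \<Rightarrow> real"
  assumes "f \<in> schwartz"
  shows "(\<lambda>x. x $ i * f x) \<in> schwartz"
proof (rule schwartz_coinduct)
  let ?A = "{\<lambda>x::real^'n. f x + x $ i * g x |f g. f \<in> schwartz \<and> g \<in> schwartz}"
  show "(\<lambda>x. x $ i * f x) \<in> ?A"
    using assms schwartz_0 by (intro CollectI exI[of _ "\<lambda>_. 0"] exI[of _ f]) auto
  fix h :: "real^'n \<Rightarrow> real" assume "h \<in> ?A"
  then obtain f g where h: "h = (\<lambda>x. f x + x $ i * g x)" and S: "f \<in> schwartz" "g \<in> schwartz"
    by blast
  note d = schwartz_differentiable[OF S(1)] schwartz_differentiable[OF S(2)]
  show "h differentiable (at x)" for x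
    unfolding h by (intro differentiable_add differentiable_mult d coordinate_differentiable)
  show "partial_deriv j h \<in> ?A" for j
  proof -
    let ?f = "\<lambda>x. partial_deriv j f x + (if i = j then 1 else 0) * g x"
    have "partial_deriv j h = (\<lambda>x. ?f x + x $ i * partial_deriv j g x)"
      unfolding h
      by (subst partial_deriv_add)
        (auto intro!: differentiable_mult d coordinate_differentiable
          simp: partial_deriv_mult[OF coordinate_differentiable d(2)] partial_deriv_coordinate)
    moreover have "?f \<in> schwartz"
      by (intro schwartz_add schwartz_cmult schwartz_partial_deriv S)
    ultimately show ?thesis
      by (intro CollectI exI[of _ ?f] exI[of _ "partial_deriv j g"] conjI schwartz_partial_deriv S)
  qed
  show "bounded (range (\<lambda>x. multi_power x \<alpha> * h x))" for \<alpha>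
    using bounded_plus_comp[OF schwartz_bounded_multi_power[OF S(1), of \<alpha>]
        schwartz_bounded_multi_power[OF S(2), of "\<alpha>(i := Suc (\<alpha> i))"]]
    by (simp add: h distrib_left multi_power_Suc algebra_simps)
qed

lemma multi_power_induct [case_names zero Suc]:
  fixes \<alpha> :: "'n::finite \<Rightarrow> nat"
  assumes "P (\<lambda>_. 0)" "\<And>\<alpha> i. P \<alpha> \<Longrightarrow> P (\<alpha>(i := Suc (\<alpha> i)))"
  shows "P \<alpha>"
proof (induction "sum \<alpha> UNIV" arbitrary: \<alpha>)
  case 0
  then have "\<alpha> = (\<lambda>_. 0)" by auto
  then show ?case using assms(1) by simp
next
  case (Suc n)
  then obtain i where "\<alpha> i \<noteq> 0"
    by (metis Zero_not_Suc sum.neutral)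
  then obtain k where k: "\<alpha> i = Suc k"
    using not0_implies_Suc by blast
  have "sum \<alpha> UNIV = Suc (sum (\<alpha>(i := k)) UNIV)"
  proof -
    have "sum (\<alpha>(i := k)) (UNIV - {i}) = sum \<alpha> (UNIV - {i})"
      by (intro sum.cong) auto
    then show ?thesis
      by (subst (1 2) sum.remove[of UNIV i]) (auto simp: k)
  qed
  then have "P (\<alpha>(i := k))"
    using Suc by simp
  from assms(2)[OF this, of i] k show ?case
    by (simp add: fun_upd_idem)
qed

lemma schwartz_multi_power_mult:
  assumes "f \<in> schwartz"
  shows "(\<lambda>x. multi_power x \<alpha> * f x) \<in> schwartz"
proof (induction \<alpha> rule: multi_power_induct)
  case (Suc \<alpha> i)
  then show ?case
    using schwartz_coordinate_mult[of "\<lambda>x. multi_power x \<alpha> * f x" i]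
    unfolding multi_power_Suc mult.assoc by simp
qed (use assms in simp)

text \<open>In the Leibniz formula for a product with \<open>x $ i\<close>, the coordinate can absorb at most one derivative, and
each of the occurrences of \<open>i\<close> in the list gives the same term.\<close>

lemma partials_coordinate_mult:
  assumes "f \<in> schwartz"
  shows "partials js (\<lambda>x. x $ i * f x)
    = (\<lambda>x. x $ i * partials js f x + real (count_list js i) * partials (remove1 i js) f x)"
proof (induction js)
  case (Cons j js)
  note d = schwartz_differentiable[OF schwartz_partials[OF assms]]
  have "partials (j # js) (\<lambda>x. x $ i * f x) =
      (\<lambda>x. x $ i * partials (j # js) f x + (if i = j then 1 else 0) * partials js f x
        + real (count_list js i) * partial_deriv j (partials (remove1 i js) f) x)"
    unfolding partials_Cons Cons
    by (subst partial_deriv_add)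
      (auto intro!: differentiable_mult d coordinate_differentiable differentiable_const
        simp: partial_deriv_mult[OF coordinate_differentiable d] partial_deriv_coordinate
          partial_deriv_cmult[OF d])
  moreover have "real (count_list js i) * partial_deriv i (partials (remove1 i js) f) x
      = real (count_list js i) * partials js f x" for x
  proof (cases "i \<in> set js")
    case True
    then have "partials (i # remove1 i js) f = partials js f"
      by (intro partials_permute schwartz_smooth assms) simp
    then show ?thesis by simp
  qed simp
  ultimately show ?case
    by (auto simp: fun_eq_iff algebra_simps)
qed simp

section \<open>Decay, integrability and integration by parts\<close>

text \<open>An integrable weight: the product form reduces integrability to dimension one, and its
reciprocal is a polynomial, so that Schwartz functions are dominated by it.\<close>

definition decay_weight :: "real^'n::finite \<Rightarrow> real" where
  "decay_weight x = (\<Prod>j\<in>UNIV. 1 / (1 + (x $ j)\<^sup>2))"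

text \<open>Expanding \<open>\<Prod>j. 1 + (x $ j)\<^sup>2\<close> into monomials, one for each set of coordinates, reduces
the bound to finitely many instances of the defining one.\<close>

lemma schwartz_decay:
  fixes f :: "real^'n::finite \<Rightarrow> real"
  assumes "f \<in> schwartz"
  obtains C where "C \<ge> 0" "\<And>x. \<bar>f x\<bar> \<le> C * decay_weight x"
proof -
  define \<alpha> :: "'n set \<Rightarrow> 'n \<Rightarrow> nat" where "\<alpha> S j = (if j \<in> S then 2 else 0)" for S j
  have "\<exists>C. \<forall>x. \<bar>multi_power x (\<alpha> S) * f x\<bar> \<le> C" for S
    using schwartz_bounded_multi_power[OF assms, of "\<alpha> S"] by (auto simp: bounded_iff)
  then obtain C where C: "\<And>S x. \<bar>multi_power x (\<alpha> S) * f x\<bar> \<le> C S"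
    by metis
  have "\<bar>f x\<bar> \<le> (\<Sum>S\<in>UNIV. C S) * decay_weight x" for x
  proof -
    have "(\<Prod>j\<in>UNIV. (x $ j)\<^sup>2 + 1) = (\<Sum>S\<in>Pow UNIV. multi_power x (\<alpha> S))"
    proof (subst prod_add)
      have "prod ((\<lambda>j. (x $ j)\<^sup>2)) S * prod (\<lambda>j. 1) (UNIV - S) = multi_power x (\<alpha> S)" for S
      proof -
        have "multi_power x (\<alpha> S) = (\<Prod>j\<in>UNIV. if j \<in> S then (x $ j)\<^sup>2 else 1)"
          unfolding multi_power_def \<alpha>_def by (intro prod.cong) auto
        then show ?thesis
          by (simp add: prod.If_cases)
      qed
      then show "(\<Sum>S\<in>Pow UNIV. prod (\<lambda>j. (x $ j)\<^sup>2) S * prod (\<lambda>j. 1) (UNIV - S)) = (\<Sum>S\<in>Pow UNIV. multi_power x (\<alpha> S))"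
        by (simp only:)
    qed simp
    then have "\<bar>(\<Prod>j\<in>UNIV. (x $ j)\<^sup>2 + 1) * f x\<bar> \<le> (\<Sum>S\<in>UNIV. C S)"
      by (simp add: sum_distrib_right) (rule order_trans[OF sum_abs sum_mono[OF C]])
    moreover have "(\<Prod>j\<in>UNIV. (x $ j)\<^sup>2 + 1) > 0"
      by (intro prod_pos) (simp add: add_nonneg_pos)
    ultimately show ?thesis
      by (simp add: decay_weight_def prod_dividef abs_mult field_simps add.commute)
  qed
  moreover have "(\<Sum>S\<in>UNIV. C S) \<ge> 0"
    using C by (intro sum_nonneg) (meson abs_ge_zero order_trans)
  ultimately show ?thesis
    by (rule that[rotated])
qed

lemma multi_deriv_partial_deriv:
  assumes "smooth f"
  shows "multi_deriv \<beta> (partial_deriv j f) = multi_deriv (\<beta>(j := Suc (\<beta> j))) f"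
proof -
  obtain js where js: "\<forall>i. count_list js i = \<beta> i" "multi_deriv \<beta> = partials js"
    using multi_deriv_eq_partials by blast
  have "count_list (js @ [j]) = \<beta>(j := Suc (\<beta> j))"
    using js(1) by auto
  then show ?thesis
    using partials_eq_multi_deriv[OF assms, of "js @ [j]"] js(2) by (simp add: partials_append)
qed

lemma multi_deriv_0: "smooth f \<Longrightarrow> multi_deriv (\<lambda>_. 0) f = f"
  using partials_eq_multi_deriv[of f "[]"] by (simp add: count_list.simps(1)[abs_def])

lemma continuous_on_schwartz: "f \<in> schwartz \<Longrightarrow> continuous_on UNIV f"
  by (intro continuous_at_imp_continuous_on ballI differentiable_imp_continuous_within
      schwartz_differentiable)

lemma schwartz_borel: "f \<in> schwartz \<Longrightarrow> f \<in> borel_measurable borel"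
  by (intro borel_measurable_continuous_onI continuous_on_schwartz)

lemma decay_weight_nonneg: "0 \<le> decay_weight x"
  and decay_weight_le_1: "decay_weight x \<le> 1"
proof -
  show "0 \<le> decay_weight x"
    unfolding decay_weight_def by (intro prod_nonneg) simp
  have "1 / (1 + (x $ j)\<^sup>2) \<le> 1" for j
    by (simp add: divide_simps add_pos_nonneg)
  then show "decay_weight x \<le> 1"
    unfolding decay_weight_def by (intro prod_le_1) simp
qed

lemma decay_weight_borel [measurable]: "decay_weight \<in> borel_measurable borel"
  unfolding decay_weight_def[abs_def] by measurable

lemma nn_integral_inverse_1_plus_square: "(\<integral>\<^sup>+x. ennreal (1 / (1 + x\<^sup>2)) \<partial>lborel) < \<infinity>"
proof -
  let ?f = "\<lambda>x::real. ennreal (1 / (1 + x\<^sup>2))"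
  have half: "(\<integral>\<^sup>+x. ?f x * indicator {0..} x \<partial>lborel) < \<infinity>"
  proof (subst nn_integral_FTC_atLeast[where F = arctan and T = "pi / 2"])
    show "(arctan has_real_derivative 1 / (1 + x\<^sup>2)) (at x)" for x
      using DERIV_arctan[of x] by (simp add: inverse_eq_divide)
  qed (auto intro: tendsto_arctan_at_top)
  have "(\<integral>\<^sup>+x. ?f x * indicator {..0} x \<partial>lborel) = (\<integral>\<^sup>+x. ?f x * indicator {0..} x \<partial>lborel)"
    by (subst nn_integral_real_affine[where c = "-1" and t = 0])
      (auto simp: indicator_def intro!: nn_integral_cong)
  moreover have "(\<integral>\<^sup>+x. ?f x \<partial>lborel) \<le> (\<integral>\<^sup>+x. ?f x * indicator {..0} x + ?f x * indicator {0..} x \<partial>lborel)"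
    by (intro nn_integral_mono) (auto simp: indicator_def)
  ultimately show ?thesis
    using half by (subst (asm) nn_integral_add) (auto simp: order.strict_iff_not top.extremum_unique)
qed

lemma Basis_real_vec: "(Basis :: (real^'n) set) = range (\<lambda>i. axis i 1)"
  by (auto simp: Basis_vec_def)

lemma decay_weight_integrable: "integrable lborel (decay_weight :: real^'n::finite \<Rightarrow> real)"
proof (rule integrableI_nonneg)
  have inj: "inj (\<lambda>i::'n. axis i (1::real))"
    by (auto simp: inj_on_def axis_eq_axis)
  have "ennreal (decay_weight x) = (\<Prod>b\<in>Basis. ennreal (1 / (1 + (inner x b)\<^sup>2)))" for x :: "real^'n"
    unfolding decay_weight_def Basis_real_vec
    by (simp add: prod.reindex[OF inj] inner_axis prod_ennreal add_nonneg_nonneg)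
  then have "(\<integral>\<^sup>+x. ennreal (decay_weight (x :: real^'n)) \<partial>lborel)
      = (\<Prod>b\<in>(Basis::(real^'n) set). (\<integral>\<^sup>+x. ennreal (1 / (1 + x\<^sup>2)) \<partial>lborel))"
    by (simp add: nn_integral_lborel_prod[where f = "\<lambda>b x. ennreal (1 / (1 + x\<^sup>2))"])
  then show "(\<integral>\<^sup>+x. ennreal (decay_weight (x :: real^'n)) \<partial>lborel) < \<infinity>"
    using nn_integral_inverse_1_plus_square by (simp add: power_less_top_ennreal)
qed (auto simp: decay_weight_nonneg)

lemma decay_integrable:
  fixes f :: "real^'n::finite \<Rightarrow> real"
  assumes "f \<in> borel_measurable borel" "\<And>x. \<bar>f x\<bar> \<le> C * decay_weight x"
  shows "integrable lborel f"
proof (rule Bochner_Integration.integrable_bound)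
  show "integrable lborel (\<lambda>x::real^'n. C * decay_weight x)"
    by (rule integrable_mult_right[OF decay_weight_integrable])
  show "AE x in lborel. norm (f x) \<le> norm (C * decay_weight x)"
    using assms(2) by (intro AE_I2) (metis abs_ge_self order_trans real_norm_def)
qed (use assms(1) in simp)

lemma schwartz_mult_decay:
  fixes f g :: "real^'n::finite \<Rightarrow> real"
  assumes "f \<in> schwartz" "g \<in> schwartz"
  obtains C where "C \<ge> 0" "\<And>x. \<bar>f x * g x\<bar> \<le> C * decay_weight x"
proof -
  obtain A where A: "A \<ge> 0" "\<And>x. \<bar>f x\<bar> \<le> A * decay_weight x"
    using schwartz_decay[OF assms(1)] by blast
  obtain B where B: "B \<ge> 0" "\<And>x. \<bar>g x\<bar> \<le> B * decay_weight x"
    using schwartz_decay[OF assms(2)] by blast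
  have "\<bar>f x * g x\<bar> \<le> (A * B) * decay_weight x" for x
  proof -
    have "\<bar>g x\<bar> \<le> B * 1"
      by (rule order_trans[OF B(2)]) (intro mult_left_mono decay_weight_le_1 B(1))
    then have "\<bar>f x\<bar> * \<bar>g x\<bar> \<le> (A * decay_weight x) * (B * 1)"
      using A mult_nonneg_nonneg[OF A(1) decay_weight_nonneg] by (intro mult_mono) auto
    then show ?thesis
      by (simp add: abs_mult mult.commute mult.left_commute)
  qed
  with A(1) B(1) show ?thesis
    by (intro that[of "A * B"]) auto
qed

lemma schwartz_mult_integrable:
  "f \<in> schwartz \<Longrightarrow> g \<in> schwartz \<Longrightarrow> integrable lborel (\<lambda>x. f x * g x)"
  by (metis (no_types) schwartz_mult_decay decay_integrable schwartz_borel borel_measurable_times)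

text \<open>A difference quotient with step at most 1 is a derivative at a point shifted by at most 1; this bound
makes the weight dominate all these quotients at once.\<close>

lemma decay_weight_shift:
  fixes x :: "real^'n::finite"
  assumes "\<bar>s\<bar> \<le> 1"
  shows "decay_weight (x + s *\<^sub>R axis j 1) \<le> 3 * decay_weight x"
proof -
  have "1 / (1 + (x $ j + s)\<^sup>2) \<le> 3 * (1 / (1 + (x $ j)\<^sup>2))"
  proof -
    have "s\<^sup>2 \<le> 1"
      using assms by (simp add: abs_square_le_1)
    \<comment> \<open>\<open>3 (1 + (x + s)\<^sup>2) - (1 + x\<^sup>2)\<close> equals \<open>(2 x + 3 s)\<^sup>2 / 2 + 2 - 3 s\<^sup>2 / 2\<close>.\<close>
    moreover have "0 \<le> (2 * x $ j + 3 * s)\<^sup>2" by simp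
    ultimately have "1 + (x $ j)\<^sup>2 \<le> 3 * (1 + (x $ j + s)\<^sup>2)"
      by (simp add: power2_sum algebra_simps power2_eq_square)
    moreover have "1 + (x $ j)\<^sup>2 > 0" "1 + (x $ j + s)\<^sup>2 > 0"
      by (simp_all add: add_pos_nonneg)
    ultimately show ?thesis
      by (simp add: divide_simps)
  qed
  moreover have "(\<Prod>k\<in>UNIV - {j}. 1 / (1 + ((x + s *\<^sub>R axis j 1) $ k)\<^sup>2)) = (\<Prod>k\<in>UNIV - {j}. 1 / (1 + (x $ k)\<^sup>2))"
    by (intro prod.cong) (auto simp: axis_def)
  moreover have "(\<Prod>k\<in>UNIV - {j}. 1 / (1 + (x $ k)\<^sup>2)) \<ge> 0"
    by (intro prod_nonneg) simp
  ultimately show ?thesis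
    unfolding decay_weight_def
    using mult_right_mono[of "1 / (1 + (x $ j + s)\<^sup>2)" "3 * (1 / (1 + (x $ j)\<^sup>2))" "\<Prod>k\<in>UNIV - {j}. 1 / (1 + (x $ k)\<^sup>2)"]
    by (subst (1 2) prod.remove[of UNIV j]) (auto simp: mult.assoc)
qed

lemma integral_lborel_translate:
  fixes h :: "'a::euclidean_space \<Rightarrow> real"
  assumes "h \<in> borel_measurable borel"
  shows "(\<integral>x. h (x + c) \<partial>lborel) = (\<integral>x. h x \<partial>lborel)"
    and "integrable lborel h \<Longrightarrow> integrable lborel (\<lambda>x. h (x + c))"
proof -
  have eq: "lborel = distr lborel borel (\<lambda>x::'a. x + c)"
    using lborel_distr_plus[of c] unfolding add.commute[of c] by (rule sym)
  show "(\<integral>x. h (x + c) \<partial>lborel) = (\<integral>x. h x \<partial>lborel)"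
    by (subst (2) eq) (use assms in \<open>simp add: integral_distr\<close>)
  show "integrable lborel (\<lambda>x. h (x + c))" if "integrable lborel h"
    using that by (subst (asm) eq) (use assms in \<open>simp add: integrable_distr_eq\<close>)
qed

text \<open>By translation invariance every difference quotient has integral zero, and dominated convergence
passes to the derivative.\<close>

lemma integral_partial_deriv_eq_0:
  fixes h :: "real^'n::finite \<Rightarrow> real"
  assumes diff: "\<And>x. h differentiable (at x)"
    and int: "integrable lborel h"
    and meas: "partial_deriv j h \<in> borel_measurable borel"
    and decay: "\<And>x. \<bar>partial_deriv j h x\<bar> \<le> C * decay_weight x" and "C \<ge> 0"
  shows "(\<integral>x. partial_deriv j h x \<partial>lborel) = 0"
proof -
  let ?e = "axis j 1 :: real^'n"
  define s where "s n = 1 / real (Suc n)" for n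
  have s: "0 < s n" "s n \<le> 1" for n
    by (simp_all add: s_def)
  have s_lim: "filterlim s (at 0) sequentially"
    unfolding filterlim_at using LIMSEQ_inverse_real_of_nat s(1)
    by (auto simp: s_def[abs_def] inverse_eq_divide)
  define q where "q n x = (h (x + s n *\<^sub>R ?e) - h x) / s n" for n x
  have h [measurable]: "h \<in> borel_measurable borel"
    using int borel_measurable_integrable by fastforce
  have [measurable]: "q n \<in> borel_measurable borel" for n
    unfolding q_def by measurable
  have zero: "(\<integral>x. q n x \<partial>lborel) = 0" for n
    unfolding q_def using integral_lborel_translate[OF h, of "s n *\<^sub>R ?e"] int by simp
  have "(\<lambda>n. \<integral>x. q n x \<partial>lborel) \<longlonglongrightarrow> (\<integral>x. partial_deriv j h x \<partial>lborel)"
  proof (rule integral_dominated_convergence)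
    show "integrable lborel (\<lambda>x::real^'n. C * (3 * decay_weight x))"
      by (intro integrable_mult_right decay_weight_integrable)
    have "(\<lambda>n. q n x) \<longlonglongrightarrow> partial_deriv j h x" for x
    proof -
      have "((\<lambda>t. (h (x + t *\<^sub>R ?e) - h x) / t) \<longlongrightarrow> partial_deriv j h x) (at 0)"
        using has_derivative_along_axis[of h x 0 j] diff by (simp add: has_field_derivative_iff)
      from filterlim_compose[OF this s_lim] show ?thesis
        by (simp add: q_def)
    qed
    then show "AE x in lborel. (\<lambda>n. q n x) \<longlonglongrightarrow> partial_deriv j h x"
      by simp
    have "norm (q n x) \<le> C * (3 * decay_weight x)" for n x
    proof -
      obtain z where z: "0 < z" "z < s n" 
        "h (x + s n *\<^sub>R ?e) - h (x + 0 *\<^sub>R ?e) = (s n - 0) * partial_deriv j h (x + z *\<^sub>R ?e)"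
        using MVT2[OF s(1)[of n], of "\<lambda>t. h (x + t *\<^sub>R ?e)", OF has_derivative_along_axis[OF diff]] by auto
      then have "q n x = partial_deriv j h (x + z *\<^sub>R ?e)"
        using s(1)[of n] by (simp add: q_def)
      then have "norm (q n x) \<le> C * decay_weight (x + z *\<^sub>R ?e)"
        using decay by simp
      also have "\<dots> \<le> C * (3 * decay_weight x)"
        using z s(2)[of n] \<open>C \<ge> 0\<close> by (intro mult_left_mono decay_weight_shift) auto
      finally show ?thesis .
    qed
    then show "AE x in lborel. norm (q n x) \<le> C * (3 * decay_weight x)" for n
      by simp
  qed (use meas in measurable)
  then show ?thesis
    by (simp add: zero LIMSEQ_const_iff)
qed

lemma schwartz_integration_by_parts:
  fixes f g :: "real^'n::finite \<Rightarrow> real"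
  assumes S: "f \<in> schwartz" "g \<in> schwartz"
  shows "(\<integral>x. partial_deriv j f x * g x \<partial>lborel) = - (\<integral>x. f x * partial_deriv j g x \<partial>lborel)"
proof -
  note d = schwartz_differentiable[OF S(1)] schwartz_differentiable[OF S(2)]
  note D = S[THEN schwartz_partial_deriv, of j]
  have eq: "partial_deriv j (\<lambda>x. f x * g x) = (\<lambda>x. f x * partial_deriv j g x + partial_deriv j f x * g x)"
    by (rule partial_deriv_mult[OF d])
  obtain A where A: "A \<ge> 0" "\<And>x. \<bar>f x * partial_deriv j g x\<bar> \<le> A * decay_weight x"
    using schwartz_mult_decay[OF S(1) D(2)] by blast
  obtain B where B: "B \<ge> 0" "\<And>x. \<bar>partial_deriv j f x * g x\<bar> \<le> B * decay_weight x"
    using schwartz_mult_decay[OF D(1) S(2)] by blast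
  have "(\<integral>x. partial_deriv j (\<lambda>x. f x * g x) x \<partial>lborel) = 0"
  proof (rule integral_partial_deriv_eq_0)
    show "(\<lambda>x. f x * g x) differentiable (at x)" for x
      by (intro differentiable_mult d)
    show "integrable lborel (\<lambda>x. f x * g x)"
      by (rule schwartz_mult_integrable[OF S])
    show "partial_deriv j (\<lambda>x. f x * g x) \<in> borel_measurable borel"
      unfolding eq by (intro borel_measurable_add borel_measurable_times schwartz_borel S D)
    show "\<bar>partial_deriv j (\<lambda>x. f x * g x) x\<bar> \<le> (A + B) * decay_weight x" for x
      unfolding eq distrib_right by (rule order_trans[OF abs_triangle_ineq add_mono[OF A(2) B(2)]])
  qed (use A(1) B(1) in simp)
  then show ?thesis
    unfolding eq using schwartz_mult_integrable[OF S(1) D(2)] schwartz_mult_integrable[OF D(1) S(2)]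
    by simp
qed

section \<open>A Sobolev inequality\<close>

text \<open>Integrate \<open>- (g\<^sup>2)' = - 2 g g' \<le> g\<^sup>2 + g'\<^sup>2\<close> over the half-line \<open>s \<ge> 0\<close>.\<close>

lemma square_le_nn_integral_line:
  fixes g :: "real \<Rightarrow> real"
  assumes der: "\<And>s. (g has_real_derivative g' s) (at s)"
    and cont: "continuous_on UNIV g'"
    and lim: "(\<lambda>n. g (real n)) \<longlonglongrightarrow> 0"
  shows "ennreal ((g 0)\<^sup>2) \<le> (\<integral>\<^sup>+s. ennreal ((g s)\<^sup>2 + (g' s)\<^sup>2) \<partial>lborel)"
    (is "_ \<le> ?J")
proof -
  have cg: "continuous_on A g" for A
    by (intro continuous_at_imp_continuous_on ballI DERIV_isCont[OF der])
  have cg': "continuous_on A g'" for A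
    using cont continuous_on_subset by blast
  have le: "ennreal ((g 0)\<^sup>2) \<le> ennreal ((g (real n))\<^sup>2) + ?J" for n
  proof -
    let ?q = "\<lambda>s. (g s)\<^sup>2 + (g' s)\<^sup>2"
    have int: "(?q has_integral integral {0..real n} ?q) {0..real n}"
      by (intro integrable_integral integrable_continuous_real continuous_intros cg cg')
    have "((\<lambda>s. 2 * g s * g' s) has_integral (g (real n))\<^sup>2 - (g 0)\<^sup>2) {0..real n}"
    proof (rule fundamental_theorem_of_calculus)
      fix s assume "s \<in> {0..real n}"
      show "((\<lambda>s. (g s)\<^sup>2) has_vector_derivative 2 * g s * g' s) (at s within {0..real n})"
        unfolding has_real_derivative_iff_has_vector_derivative[symmetric]
        by (rule DERIV_subset[OF _ subset_UNIV]) (auto intro!: derivative_eq_intros der)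
    qed simp
    from has_integral_neg[OF this] have "- ((g (real n))\<^sup>2 - (g 0)\<^sup>2) \<le> integral {0..real n} ?q"
    proof (rule has_integral_le[OF _ int])
      fix s
      show "- (2 * g s * g' s) \<le> (g s)\<^sup>2 + (g' s)\<^sup>2"
        using zero_le_power2[of "g s + g' s"] by (simp add: power2_sum)
    qed
    then have "ennreal ((g 0)\<^sup>2) \<le> ennreal ((g (real n))\<^sup>2 + integral {0..real n} ?q)"
      by (intro ennreal_leI) simp
    also have "\<dots> = ennreal ((g (real n))\<^sup>2) + ennreal (integral {0..real n} ?q)"
      by (intro ennreal_plus integral_nonneg) (use int in \<open>auto simp: has_integral_integrable\<close>)
    also have "ennreal (integral {0..real n} ?q) = (\<integral>\<^sup>+s. ennreal (indicator {0..real n} s * ?q s) \<partial>lborel)"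
      by (rule nn_integral_has_integral_lebesgue[OF _ int, symmetric]) simp
    also have "\<dots> \<le> ?J"
      by (intro nn_integral_mono ennreal_leI) (auto simp: indicator_def)
    finally show ?thesis
      by (simp add: add_left_mono)
  qed
  have "(\<lambda>n. ennreal ((g (real n))\<^sup>2) + ?J) \<longlonglongrightarrow> ennreal (0\<^sup>2) + ?J"
    by (intro tendsto_add tendsto_const tendsto_ennrealI tendsto_power lim)
  then have "(\<lambda>n. ennreal ((g (real n))\<^sup>2) + ?J) \<longlonglongrightarrow> ?J"
    by simp
  then show ?thesis
    by (rule LIMSEQ_le_const) (use le in auto)
qed

text \<open>The multi-index that differentiates once in each of the given directions. The directions are basis
vectors because Lebesgue measure is a product measure over \<open>Basis\<close>.\<close>

definition basis_index :: "(real^'n) set \<Rightarrow> 'n::finite \<Rightarrow> nat" where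
  "basis_index B i = (if axis i 1 \<in> B then 1 else 0)"

lemma multi_deriv_basis_index_insert:
  assumes "smooth f" "axis j 1 \<notin> B"
  shows "multi_deriv (basis_index B) (partial_deriv j f) = multi_deriv (basis_index (insert (axis j 1) B)) f"
proof -
  have "(basis_index B)(j := Suc (basis_index B j)) = basis_index (insert (axis j 1) B)"
    using assms(2) by (auto simp: basis_index_def fun_eq_iff axis_eq_axis)
  then show ?thesis
    by (simp add: multi_deriv_partial_deriv[OF assms(1)])
qed

lemma schwartz_tendsto_0_along_axis:
  assumes "f \<in> schwartz"
  shows "(\<lambda>n. f (x + real n *\<^sub>R axis j 1)) \<longlonglongrightarrow> 0"
proof -
  have "bounded (range (\<lambda>x. multi_power x ((\<lambda>_. 0)(j := Suc 0)) * f x))"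
    by (rule schwartz_bounded_multi_power[OF assms])
  moreover have "multi_power y ((\<lambda>_. 0)(j := Suc 0)) = y $ j" for y :: "real^'a"
    using multi_power_Suc[of y "\<lambda>_. 0" j] by simp
  ultimately obtain C where C: "\<And>y. \<bar>y $ j * f y\<bar> \<le> C"
    by (auto simp: bounded_iff)
  show ?thesis
  proof (rule Lim_null_comparison)
    have "norm (f (x + real n *\<^sub>R axis j 1)) \<le> C / (x $ j + real n)" if "n \<ge> nat \<lceil>1 - x $ j\<rceil>" for n
    proof -
      have "x $ j + real n > 0"
        using that by linarith
      then show ?thesis
        using C[of "x + real n *\<^sub>R axis j 1"] by (simp add: abs_mult pos_le_divide_eq mult.commute)
    qed
    then show "\<forall>\<^sub>F n in sequentially. norm (f (x + real n *\<^sub>R axis j 1)) \<le> C / (x $ j + real n)"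
      by (rule eventually_sequentiallyI)
    show "(\<lambda>n. C / (x $ j + real n)) \<longlonglongrightarrow> 0"
      by (intro tendsto_divide_0[OF tendsto_const] filterlim_at_top_imp_at_infinity
          filterlim_tendsto_add_at_top[OF tendsto_const] filterlim_real_sequentially)
  qed
qed

text \<open>The one-dimensional inequality is used along one axis after the other. Each use replaces a function by
the function and its derivative in the new direction, which leads to the sum over all subsets.\<close>

lemma schwartz_square_le_integral_over_axes:
  fixes f :: "real^'n::finite \<Rightarrow> real" and x :: "real^'n"
  assumes "J \<subseteq> Basis" "f \<in> schwartz"
  shows "ennreal ((f x)\<^sup>2) \<le> (\<Sum>B\<in>Pow J. \<integral>\<^sup>+y. ennreal ((multi_deriv (basis_index B) f (x + (\<Sum>b\<in>J. y b *\<^sub>R b)))\<^sup>2)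
      \<partial>Pi\<^sub>M J (\<lambda>_. lborel))"
proof -
  have "finite J"
    using assms(1) finite_subset finite_Basis by blast
  from this assms show ?thesis
  proof (induction J arbitrary: f x rule: finite_induct)
    case empty
    interpret product_sigma_finite "\<lambda>_::real^'n. lborel :: real measure" ..
    have "basis_index {} = (\<lambda>_::'n. 0)"
      by (auto simp: basis_index_def)
    then show ?case
      using empty by (simp del: nn_integral_const add: nn_integral_empty multi_deriv_0 schwartz_smooth)
  next
    case (insert b J)
    interpret product_sigma_finite "\<lambda>_::real^'n. lborel :: real measure" ..
    obtain j where b: "b = axis j 1"
      using insert.prems by (auto simp: Basis_real_vec)
    let ?I = "\<lambda>f J B x. \<integral>\<^sup>+y. ennreal ((multi_deriv (basis_index B) f (x + (\<Sum>b\<in>J. y b *\<^sub>R b)))\<^sup>2)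
      \<partial>Pi\<^sub>M J (\<lambda>_. lborel)"
    let ?F = "partial_deriv j f"
    have meas: "multi_deriv \<beta> g \<in> borel_measurable borel" if "g \<in> schwartz" for \<beta> and g :: "real^'n \<Rightarrow> real"
      by (intro schwartz_borel schwartz_multi_deriv that)
    note S = insert.prems(2) schwartz_partial_deriv[OF insert.prems(2), of j]
    note [measurable] = meas[OF S(1)] meas[OF S(2)]
    have measI [measurable]: "(\<lambda>s. ?I g J B (x + s *\<^sub>R b)) \<in> borel_measurable lborel" if "g \<in> schwartz" for g B
    proof -
      interpret J: sigma_finite_measure "Pi\<^sub>M J (\<lambda>_. lborel :: real measure)"
        by (rule sigma_finite[OF insert.hyps(1)])
      show ?thesis
        by (rule J.borel_measurable_nn_integral) (use meas[OF that] in measurable)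
    qed
    have step: "(\<integral>\<^sup>+s. ?I f J B (x + s *\<^sub>R b) \<partial>lborel) = ?I f (insert b J) B x" for B
    proof -
      have "(\<Sum>i\<in>J. (if i = b then s else y i) *\<^sub>R i) = (\<Sum>i\<in>J. y i *\<^sub>R i)" for s and y :: "real^'n \<Rightarrow> real"
        using insert.hyps(2) by (intro sum.cong) auto
      then show ?thesis
        by (subst product_nn_integral_insert_rev[OF insert.hyps(1,2)])
          (use insert.hyps S in \<open>simp_all add: add.assoc\<close>)
    qed
    have disj: "Pow J \<inter> insert b ` Pow J = {}"
      using insert.hyps(2) by auto
    have inj: "inj_on (insert b) (Pow J)"
      using insert.hyps(2) by (auto simp: inj_on_def)
    have "ennreal ((f x)\<^sup>2) \<le> (\<integral>\<^sup>+s. ennreal ((f (x + s *\<^sub>R b))\<^sup>2 + (?F (x + s *\<^sub>R b))\<^sup>2) \<partial>lborel)"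
    proof -
      have "ennreal ((f (x + 0 *\<^sub>R b))\<^sup>2) \<le> (\<integral>\<^sup>+s. ennreal ((f (x + s *\<^sub>R b))\<^sup>2 + (?F (x + s *\<^sub>R b))\<^sup>2) \<partial>lborel)"
        unfolding b
      proof (rule square_le_nn_integral_line)
        show "((\<lambda>s. f (x + s *\<^sub>R axis j 1)) has_real_derivative ?F (x + s *\<^sub>R axis j 1)) (at s)" for s
          by (intro has_derivative_along_axis schwartz_differentiable S)
        show "continuous_on UNIV (\<lambda>s. ?F (x + s *\<^sub>R axis j 1))"
          by (rule continuous_on_compose2[OF continuous_on_schwartz[OF S(2)]]) (auto intro!: continuous_intros)
        show "(\<lambda>n. f (x + real n *\<^sub>R axis j 1)) \<longlonglongrightarrow> 0"
          by (rule schwartz_tendsto_0_along_axis[OF S(1)])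
      qed
      then show ?thesis by simp
    qed
    also have "\<dots> \<le> (\<integral>\<^sup>+s. (\<Sum>B\<in>Pow J. ?I f J B (x + s *\<^sub>R b)) + (\<Sum>B\<in>Pow J. ?I ?F J B (x + s *\<^sub>R b)) \<partial>lborel)"
      using insert.prems(1) insert.IH[OF _ S(1)] insert.IH[OF _ S(2)]
      by (intro nn_integral_mono) (simp add: add_mono)
    also have "\<dots> = (\<Sum>B\<in>Pow J. \<integral>\<^sup>+s. ?I f J B (x + s *\<^sub>R b) \<partial>lborel) + (\<Sum>B\<in>Pow J. \<integral>\<^sup>+s. ?I ?F J B (x + s *\<^sub>R b) \<partial>lborel)"
      using measI S by (subst nn_integral_add) (auto intro!: borel_measurable_sum simp: nn_integral_sum)
    also have "(\<Sum>B\<in>Pow J. \<integral>\<^sup>+s. ?I ?F J B (x + s *\<^sub>R b) \<partial>lborel)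
        = (\<Sum>B\<in>Pow J. \<integral>\<^sup>+s. ?I f J (insert b B) (x + s *\<^sub>R b) \<partial>lborel)"
    proof (rule sum.cong)
      fix B assume "B \<in> Pow J"
      then have "axis j 1 \<notin> B"
        using insert.hyps(2) b by auto
      from multi_deriv_basis_index_insert[OF schwartz_smooth[OF S(1)] this]
      show "(\<integral>\<^sup>+s. ?I ?F J B (x + s *\<^sub>R b) \<partial>lborel) = (\<integral>\<^sup>+s. ?I f J (insert b B) (x + s *\<^sub>R b) \<partial>lborel)"
        by (simp add: b)
    qed simp
    also have "(\<Sum>B\<in>Pow J. \<integral>\<^sup>+s. ?I f J B (x + s *\<^sub>R b) \<partial>lborel)
        + (\<Sum>B\<in>Pow J. \<integral>\<^sup>+s. ?I f J (insert b B) (x + s *\<^sub>R b) \<partial>lborel)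
        = (\<Sum>B\<in>Pow (insert b J). ?I f (insert b J) B x)"
      unfolding step Pow_insert using insert.hyps(1)
      by (subst sum.union_disjoint) (auto simp: disj sum.reindex[OF inj])
    finally show ?case .
  qed
qed

text \<open>The integrals over all axes together are integrals over the whole space, by translation invariance
independent of \<open>x\<close>. The bound costs \<open>CARD('n)\<close> derivatives, more than the optimal number; the loss is
harmless where all orders are at hand.\<close>

lemma schwartz_sobolev:
  fixes f :: "real^'n::finite \<Rightarrow> real"
  assumes "f \<in> schwartz"
  shows "(f x)\<^sup>2 \<le> (\<Sum>B\<in>Pow Basis. \<integral>z. (multi_deriv (basis_index B) f z)\<^sup>2 \<partial>lborel)"
proof -
  note S = schwartz_multi_deriv[OF assms]
  have int: "integrable lborel (\<lambda>z. (multi_deriv \<beta> f z)\<^sup>2)" for \<beta>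
    unfolding power2_eq_square by (rule schwartz_mult_integrable[OF S S])
  have [measurable]: "multi_deriv \<beta> f \<in> borel_measurable borel" for \<beta>
    by (rule schwartz_borel[OF S])
  have "(\<integral>\<^sup>+y. ennreal ((multi_deriv \<beta> f (x + (\<Sum>b\<in>Basis. y b *\<^sub>R b)))\<^sup>2) \<partial>Pi\<^sub>M Basis (\<lambda>_. lborel))
      = ennreal (\<integral>z. (multi_deriv \<beta> f z)\<^sup>2 \<partial>lborel)" for \<beta>
  proof -
    have "(\<integral>\<^sup>+y. ennreal ((multi_deriv \<beta> f (x + (\<Sum>b\<in>Basis. y b *\<^sub>R b)))\<^sup>2) \<partial>Pi\<^sub>M Basis (\<lambda>_. lborel))
      = (\<integral>\<^sup>+z. ennreal ((multi_deriv \<beta> f (x + z))\<^sup>2) \<partial>lborel)"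
      by (subst (2) lborel_eq) (simp add: nn_integral_distr)
    also have "\<dots> = (\<integral>\<^sup>+z. ennreal ((multi_deriv \<beta> f z)\<^sup>2) \<partial>lborel)"
      by (subst (2) lborel_distr_plus[of x, symmetric]) (simp add: nn_integral_distr)
    also have "\<dots> = ennreal (\<integral>z. (multi_deriv \<beta> f z)\<^sup>2 \<partial>lborel)"
      by (rule nn_integral_eq_integral[OF int]) simp
    finally show ?thesis .
  qed
  then have "ennreal ((f x)\<^sup>2) \<le> (\<Sum>B\<in>Pow Basis. ennreal (\<integral>z. (multi_deriv (basis_index B) f z)\<^sup>2 \<partial>lborel))"
    using schwartz_square_le_integral_over_axes[OF order_refl assms, of x] by simp
  also have "\<dots> = ennreal (\<Sum>B\<in>Pow Basis. \<integral>z. (multi_deriv (basis_index B) f z)\<^sup>2 \<partial>lborel)"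
    by (rule sum_ennreal) simp
  finally show ?thesis
    by (subst (asm) ennreal_le_iff) (auto intro: sum_nonneg)
qed

section \<open>Square-integrable functions\<close>

text \<open>\<open>L2fun\<close> and \<open>l2\<close> are the counterparts of \<open>L2\<close> and \<open>L2_norm\<close> on representatives, where
pointwise estimates can be made.\<close>

definition L2fun :: "(real^'n::finite \<Rightarrow> real) set" where
  "L2fun = {f. f \<in> borel_measurable borel \<and> integrable lborel (\<lambda>x. (f x)\<^sup>2)}"

definition l2 :: "(real^'n::finite \<Rightarrow> real) \<Rightarrow> real" where
  "l2 f = sqrt (\<integral>x. (f x)\<^sup>2 \<partial>lborel)"

lemma L2fun_borel: "f \<in> L2fun \<Longrightarrow> f \<in> borel_measurable borel"
  by (simp add: L2fun_def)

lemma L2fun_square_integrable: "f \<in> L2fun \<Longrightarrow> integrable lborel (\<lambda>x. (f x)\<^sup>2)"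
  by (simp add: L2fun_def)

lemma schwartz_L2fun: "f \<in> schwartz \<Longrightarrow> f \<in> L2fun"
  using schwartz_mult_integrable[of f f] by (simp add: L2fun_def schwartz_borel power2_eq_square)

lemma l2_nonneg [simp]: "0 \<le> l2 f"
  by (simp add: l2_def)

lemma l2_square: "(l2 f)\<^sup>2 = (\<integral>x. (f x)\<^sup>2 \<partial>lborel)"
  by (simp add: l2_def)

lemma L2fun_mult_integrable:
  assumes "f \<in> L2fun" "g \<in> L2fun"
  shows "integrable lborel (\<lambda>x. f x * g x)"
proof (rule Bochner_Integration.integrable_bound)
  show "integrable lborel (\<lambda>x. (f x)\<^sup>2 + (g x)\<^sup>2)"
    using assms by (intro Bochner_Integration.integrable_add L2fun_square_integrable)
  have "\<bar>a * b\<bar> \<le> \<bar>a\<^sup>2 + b\<^sup>2\<bar>" for a b :: real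
  proof -
    have "2 * \<bar>a\<bar> * \<bar>b\<bar> \<le> a\<^sup>2 + b\<^sup>2"
      using zero_le_power2[of "\<bar>a\<bar> - \<bar>b\<bar>"] by (simp add: power2_diff)
    then show ?thesis
      using mult_nonneg_nonneg[of "\<bar>a\<bar>" "\<bar>b\<bar>"] unfolding abs_mult by linarith
  qed
  then show "AE x in lborel. norm (f x * g x) \<le> norm ((f x)\<^sup>2 + (g x)\<^sup>2)"
    by simp
qed (use assms L2fun_borel in measurable)

lemma L2fun_cmult: "f \<in> L2fun \<Longrightarrow> (\<lambda>x. c * f x) \<in> L2fun"
  by (auto simp: L2fun_def power_mult_distrib)

lemma L2fun_add: "f \<in> L2fun \<Longrightarrow> g \<in> L2fun \<Longrightarrow> (\<lambda>x. f x + g x) \<in> L2fun"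
  using L2fun_mult_integrable[of f g] by (auto simp: L2fun_def power2_sum mult.assoc)

lemma L2fun_diff: "f \<in> L2fun \<Longrightarrow> g \<in> L2fun \<Longrightarrow> (\<lambda>x. f x - g x) \<in> L2fun"
  using L2fun_mult_integrable[of f g] by (auto simp: L2fun_def power2_diff mult.assoc)

lemma L2fun_sum: "(\<And>i. i \<in> A \<Longrightarrow> f i \<in> L2fun) \<Longrightarrow> (\<lambda>x. \<Sum>i\<in>A. f i x) \<in> L2fun"
proof (induction A rule: infinite_finite_induct)
  case (insert a A)
  then show ?case
    using L2fun_add[of "f a" "\<lambda>x. \<Sum>i\<in>A. f i x"] by simp
qed (simp_all add: L2fun_def)

lemma discriminant_le:
  fixes a b c :: real
  assumes nonneg: "\<And>s. 0 \<le> a + 2 * s * b + s\<^sup>2 * c" and "c \<ge> 0"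
  shows "b\<^sup>2 \<le> a * c"
proof (cases "c = 0")
  case True
  have "0 \<le> a + 2 * ((-a - 1) / (2 * b)) * b"
    using nonneg[of "(-a - 1) / (2 * b)"] True by simp
  then have "b = 0"
    by (cases "b = 0") (auto simp: field_simps)
  with True show ?thesis by simp
next
  case False
  have "0 \<le> a + 2 * (- b / c) * b + (- b / c)\<^sup>2 * c"
    by (rule nonneg)
  also have "\<dots> = (a * c - b\<^sup>2) / c"
    using False by (simp add: field_simps power2_eq_square)
  finally show ?thesis
    using False \<open>c \<ge> 0\<close> by (simp add: zero_le_divide_iff)
qed

text \<open>The polynomial \<open>s \<mapsto> \<parallel>f + s g\<parallel>\<^sup>2\<close> is nonnegative, so its discriminant is not positive.\<close>

lemma L2_cauchy_schwarz:
  assumes "f \<in> L2fun" "g \<in> L2fun"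
  shows "\<bar>\<integral>x. f x * g x \<partial>lborel\<bar> \<le> l2 f * l2 g"
proof -
  have "0 \<le> (l2 f)\<^sup>2 + 2 * s * (\<integral>x. f x * g x \<partial>lborel) + s\<^sup>2 * (l2 g)\<^sup>2" for s
  proof -
    have "0 \<le> (\<integral>x. (f x + s * g x)\<^sup>2 \<partial>lborel)"
      by simp
    also have "\<dots> = (\<integral>x. (f x)\<^sup>2 + (2 * s) * (f x * g x) + s\<^sup>2 * (g x)\<^sup>2 \<partial>lborel)"
      by (simp add: power2_sum power_mult_distrib algebra_simps)
    also have "\<dots> = (l2 f)\<^sup>2 + 2 * s * (\<integral>x. f x * g x \<partial>lborel) + s\<^sup>2 * (l2 g)\<^sup>2"
      using assms L2fun_mult_integrable[OF assms] by (simp add: l2_square L2fun_square_integrable)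
    finally show ?thesis .
  qed
  then have "(\<integral>x. f x * g x \<partial>lborel)\<^sup>2 \<le> (l2 f)\<^sup>2 * (l2 g)\<^sup>2"
    by (rule discriminant_le) simp
  then show ?thesis
    by (metis abs_le_square_iff abs_of_nonneg l2_nonneg mult_nonneg_nonneg power_mult_distrib)
qed

lemma l2_cmult: "l2 (\<lambda>x. c * f x) = \<bar>c\<bar> * l2 f"
  by (simp add: l2_def power_mult_distrib real_sqrt_mult)

lemma l2_add_le:
  assumes "f \<in> L2fun" "g \<in> L2fun"
  shows "l2 (\<lambda>x. f x + g x) \<le> l2 f + l2 g"
proof (rule power2_le_imp_le)
  have "(l2 (\<lambda>x. f x + g x))\<^sup>2 = (\<integral>x. (f x)\<^sup>2 + (g x)\<^sup>2 + 2 * (f x * g x) \<partial>lborel)"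
    by (simp add: l2_square power2_sum mult.assoc)
  also have "\<dots> = (l2 f)\<^sup>2 + (l2 g)\<^sup>2 + 2 * (\<integral>x. f x * g x \<partial>lborel)"
    using assms L2fun_mult_integrable[OF assms] by (simp add: l2_square L2fun_square_integrable)
  also have "\<dots> \<le> (l2 f)\<^sup>2 + (l2 g)\<^sup>2 + 2 * (l2 f * l2 g)"
    using L2_cauchy_schwarz[OF assms] by (simp add: abs_le_iff)
  finally show "(l2 (\<lambda>x. f x + g x))\<^sup>2 \<le> (l2 f + l2 g)\<^sup>2"
    by (simp add: power2_sum mult.assoc)
qed simp

lemma l2_minus_commute: "l2 (\<lambda>x. f x - g x) = l2 (\<lambda>x. g x - f x)"
  by (simp add: l2_def power2_commute)

lemma l2_diff_triangle:
  assumes "f \<in> L2fun" "g \<in> L2fun" "h \<in> L2fun"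
  shows "l2 (\<lambda>x. f x - h x) \<le> l2 (\<lambda>x. f x - g x) + l2 (\<lambda>x. g x - h x)"
  using l2_add_le[OF L2fun_diff[OF assms(1,2)] L2fun_diff[OF assms(2,3)]] by simp

lemma l2_diff_diff_le:
  assumes "f \<in> L2fun" "f' \<in> L2fun" "h \<in> L2fun" "h' \<in> L2fun"
  shows "l2 (\<lambda>x. (f x - h x) - (f' x - h' x)) \<le> l2 (\<lambda>x. f x - f' x) + l2 (\<lambda>x. h x - h' x)"
proof -
  have "l2 (\<lambda>x. (f x - f' x) + (h' x - h x)) \<le> l2 (\<lambda>x. f x - f' x) + l2 (\<lambda>x. h' x - h x)"
    by (intro l2_add_le L2fun_diff assms)
  moreover have "(\<lambda>x. (f x - f' x) + (h' x - h x)) = (\<lambda>x. (f x - h x) - (f' x - h' x))"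
    by (simp add: fun_eq_iff)
  ultimately show ?thesis
    unfolding l2_minus_commute[of h'] by simp
qed

lemma l2_sum_le:
  assumes "\<And>i. i \<in> A \<Longrightarrow> f i \<in> L2fun"
  shows "l2 (\<lambda>x. \<Sum>i\<in>A. f i x) \<le> (\<Sum>i\<in>A. l2 (f i))"
  using assms
proof (induction A rule: infinite_finite_induct)
  case (insert a A)
  have "l2 (\<lambda>x. f a x + (\<Sum>i\<in>A. f i x)) \<le> l2 (f a) + l2 (\<lambda>x. \<Sum>i\<in>A. f i x)"
    using insert.prems by (intro l2_add_le L2fun_sum) auto
  with insert show ?case by fastforce
qed (simp_all add: l2_def)

lemma
  assumes "f \<in> L2fun" and g: "g \<in> borel_measurable borel" "\<And>x. \<bar>g x\<bar> \<le> M"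
  shows L2fun_bounded_mult: "(\<lambda>x. g x * f x) \<in> L2fun"
    and l2_bounded_mult_le: "l2 (\<lambda>x. g x * f x) \<le> M * l2 f"
proof -
  have "M \<ge> 0" using g(2) by (meson abs_ge_zero order_trans)
  have le: "(g x * f x)\<^sup>2 \<le> M\<^sup>2 * (f x)\<^sup>2" for x
    unfolding power_mult_distrib using g(2)[of x] by (intro mult_right_mono) (auto simp: abs_le_square_iff[symmetric] \<open>M \<ge> 0\<close>)
  have int: "integrable lborel (\<lambda>x. M\<^sup>2 * (f x)\<^sup>2)"
    using assms(1) by (intro integrable_mult_right L2fun_square_integrable)
  have int': "integrable lborel (\<lambda>x. (g x * f x)\<^sup>2)"
    by (rule Bochner_Integration.integrable_bound[OF int]) (use L2fun_borel[OF assms(1)] g(1) le in \<open>auto intro!: borel_measurable_power borel_measurable_times\<close>)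
  then show "(\<lambda>x. g x * f x) \<in> L2fun"
    using borel_measurable_times[OF g(1) L2fun_borel[OF assms(1)]] by (simp add: L2fun_def)
  have "(l2 (\<lambda>x. g x * f x))\<^sup>2 \<le> (M * l2 f)\<^sup>2"
    using integral_mono[OF int' int le] by (simp add: l2_square power_mult_distrib)
  then show "l2 (\<lambda>x. g x * f x) \<le> M * l2 f"
    by (rule power2_le_imp_le) (simp add: \<open>M \<ge> 0\<close>)
qed

section \<open>The norms on the Schwartz space\<close>

definition weighted_deriv :: "('n::finite \<Rightarrow> nat) \<times> ('n \<Rightarrow> nat) \<Rightarrow> (real^'n \<Rightarrow> real) \<Rightarrow> real^'n \<Rightarrow> real" where
  "weighted_deriv ab f x = multi_power x (fst ab) * multi_deriv (snd ab) f x"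

lemma schwartz_weighted_deriv: "f \<in> schwartz \<Longrightarrow> weighted_deriv ab f \<in> schwartz"
  unfolding weighted_deriv_def[abs_def]
  by (intro schwartz_multi_power_mult schwartz_multi_deriv)

lemma weighted_deriv_L2fun: "f \<in> schwartz \<Longrightarrow> weighted_deriv ab f \<in> L2fun"
  by (intro schwartz_L2fun schwartz_weighted_deriv)

lemma weighted_deriv_linear_combination:
  assumes "f \<in> schwartz" "g \<in> schwartz"
  shows "weighted_deriv ab (\<lambda>x. a * f x + b * g x) = (\<lambda>x. a * weighted_deriv ab f x + b * weighted_deriv ab g x)"
proof -
  note d = assms[THEN schwartz_partials, THEN schwartz_differentiable]
  have "partials js (\<lambda>x. a * f x + b * g x) = (\<lambda>x. a * partials js f x + b * partials js g x)" for js
  proof (induction js)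
    case (Cons j js)
    show ?case
      unfolding partials_Cons Cons
      by (subst partial_deriv_add) (intro differentiable_mult differentiable_const d, simp_all add: partial_deriv_cmult d)
  qed simp
  moreover obtain js where "multi_deriv (snd ab) = partials js"
    using multi_deriv_eq_partials by blast
  ultimately show ?thesis
    unfolding weighted_deriv_def[abs_def] by (simp only: distrib_left mult.left_commute)
qed

lemma
  assumes "f \<in> schwartz" "g \<in> schwartz"
  shows weighted_deriv_add: "weighted_deriv ab (\<lambda>x. f x + g x) = (\<lambda>x. weighted_deriv ab f x + weighted_deriv ab g x)"
    and weighted_deriv_diff: "weighted_deriv ab (\<lambda>x. f x - g x) = (\<lambda>x. weighted_deriv ab f x - weighted_deriv ab g x)"
  using weighted_deriv_linear_combination[OF assms, of ab 1 1] weighted_deriv_linear_combination[OF assms, of ab 1 "-1"]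
  by simp_all

lemma weighted_deriv_cmult:
  "f \<in> schwartz \<Longrightarrow> weighted_deriv ab (\<lambda>x. c * f x) = (\<lambda>x. c * weighted_deriv ab f x)"
  using weighted_deriv_linear_combination[of f f ab c 0] by simp

lemma schwartz_inner_eq:
  "schwartz_inner p f g = (\<Sum>ab\<in>multi_index_pairs (2 * p). \<integral>x. weighted_deriv ab f x * weighted_deriv ab g x \<partial>lborel)"
  by (simp add: schwartz_inner_def weighted_deriv_def case_prod_beta')

lemma schwartz_inner_diff_right:
  assumes "f \<in> schwartz" "g \<in> schwartz" "h \<in> schwartz"
  shows "schwartz_inner p f (\<lambda>x. g x - h x) = schwartz_inner p f g - schwartz_inner p f h"
  unfolding schwartz_inner_eq sum_subtractf[symmetric] weighted_deriv_diff[OF assms(2,3)] right_diff_distrib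
  by (intro sum.cong refl Bochner_Integration.integral_diff schwartz_mult_integrable
      schwartz_weighted_deriv assms)

text \<open>As a Euclidean combination of \<open>L\<^sup>2\<close> norms the norm inherits the triangle and Cauchy-Schwarz inequalities
from those of \<open>l2\<close> and \<open>L2_set\<close>.\<close>

lemma schwartz_norm_eq_L2_set: "schwartz_norm p f = L2_set (\<lambda>ab. l2 (weighted_deriv ab f)) (multi_index_pairs (2 * p))"
  unfolding schwartz_norm_def L2_set_def l2_square schwartz_inner_eq
  by (simp only: power2_eq_square)

lemma schwartz_norm_nonneg [simp]: "0 \<le> schwartz_norm p f"
  by (simp add: schwartz_norm_eq_L2_set)

lemma schwartz_norm_square: "(schwartz_norm p f)\<^sup>2 = schwartz_inner p f f"
  by (simp add: schwartz_norm_def schwartz_inner_eq sum_nonneg)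

lemma schwartz_inner_cauchy_schwarz:
  assumes "f \<in> schwartz" "g \<in> schwartz"
  shows "\<bar>schwartz_inner p f g\<bar> \<le> schwartz_norm p f * schwartz_norm p g"
proof -
  have "\<bar>schwartz_inner p f g\<bar> \<le> (\<Sum>ab\<in>multi_index_pairs (2 * p). \<bar>l2 (weighted_deriv ab f)\<bar> * \<bar>l2 (weighted_deriv ab g)\<bar>)"
    unfolding schwartz_inner_eq
    by (rule order_trans[OF sum_abs], rule sum_mono) (simp add: L2_cauchy_schwarz weighted_deriv_L2fun assms)
  also have "\<dots> \<le> schwartz_norm p f * schwartz_norm p g"
    unfolding schwartz_norm_eq_L2_set by (rule L2_set_mult_ineq)
  finally show ?thesis .
qed

lemma schwartz_norm_add_le:
  assumes "f \<in> schwartz" "g \<in> schwartz"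
  shows "schwartz_norm p (\<lambda>x. f x + g x) \<le> schwartz_norm p f + schwartz_norm p g"
  unfolding schwartz_norm_eq_L2_set weighted_deriv_add[OF assms]
  by (rule order_trans[OF L2_set_mono L2_set_triangle_ineq])
    (simp_all add: l2_add_le weighted_deriv_L2fun assms)

lemma schwartz_norm_cmult:
  "f \<in> schwartz \<Longrightarrow> schwartz_norm p (\<lambda>x. c * f x) = \<bar>c\<bar> * schwartz_norm p f"
  by (simp add: schwartz_norm_eq_L2_set weighted_deriv_cmult l2_cmult L2_set_right_distrib)

lemma schwartz_norm_minus_commute:
  assumes "f \<in> schwartz" "g \<in> schwartz"
  shows "schwartz_norm p (\<lambda>x. f x - g x) = schwartz_norm p (\<lambda>x. g x - f x)"
  using schwartz_norm_cmult[OF schwartz_diff[OF assms], of p "-1"] by simp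

lemma schwartz_norm_le_add_diff:
  assumes "f \<in> schwartz" "g \<in> schwartz"
  shows "schwartz_norm p f \<le> schwartz_norm p g + schwartz_norm p (\<lambda>x. f x - g x)"
  using schwartz_norm_add_le[OF assms(2) schwartz_diff[OF assms], of p] by simp

lemma schwartz_norm_reverse_triangle:
  assumes "f \<in> schwartz" "g \<in> schwartz"
  shows "\<bar>schwartz_norm p f - schwartz_norm p g\<bar> \<le> schwartz_norm p (\<lambda>x. f x - g x)"
  using schwartz_norm_le_add_diff[OF assms, of p] schwartz_norm_le_add_diff[OF assms(2,1), of p]
  unfolding schwartz_norm_minus_commute[OF assms(2,1)] by linarith

lemma l2_weighted_deriv_le:
  assumes "ab \<in> multi_index_pairs (2 * p)"
  shows "l2 (weighted_deriv ab f) \<le> schwartz_norm p f"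
  unfolding schwartz_norm_eq_L2_set
  by (rule member_le_L2_set[OF finite_multi_index_pairs assms])

lemma schwartz_norm_le_of_weighted_derivs:
  "\<exists>C\<ge>0. \<forall>K. \<forall>g :: real^'n::finite \<Rightarrow> real.
     (\<forall>ab\<in>multi_index_pairs (2 * p). l2 (weighted_deriv ab g) \<le> K) \<longrightarrow> schwartz_norm p g \<le> C * K"
  unfolding schwartz_norm_eq_L2_set
  by (intro exI[of _ "real (card (multi_index_pairs (2 * p) :: (('n \<Rightarrow> nat) \<times> ('n \<Rightarrow> nat)) set))"] conjI allI impI)
    (auto intro: order_trans[OF L2_set_le_sum sum_bounded_above])

lemma schwartz_norm_mono:
  assumes "p \<le> q"
  shows "schwartz_norm p f \<le> schwartz_norm q f"
  unfolding schwartz_norm_def real_sqrt_le_iff schwartz_inner_eq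
proof (rule sum_mono2)
  show "multi_index_pairs (2 * p) \<subseteq> multi_index_pairs (2 * q)"
    using assms by (auto simp: multi_index_pairs_def)
qed (auto simp: finite_multi_index_pairs)

lemma l2_le_schwartz_norm:
  assumes "f \<in> schwartz"
  shows "l2 f \<le> schwartz_norm p f"
  using l2_weighted_deriv_le[of "(\<lambda>_. 0, \<lambda>_. 0)" p f] assms
  by (simp add: multi_index_pairs_def weighted_deriv_def[abs_def] multi_deriv_0 schwartz_smooth)

lemma sum_fun_upd_Suc: "(\<Sum>k\<in>UNIV. (\<beta>(j := Suc (\<beta> j))) k) = Suc (\<Sum>k\<in>UNIV. \<beta> (k::'n::finite))"
proof -
  have "(\<Sum>k\<in>UNIV - {j}. (\<beta>(j := Suc (\<beta> j))) k) = (\<Sum>k\<in>UNIV - {j}. \<beta> k)"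
    by (intro sum.cong) auto
  then show ?thesis
    by (subst (1 2) sum.remove[of UNIV j]) auto
qed

text \<open>Order \<open>p\<close> counts \<open>2 p\<close> derivatives and powers, so one derivative or one power, as in the next
lemma, is paid for by one order.\<close>

lemma schwartz_norm_partial_deriv_le:
  fixes j :: "'n::finite"
  shows "\<exists>C\<ge>0. \<forall>f\<in>schwartz. schwartz_norm p (partial_deriv j f) \<le> C * schwartz_norm (Suc p) f"
proof -
  obtain B where B: "B \<ge> 0" "\<And>K (g :: real^'n \<Rightarrow> real).
      (\<And>ab. ab \<in> multi_index_pairs (2 * p) \<Longrightarrow> l2 (weighted_deriv ab g) \<le> K) \<Longrightarrow> schwartz_norm p g \<le> B * K"
    using schwartz_norm_le_of_weighted_derivs by meson
  show ?thesis
  proof (intro exI[of _ B] conjI ballI)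
    fix f :: "real^'n \<Rightarrow> real" assume S: "f \<in> schwartz"
    show "schwartz_norm p (partial_deriv j f) \<le> B * schwartz_norm (Suc p) f"
    proof (rule B(2))
      fix ab :: "('n \<Rightarrow> nat) \<times> ('n \<Rightarrow> nat)" assume ab: "ab \<in> multi_index_pairs (2 * p)"
      let ?ab = "(fst ab, (snd ab)(j := Suc (snd ab j)))"
      have "weighted_deriv ab (partial_deriv j f) = weighted_deriv ?ab f"
        by (simp add: weighted_deriv_def[abs_def] multi_deriv_partial_deriv[OF schwartz_smooth[OF S]])
      moreover have "?ab \<in> multi_index_pairs (2 * Suc p)"
        using ab sum_fun_upd_Suc[of "snd ab" j] by (auto simp: multi_index_pairs_def)
      ultimately show "l2 (weighted_deriv ab (partial_deriv j f)) \<le> schwartz_norm (Suc p) f"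
        by (metis l2_weighted_deriv_le)
    qed
  qed (simp add: B(1))
qed

lemma schwartz_norm_coordinate_mult_le:
  fixes i :: "'n::finite"
  shows "\<exists>C\<ge>0. \<forall>f\<in>schwartz. schwartz_norm p (\<lambda>x. x $ i * f x) \<le> C * schwartz_norm (Suc p) f"
proof -
  obtain B where B: "B \<ge> 0" "\<And>K (g :: real^'n \<Rightarrow> real).
      (\<And>ab. ab \<in> multi_index_pairs (2 * p) \<Longrightarrow> l2 (weighted_deriv ab g) \<le> K) \<Longrightarrow> schwartz_norm p g \<le> B * K"
    using schwartz_norm_le_of_weighted_derivs by meson
  show ?thesis
  proof (intro exI[of _ "B * (1 + real (2 * p))"] conjI ballI)
    fix f :: "real^'n \<Rightarrow> real" assume S: "f \<in> schwartz"
    let ?K = "schwartz_norm (Suc p) f"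
    have "schwartz_norm p (\<lambda>x. x $ i * f x) \<le> B * ((1 + real (2 * p)) * ?K)"
    proof (rule B(2))
      fix ab :: "('n \<Rightarrow> nat) \<times> ('n \<Rightarrow> nat)" assume ab: "ab \<in> multi_index_pairs (2 * p)"
      obtain \<alpha> \<beta> where ab_eq: "ab = (\<alpha>, \<beta>)" by (cases ab)
      obtain js where js: "\<forall>j. count_list js j = \<beta> j" "multi_deriv \<beta> = partials js"
        using multi_deriv_eq_partials by blast
      let ?a = "(\<alpha>(i := Suc (\<alpha> i)), \<beta>)" and ?b = "(\<alpha>, count_list (remove1 i js))"
      have "multi_deriv \<beta> (\<lambda>x. x $ i * f x)
          = (\<lambda>x. x $ i * multi_deriv \<beta> f x + real (\<beta> i) * multi_deriv (count_list (remove1 i js)) f x)"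
        using partials_coordinate_mult[OF S, of js i]
        unfolding js(1)[rule_format] partials_eq_multi_deriv[OF schwartz_smooth[OF S], of "remove1 i js"]
        unfolding js(2)[symmetric] .
      moreover have "m * (y * A + b * B) = (y * m) * A + b * (m * B)" for m y A b B :: real
        by (simp add: algebra_simps)
      ultimately have eq: "weighted_deriv ab (\<lambda>x. x $ i * f x) = (\<lambda>x. weighted_deriv ?a f x + real (\<beta> i) * weighted_deriv ?b f x)"
        unfolding ab_eq weighted_deriv_def[abs_def] fst_conv snd_conv multi_power_Suc
        by (simp only:)
      have "count_list (remove1 i js) k \<le> count_list js k" for k
        by (induction js) auto
      then have "sum (count_list (remove1 i js)) UNIV \<le> sum \<beta> UNIV"
        unfolding js(1)[rule_format, symmetric] by (rule sum_mono)
      then have mem: "?a \<in> multi_index_pairs (2 * Suc p)" "?b \<in> multi_index_pairs (2 * Suc p)"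
        using ab sum_fun_upd_Suc[of \<alpha> i] by (auto simp: ab_eq multi_index_pairs_def)
      have "\<beta> i \<le> sum \<beta> UNIV"
        by (rule member_le_sum) auto
      then have beta: "\<beta> i \<le> 2 * p"
        using ab by (simp add: ab_eq multi_index_pairs_def)
      have "l2 (weighted_deriv ab (\<lambda>x. x $ i * f x)) \<le> l2 (weighted_deriv ?a f) + real (\<beta> i) * l2 (weighted_deriv ?b f)"
        using l2_add_le[OF weighted_deriv_L2fun[OF S] L2fun_cmult[OF weighted_deriv_L2fun[OF S]], of ?a "real (\<beta> i)" ?b]
        unfolding eq l2_cmult abs_of_nat .
      also have "\<dots> \<le> ?K + real (2 * p) * ?K"
        using beta by (intro add_mono mult_mono l2_weighted_deriv_le mem) auto
      finally show "l2 (weighted_deriv ab (\<lambda>x. x $ i * f x)) \<le> (1 + real (2 * p)) * ?K"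
        by (simp add: distrib_right)
    qed
    then show "schwartz_norm p (\<lambda>x. x $ i * f x) \<le> B * (1 + real (2 * p)) * ?K"
      by (simp add: mult.assoc)
  qed (simp add: B(1))
qed

lemma schwartz_sup_le_norm:
  "\<exists>C\<ge>0. \<forall>f\<in>schwartz. \<forall>x::real^'n::finite. \<bar>f x\<bar> \<le> C * schwartz_norm CARD('n) f"
proof (intro exI[of _ "sqrt (2 ^ CARD('n))"] conjI ballI allI)
  fix f :: "real^'n \<Rightarrow> real" and x assume S: "f \<in> schwartz"
  have "(\<integral>z. (multi_deriv (basis_index B) f z)\<^sup>2 \<partial>lborel) \<le> (schwartz_norm CARD('n) f)\<^sup>2" for B
  proof -
    have "sum (basis_index B) UNIV \<le> (\<Sum>i\<in>(UNIV::'n set). 1)"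
      by (intro sum_mono) (simp add: basis_index_def)
    then have "(\<lambda>_. 0, basis_index B) \<in> multi_index_pairs (2 * CARD('n))"
      by (simp add: multi_index_pairs_def)
    from l2_weighted_deriv_le[OF this, of f]
    have "l2 (multi_deriv (basis_index B) f) \<le> schwartz_norm CARD('n) f"
      by (simp add: weighted_deriv_def[abs_def])
    then show ?thesis
      unfolding l2_square[symmetric] by (intro power_mono) auto
  qed
  then have "(f x)\<^sup>2 \<le> (\<Sum>B\<in>Pow (Basis::(real^'n) set). (schwartz_norm CARD('n) f)\<^sup>2)"
    by (intro order_trans[OF schwartz_sobolev[OF S] sum_mono])
  also have "\<dots> = (sqrt (2 ^ CARD('n)) * schwartz_norm CARD('n) f)\<^sup>2"
    by (simp add: card_Pow power_mult_distrib)
  finally show "\<bar>f x\<bar> \<le> sqrt (2 ^ CARD('n)) * schwartz_norm CARD('n) f"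
    by (subst (asm) abs_le_square_iff[symmetric]) (simp add: abs_mult)
qed simp

text \<open>The Sobolev inequality for \<open>x\<^sup>\<alpha> f\<close>, with the powers traded for orders one by one.\<close>

lemma schwartz_sup_multi_power_le_norm:
  fixes \<alpha> :: "'n::finite \<Rightarrow> nat"
  shows "\<exists>p C. C \<ge> 0 \<and> (\<forall>f\<in>schwartz. \<forall>x. \<bar>multi_power x \<alpha> * f x\<bar> \<le> C * schwartz_norm p f)"
proof (induction \<alpha> rule: multi_power_induct)
  case zero
  show ?case
    using schwartz_sup_le_norm by auto
next
  case (Suc \<alpha> i)
  then obtain p C where C: "C \<ge> 0"
    "\<And>f x. f \<in> schwartz \<Longrightarrow> \<bar>multi_power x \<alpha> * f x\<bar> \<le> C * schwartz_norm p f"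
    by blast
  obtain C' where C': "C' \<ge> 0" "\<And>f. f \<in> schwartz \<Longrightarrow> schwartz_norm p (\<lambda>x. x $ i * f x) \<le> C' * schwartz_norm (Suc p) f"
    using schwartz_norm_coordinate_mult_le[of p i] by blast
  have "\<bar>multi_power x (\<alpha>(i := Suc (\<alpha> i))) * f x\<bar> \<le> (C * C') * schwartz_norm (Suc p) f" if S: "f \<in> schwartz" for f x
  proof -
    have "\<bar>multi_power x (\<alpha>(i := Suc (\<alpha> i))) * f x\<bar> = \<bar>multi_power x \<alpha> * (x $ i * f x)\<bar>"
      unfolding multi_power_Suc by (simp add: mult.commute mult.left_commute)
    also have "\<dots> \<le> C * schwartz_norm p (\<lambda>x. x $ i * f x)"
      by (rule C(2)[OF schwartz_coordinate_mult[OF S]])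
    also have "\<dots> \<le> C * (C' * schwartz_norm (Suc p) f)"
      by (intro mult_left_mono C'(2) S C(1))
    finally show ?thesis by simp
  qed
  moreover have "C * C' \<ge> 0"
    using C(1) C'(1) by simp
  ultimately show ?case
    by blast
qed

section \<open>Cauchy sequences of Schwartz functions and closability\<close>

text \<open>The part of \<open>hs_approximates\<close> that does not refer to the limit.\<close>

definition schwartz_Cauchy :: "nat \<Rightarrow> (nat \<Rightarrow> real^'n::finite \<Rightarrow> real) \<Rightarrow> bool" where
  "schwartz_Cauchy p \<phi> \<longleftrightarrow> (\<forall>n. \<phi> n \<in> schwartz) \<and>
     (\<forall>e>0. \<exists>N. \<forall>m\<ge>N. \<forall>n\<ge>N. schwartz_norm p (\<lambda>x. \<phi> m x - \<phi> n x) < e)"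

lemma schwartz_CauchyD: "schwartz_Cauchy p \<phi> \<Longrightarrow> \<phi> n \<in> schwartz"
  by (simp add: schwartz_Cauchy_def)

lemma schwartz_Cauchy_dominates:
  assumes "schwartz_Cauchy p \<phi>" "C \<ge> 0" "e > 0"
    and le: "\<And>m n. d m n \<le> C * schwartz_norm p (\<lambda>x. \<phi> m x - \<phi> n x)"
  shows "\<exists>N. \<forall>m\<ge>N. \<forall>n\<ge>N. d m n < e"
proof -
  have "e / (C + 1) > 0" using assms(2,3) by simp
  then obtain N where N: "\<And>m n. m \<ge> N \<Longrightarrow> n \<ge> N \<Longrightarrow> schwartz_norm p (\<lambda>x. \<phi> m x - \<phi> n x) < e / (C + 1)"
    using assms(1) unfolding schwartz_Cauchy_def by meson
  have "d m n < e" if "m \<ge> N" "n \<ge> N" for m n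
  proof -
    have "d m n \<le> C * (e / (C + 1))"
      using N[OF that] assms(2) by (intro order_trans[OF le mult_left_mono]) auto
    also have "\<dots> < e"
      using assms(2,3) by (simp add: field_simps)
    finally show ?thesis .
  qed
  then show ?thesis by blast
qed

lemma schwartz_Cauchy_bounded:
  assumes "schwartz_Cauchy p \<phi>"
  shows "\<exists>K\<ge>0. \<forall>n. schwartz_norm p (\<phi> n) \<le> K"
proof -
  note S = schwartz_CauchyD[OF assms]
  obtain N where N: "\<And>m n. m \<ge> N \<Longrightarrow> n \<ge> N \<Longrightarrow> schwartz_norm p (\<lambda>x. \<phi> m x - \<phi> n x) < 1"
    using assms unfolding schwartz_Cauchy_def by (meson zero_less_one)
  define K where "K = (\<Sum>n\<le>N. schwartz_norm p (\<phi> n)) + 1"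
  have *: "schwartz_norm p (\<phi> n) \<le> (\<Sum>n\<le>N. schwartz_norm p (\<phi> n))" if "n \<le> N" for n
    using that by (intro member_le_sum) auto
  have "schwartz_norm p (\<phi> n) \<le> K" for n
  proof (cases "n \<le> N")
    case True
    then show ?thesis using *[OF True] by (simp add: K_def)
  next
    case False
    then show ?thesis
      using schwartz_norm_le_add_diff[OF S S, of p n N] N[of n N] *[of N] by (simp add: K_def)
  qed
  moreover have "K \<ge> 0" by (auto simp: K_def intro!: add_nonneg_nonneg sum_nonneg)
  ultimately show ?thesis by blast
qed

lemma schwartz_Cauchy_diff:
  assumes "schwartz_Cauchy p \<phi>" "schwartz_Cauchy p \<psi>"
  shows "schwartz_Cauchy p (\<lambda>n x. \<phi> n x - \<psi> n x)"
  unfolding schwartz_Cauchy_def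
proof (intro conjI allI impI)
  note S = schwartz_CauchyD[OF assms(1)] schwartz_CauchyD[OF assms(2)]
  show "(\<lambda>x. \<phi> n x - \<psi> n x) \<in> schwartz" for n
    by (intro schwartz_diff S)
  fix e :: real assume "e > 0"
  then obtain M N where
    M: "\<And>m n. m \<ge> M \<Longrightarrow> n \<ge> M \<Longrightarrow> schwartz_norm p (\<lambda>x. \<phi> m x - \<phi> n x) < e / 2" and
    N: "\<And>m n. m \<ge> N \<Longrightarrow> n \<ge> N \<Longrightarrow> schwartz_norm p (\<lambda>x. \<psi> m x - \<psi> n x) < e / 2"
    using assms unfolding schwartz_Cauchy_def by (meson half_gt_zero)
  have "schwartz_norm p (\<lambda>x. (\<phi> m x - \<psi> m x) - (\<phi> n x - \<psi> n x)) < e" if "m \<ge> max M N" "n \<ge> max M N" for m n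
  proof -
    have "schwartz_norm p (\<lambda>x. (\<phi> m x - \<phi> n x) + (\<psi> n x - \<psi> m x))
        \<le> schwartz_norm p (\<lambda>x. \<phi> m x - \<phi> n x) + schwartz_norm p (\<lambda>x. \<psi> n x - \<psi> m x)"
      by (intro schwartz_norm_add_le schwartz_diff S)
    with M[of m n] N[of n m] that show ?thesis by (simp add: algebra_simps)
  qed
  then show "\<exists>N. \<forall>m\<ge>N. \<forall>n\<ge>N. schwartz_norm p (\<lambda>x. (\<phi> m x - \<psi> m x) - (\<phi> n x - \<psi> n x)) < e"
    by blast
qed

lemma schwartz_Cauchy_mono: "schwartz_Cauchy q \<phi> \<Longrightarrow> p \<le> q \<Longrightarrow> schwartz_Cauchy p \<phi>"
  unfolding schwartz_Cauchy_def by (meson order_le_less_trans schwartz_norm_mono)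

lemma schwartz_Cauchy_partial_deriv:
  assumes "schwartz_Cauchy (Suc p) \<phi>"
  shows "schwartz_Cauchy p (\<lambda>n. partial_deriv j (\<phi> n))"
  unfolding schwartz_Cauchy_def
proof (intro conjI allI impI)
  note S = schwartz_CauchyD[OF assms]
  show "partial_deriv j (\<phi> n) \<in> schwartz" for n
    by (intro schwartz_partial_deriv S)
  fix e :: real assume "e > 0"
  obtain C where C: "C \<ge> 0" "\<And>f. f \<in> schwartz \<Longrightarrow> schwartz_norm p (partial_deriv j f) \<le> C * schwartz_norm (Suc p) f"
    using schwartz_norm_partial_deriv_le[of p j] by blast
  have "schwartz_norm p (\<lambda>x. partial_deriv j (\<phi> m) x - partial_deriv j (\<phi> n) x) \<le> C * schwartz_norm (Suc p) (\<lambda>x. \<phi> m x - \<phi> n x)" for m n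
    using C(2)[OF schwartz_diff[OF S S], of m n] unfolding partial_deriv_diff_schwartz[OF S S] .
  from schwartz_Cauchy_dominates[OF assms C(1) \<open>e > 0\<close> this]
  show "\<exists>N. \<forall>m\<ge>N. \<forall>n\<ge>N. schwartz_norm p (\<lambda>x. partial_deriv j (\<phi> m) x - partial_deriv j (\<phi> n) x) < e" .
qed

lemma partials_adjoint:
  assumes "g \<in> schwartz"
  shows "\<exists>h\<in>schwartz. \<forall>f\<in>schwartz. (\<integral>x. partials js f x * g x \<partial>lborel) = (\<integral>x. f x * h x \<partial>lborel)"
  using assms
proof (induction js arbitrary: g)
  case (Cons j js)
  let ?g = "\<lambda>x. - 1 * partial_deriv j g x"
  have "?g \<in> schwartz"
    by (intro schwartz_cmult schwartz_partial_deriv Cons.prems)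
  from Cons.IH[OF this] obtain h where h: "h \<in> schwartz"
    "\<And>f. f \<in> schwartz \<Longrightarrow> (\<integral>x. partials js f x * ?g x \<partial>lborel) = (\<integral>x. f x * h x \<partial>lborel)"
    by blast
  have "(\<integral>x. partials (j # js) f x * g x \<partial>lborel) = (\<integral>x. f x * h x \<partial>lborel)" if "f \<in> schwartz" for f
    using schwartz_integration_by_parts[OF schwartz_partials[OF that] Cons.prems, of j js] h(2)[OF that] by simp
  with h(1) show ?case by blast
qed auto

lemma weighted_deriv_adjoint:
  assumes "g \<in> schwartz"
  shows "\<exists>h\<in>schwartz. \<forall>f\<in>schwartz. (\<integral>x. weighted_deriv ab f x * g x \<partial>lborel) = (\<integral>x. f x * h x \<partial>lborel)"
proof -
  obtain js where js: "multi_deriv (snd ab) = partials js"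
    using multi_deriv_eq_partials by blast
  show ?thesis
    using partials_adjoint[OF schwartz_multi_power_mult[OF assms, of "fst ab"], of js]
    by (simp add: weighted_deriv_def js mult.assoc mult.left_commute)
qed

lemma tendsto_0_boundI:
  fixes f g :: "'a \<Rightarrow> real"
  assumes "\<And>s. norm (f s) \<le> g s" "(g \<longlongrightarrow> 0) net"
  shows "(f \<longlongrightarrow> 0) net"
  using Lim_null_comparison[OF always_eventually assms(2)] assms(1) by blast

lemma tendsto_0_withinI:
  fixes f :: "'a::topological_space \<Rightarrow> real"
  assumes "\<And>s. s \<in> I \<Longrightarrow> norm (f s) \<le> g s" "(g \<longlongrightarrow> 0) (at t within I)"
  shows "(f \<longlongrightarrow> 0) (at t within I)"
  by (rule Lim_null_comparison[OF _ assms(2)]) (use assms(1) in \<open>auto simp: eventually_at_filter\<close>)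

lemma schwartz_inner_tendsto_0:
  assumes S: "\<And>n. \<phi> n \<in> schwartz" and g: "g \<in> schwartz" and lim: "(\<lambda>n. l2 (\<phi> n)) \<longlonglongrightarrow> 0"
  shows "(\<lambda>n. schwartz_inner p (\<phi> n) g) \<longlonglongrightarrow> 0"
  unfolding schwartz_inner_eq
proof (rule tendsto_null_sum)
  fix ab
  obtain h where h: "h \<in> schwartz"
    "\<And>f. f \<in> schwartz \<Longrightarrow> (\<integral>x. weighted_deriv ab f x * weighted_deriv ab g x \<partial>lborel) = (\<integral>x. f x * h x \<partial>lborel)"
    using weighted_deriv_adjoint[OF schwartz_weighted_deriv[OF g]] by blast
  show "(\<lambda>n. \<integral>x. weighted_deriv ab (\<phi> n) x * weighted_deriv ab g x \<partial>lborel) \<longlonglongrightarrow> 0"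
  proof (rule Lim_null_comparison)
    show "\<forall>\<^sub>F n in sequentially. norm (\<integral>x. weighted_deriv ab (\<phi> n) x * weighted_deriv ab g x \<partial>lborel) \<le> l2 (\<phi> n) * l2 h"
      using L2_cauchy_schwarz[OF schwartz_L2fun[OF S] schwartz_L2fun[OF h(1)]] by (simp add: h(2)[OF S])
    show "(\<lambda>n. l2 (\<phi> n) * l2 h) \<longlonglongrightarrow> 0"
      using tendsto_mult_left_zero[OF lim] by simp
  qed
qed

text \<open>Write \<open>\<parallel>\<phi> n\<parallel>\<^sup>2 = \<langle>\<phi> n, \<phi> n - \<phi> N\<rangle> + \<langle>\<phi> n, \<phi> N\<rangle>\<close>. The first term is small because the sequence is
bounded and Cauchy. In the second all derivatives and powers can be moved onto the fixed Schwartz function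
\<open>\<phi> N\<close>, so that it tends to zero with \<open>\<phi> n\<close> in \<open>L\<^sup>2\<close>.\<close>

lemma schwartz_norm_closable:
  assumes "schwartz_Cauchy p \<phi>" and lim: "(\<lambda>n. l2 (\<phi> n)) \<longlonglongrightarrow> 0"
  shows "(\<lambda>n. schwartz_norm p (\<phi> n)) \<longlonglongrightarrow> 0"
proof -
  note S = schwartz_CauchyD[OF assms(1)]
  obtain K where K: "K \<ge> 0" "\<And>n. schwartz_norm p (\<phi> n) \<le> K"
    using schwartz_Cauchy_bounded[OF assms(1)] by blast
  have "(\<lambda>n. (schwartz_norm p (\<phi> n))\<^sup>2) \<longlonglongrightarrow> 0"
  proof (rule LIMSEQ_I)
    fix r :: real assume "r > 0"
    define e where "e = r / (2 * (K + 1))"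
    have e: "e > 0" "K * e < r / 2"
      using \<open>r > 0\<close> K(1) by (auto simp: e_def field_simps)
    obtain N where N: "\<And>m n. m \<ge> N \<Longrightarrow> n \<ge> N \<Longrightarrow> schwartz_norm p (\<lambda>x. \<phi> m x - \<phi> n x) < e"
      using assms(1) e(1) unfolding schwartz_Cauchy_def by meson
    have "\<forall>\<^sub>F n in sequentially. \<bar>schwartz_inner p (\<phi> n) (\<phi> N)\<bar> < r / 2"
      using tendstoD[OF schwartz_inner_tendsto_0[OF S S lim], of "r / 2" p] \<open>r > 0\<close> by (simp add: dist_norm)
    then obtain M where M: "\<And>n. n \<ge> M \<Longrightarrow> \<bar>schwartz_inner p (\<phi> n) (\<phi> N)\<bar> < r / 2"
      by (auto simp: eventually_sequentially)
    have "norm ((schwartz_norm p (\<phi> n))\<^sup>2 - 0) < r" if "n \<ge> max M N" for n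
    proof -
      have "\<bar>schwartz_inner p (\<phi> n) (\<lambda>x. \<phi> n x - \<phi> N x)\<bar> \<le> schwartz_norm p (\<phi> n) * schwartz_norm p (\<lambda>x. \<phi> n x - \<phi> N x)"
        by (intro schwartz_inner_cauchy_schwarz schwartz_diff S)
      also have "\<dots> \<le> K * e"
        using K N[of n N] that by (intro mult_mono) (auto simp: less_imp_le)
      finally have "\<bar>schwartz_inner p (\<phi> n) (\<phi> n) - schwartz_inner p (\<phi> n) (\<phi> N)\<bar> < r / 2"
        using e(2) by (simp add: schwartz_inner_diff_right[OF S S S])
      moreover have "\<bar>schwartz_inner p (\<phi> n) (\<phi> N)\<bar> < r / 2"
        using M that by simp
      ultimately have "schwartz_inner p (\<phi> n) (\<phi> n) < r"
        by linarith
      then show ?thesis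
        unfolding schwartz_norm_square[symmetric] by simp
    qed
    then show "\<exists>no. \<forall>n\<ge>no. norm ((schwartz_norm p (\<phi> n))\<^sup>2 - 0) < r"
      by blast
  qed
  from tendsto_real_sqrt[OF this] show ?thesis
    by simp
qed

section \<open>Hermite-Sobolev spaces\<close>

lemma mfun_eq_refl: "f \<in> borel_measurable borel \<Longrightarrow> mfun_eq f f"
  by (simp add: mfun_eq_def)

lemma mfun_cases:
  fixes u :: "'n::finite mfun"
  obtains f where "f \<in> borel_measurable borel" "u = mfun_of f"
  by (induction u rule: mfun.abs_induct) (auto simp: mfun_eq_def)

lemma mfun_of_eqI:
  assumes "f \<in> borel_measurable borel" "g \<in> borel_measurable borel" "AE x in lborel. f x = g x"
  shows "mfun_of f = mfun_of g"
  using assms by (intro Quotient_rel_abs[OF Quotient_mfun]) (simp add: mfun_eq_def)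

lemma
  assumes "f \<in> borel_measurable borel" "g \<in> borel_measurable borel"
  shows mfun_of_add: "mfun_of f + mfun_of g = mfun_of (\<lambda>x. f x + g x)"
    and mfun_of_diff: "mfun_of f - mfun_of g = mfun_of (\<lambda>x. f x - g x)"
    and mfun_of_mult: "mfun_of f * mfun_of g = mfun_of (\<lambda>x. f x * g x)"
    and L2_inner_mfun_of: "L2_inner (mfun_of f) (mfun_of g) = (\<integral>x. f x * g x \<partial>lborel)"
  by (simp_all add: assms mfun_eq_refl plus_mfun.abs_eq minus_mfun.abs_eq times_mfun.abs_eq L2_inner.abs_eq)

lemma
  assumes "f \<in> borel_measurable borel"
  shows mfun_of_scaleR: "c *\<^sub>R mfun_of f = mfun_of (\<lambda>x. c * f x)"
    and L2_norm_mfun_of: "L2_norm (mfun_of f) = l2 f"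
    and mfun_of_in_L2: "mfun_of f \<in> L2 \<longleftrightarrow> f \<in> L2fun"
  by (simp_all add: assms mfun_eq_refl scaleR_mfun.abs_eq L2_inner.abs_eq L2_norm_def l2_def
      L2_def square_integrable.abs_eq L2fun_def power2_eq_square)

lemma mfun_of_sum:
  assumes "finite A" "\<And>i. i \<in> A \<Longrightarrow> f i \<in> borel_measurable borel"
  shows "(\<Sum>i\<in>A. mfun_of (f i)) = mfun_of (\<lambda>x. \<Sum>i\<in>A. f i x)"
  using assms
  by (induction A rule: finite_induct) (simp_all add: zero_mfun_def mfun_of_add borel_measurable_sum)

lemma hs_approximates_mfun_of:
  assumes "f \<in> borel_measurable borel"
  shows "hs_approximates p \<phi> (mfun_of f) \<longleftrightarrow>
    schwartz_Cauchy p \<phi> \<and> f \<in> L2fun \<and> (\<lambda>n. l2 (\<lambda>x. \<phi> n x - f x)) \<longlonglongrightarrow> 0"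
proof -
  have "L2_norm (mfun_of (\<phi> n) - mfun_of f) = l2 (\<lambda>x. \<phi> n x - f x)" if "\<phi> n \<in> schwartz" for n
    using schwartz_borel[OF that] assms by (simp add: mfun_of_diff L2_norm_mfun_of)
  then show ?thesis
    unfolding hs_approximates_def schwartz_Cauchy_def mfun_of_in_L2[OF assms] by auto
qed

lemma L2_norm_of_limit:
  assumes "\<And>n. \<phi> n \<in> L2fun" "f \<in> L2fun" "(\<lambda>n. l2 (\<lambda>x. \<phi> n x - f x)) \<longlonglongrightarrow> 0"
  shows "(\<lambda>n. l2 (\<phi> n)) \<longlonglongrightarrow> l2 f"
proof -
  have "\<bar>l2 (\<phi> n) - l2 f\<bar> \<le> l2 (\<lambda>x. \<phi> n x - f x)" for n
    using l2_add_le[OF L2fun_diff[OF assms(1,2)] assms(2), of n]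
      l2_add_le[OF L2fun_diff[OF assms(2,1)] assms(1), of n n] l2_minus_commute[of "\<phi> n" f] by simp
  then have "(\<lambda>n. l2 (\<phi> n) - l2 f) \<longlonglongrightarrow> 0"
    by (intro Lim_null_comparison[OF _ assms(3)]) simp
  then show ?thesis
    by (simp add: LIM_zero_iff)
qed

text \<open>Two approximations of the same element differ by a Cauchy sequence that vanishes in \<open>L\<^sup>2\<close>; closability
makes it vanish in norm, even when the two refer to different orders.\<close>

lemma hs_approximates_diff_tendsto_0:
  assumes "hs_approximates p \<phi> u" "hs_approximates q \<psi> u" "r \<le> p" "r \<le> q"
  shows "(\<lambda>n. schwartz_norm r (\<lambda>x. \<phi> n x - \<psi> n x)) \<longlonglongrightarrow> 0"
proof (rule schwartz_norm_closable)
  obtain f where f: "f \<in> borel_measurable borel" "u = mfun_of f"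
    by (rule mfun_cases)
  note a = assms(1)[unfolded f(2) hs_approximates_mfun_of[OF f(1)]]
    and b = assms(2)[unfolded f(2) hs_approximates_mfun_of[OF f(1)]]
  have S: "\<phi> n \<in> L2fun" "\<psi> n \<in> L2fun" for n
    using a b by (auto intro: schwartz_L2fun schwartz_CauchyD)
  show "schwartz_Cauchy r (\<lambda>n x. \<phi> n x - \<psi> n x)"
    using a b assms(3,4) by (intro schwartz_Cauchy_diff) (auto intro: schwartz_Cauchy_mono)
  show "(\<lambda>n. l2 (\<lambda>x. \<phi> n x - \<psi> n x)) \<longlonglongrightarrow> 0"
  proof (rule Lim_null_comparison)
    have "norm (l2 (\<lambda>x. \<phi> n x - \<psi> n x)) \<le> l2 (\<lambda>x. \<phi> n x - f x) + l2 (\<lambda>x. \<psi> n x - f x)" for n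
      using l2_diff_triangle[OF S(1), of f "\<psi> n" n] S a l2_minus_commute[of f "\<psi> n"] by simp
    then show "\<forall>\<^sub>F n in sequentially. norm (l2 (\<lambda>x. \<phi> n x - \<psi> n x)) \<le> l2 (\<lambda>x. \<phi> n x - f x) + l2 (\<lambda>x. \<psi> n x - f x)"
      by simp
    show "(\<lambda>n. l2 (\<lambda>x. \<phi> n x - f x) + l2 (\<lambda>x. \<psi> n x - f x)) \<longlonglongrightarrow> 0"
      using tendsto_add[OF a[THEN conjunct2, THEN conjunct2] b[THEN conjunct2, THEN conjunct2]] by simp
  qed
qed

lemma hs_approximates_Cauchy: "hs_approximates p \<phi> u \<Longrightarrow> schwartz_Cauchy p \<phi>"
  by (simp add: hs_approximates_def schwartz_Cauchy_def)

lemma schwartz_norm_convergent: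
  assumes "schwartz_Cauchy p \<phi>"
  shows "convergent (\<lambda>n. schwartz_norm p (\<phi> n))"
proof (rule real_Cauchy_convergent, rule CauchyI)
  note S = schwartz_CauchyD[OF assms]
  fix e :: real assume "e > 0"
  then obtain N where N: "\<And>m n. m \<ge> N \<Longrightarrow> n \<ge> N \<Longrightarrow> schwartz_norm p (\<lambda>x. \<phi> m x - \<phi> n x) < e"
    using assms unfolding schwartz_Cauchy_def by meson
  have "norm (schwartz_norm p (\<phi> m) - schwartz_norm p (\<phi> n)) < e" if "m \<ge> N" "n \<ge> N" for m n
    using order_le_less_trans[OF schwartz_norm_reverse_triangle[OF S S] N[OF that]] by simp
  then show "\<exists>M. \<forall>m\<ge>M. \<forall>n\<ge>M. norm (schwartz_norm p (\<phi> m) - schwartz_norm p (\<phi> n)) < e"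
    by blast
qed

lemma schwartz_inner_limit_eq:
  assumes "hs_approximates p \<phi> u" "hs_approximates p \<phi>' u" "hs_approximates p \<psi> u"
    and lim: "(\<lambda>n. schwartz_norm p (\<phi> n)) \<longlonglongrightarrow> a"
  shows "(\<lambda>n. schwartz_inner p (\<phi>' n) (\<psi> n)) \<longlonglongrightarrow> a\<^sup>2"
proof -
  note S = assms(1-3)[THEN hs_approximates_Cauchy, THEN schwartz_CauchyD]
  have lim': "(\<lambda>n. schwartz_norm p (\<phi>' n)) \<longlonglongrightarrow> a"
  proof -
    have "(\<lambda>n. schwartz_norm p (\<phi>' n) - schwartz_norm p (\<phi> n)) \<longlonglongrightarrow> 0"
      by (rule tendsto_0_boundI[OF _ hs_approximates_diff_tendsto_0[OF assms(2,1) order_refl order_refl]])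
        (simp add: schwartz_norm_reverse_triangle S)
    from tendsto_add[OF this lim] show ?thesis by simp
  qed
  have "(\<lambda>n. schwartz_inner p (\<phi>' n) (\<lambda>x. \<phi>' n x - \<psi> n x)) \<longlonglongrightarrow> 0"
  proof (rule Lim_null_comparison)
    show "\<forall>\<^sub>F n in sequentially. norm (schwartz_inner p (\<phi>' n) (\<lambda>x. \<phi>' n x - \<psi> n x))
        \<le> schwartz_norm p (\<phi>' n) * schwartz_norm p (\<lambda>x. \<phi>' n x - \<psi> n x)"
      using schwartz_inner_cauchy_schwarz[OF S(2) schwartz_diff[OF S(2) S(3)]] by simp
    show "(\<lambda>n. schwartz_norm p (\<phi>' n) * schwartz_norm p (\<lambda>x. \<phi>' n x - \<psi> n x)) \<longlonglongrightarrow> 0"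
      using tendsto_mult[OF lim' hs_approximates_diff_tendsto_0[OF assms(2,3) order_refl order_refl]] by simp
  qed
  from tendsto_diff[OF tendsto_power[OF lim', of 2] this] show ?thesis
    by (simp add: schwartz_inner_diff_right[OF S(2) S(2) S(3)] schwartz_norm_square)
qed

text \<open>All pairs of approximating sequences have the same limit of inner products, which justifies the definite
description in \<open>hs_inner\<close>.\<close>

lemma hs_inner_eq_limit:
  assumes "hs_approximates p \<phi> u"
  shows "(\<lambda>n. schwartz_inner p (\<phi> n) (\<phi> n)) \<longlonglongrightarrow> hs_inner p u u"
proof -
  obtain a where a: "(\<lambda>n. schwartz_norm p (\<phi> n)) \<longlonglongrightarrow> a"
    using schwartz_norm_convergent[OF hs_approximates_Cauchy[OF assms]] by (auto simp: convergent_def)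
  have "hs_inner p u u = a\<^sup>2"
    unfolding hs_inner_def
  proof (rule the_equality)
    show "\<forall>\<phi> \<psi>. hs_approximates p \<phi> u \<longrightarrow> hs_approximates p \<psi> u \<longrightarrow> (\<lambda>n. schwartz_inner p (\<phi> n) (\<psi> n)) \<longlonglongrightarrow> a\<^sup>2"
      using schwartz_inner_limit_eq[OF assms _ _ a] by blast
    fix r assume "\<forall>\<phi> \<psi>. hs_approximates p \<phi> u \<longrightarrow> hs_approximates p \<psi> u \<longrightarrow> (\<lambda>n. schwartz_inner p (\<phi> n) (\<psi> n)) \<longlonglongrightarrow> r"
    with assms have "(\<lambda>n. schwartz_inner p (\<phi> n) (\<phi> n)) \<longlonglongrightarrow> r" by blast
    then show "r = a\<^sup>2"
      using schwartz_inner_limit_eq[OF assms assms assms a] by (rule LIMSEQ_unique)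
  qed
  with schwartz_inner_limit_eq[OF assms assms assms a] show ?thesis by simp
qed

lemma L2_norm_le_hs_norm:
  assumes "u \<in> hermite_sobolev p"
  shows "(L2_norm u)\<^sup>2 \<le> hs_inner p u u"
proof -
  obtain f where f: "f \<in> borel_measurable borel" "u = mfun_of f"
    by (rule mfun_cases)
  obtain \<phi> where \<phi>: "hs_approximates p \<phi> u"
    using assms by (auto simp: hermite_sobolev_def)
  note a = \<phi>[unfolded f(2) hs_approximates_mfun_of[OF f(1)]]
  have S: "\<phi> n \<in> schwartz" for n
    using a by (auto intro: schwartz_CauchyD)
  have "(\<lambda>n. (l2 (\<phi> n))\<^sup>2) \<longlonglongrightarrow> (L2_norm u)\<^sup>2"
    unfolding f(2) L2_norm_mfun_of[OF f(1)]
    using a by (intro tendsto_power L2_norm_of_limit schwartz_L2fun[OF S]) auto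
  then show ?thesis
  proof (rule LIMSEQ_le[OF _ hs_inner_eq_limit[OF \<phi>]])
    show "\<exists>N. \<forall>n\<ge>N. (l2 (\<phi> n))\<^sup>2 \<le> schwartz_inner p (\<phi> n) (\<phi> n)"
      unfolding schwartz_norm_square[symmetric] by (auto intro!: power_mono l2_le_schwartz_norm S)
  qed
qed

lemma hs_inner_nonneg: "u \<in> hermite_sobolev p \<Longrightarrow> 0 \<le> hs_inner p u u"
  using L2_norm_le_hs_norm order_trans[OF zero_le_power2] by blast

lemma hermite_sobolev_subset_L2: "u \<in> hermite_sobolev p \<Longrightarrow> u \<in> L2"
  by (auto simp: hermite_sobolev_def hs_approximates_def)

lemma hs_approximates_const:
  fixes f :: "real^'n::finite \<Rightarrow> real"
  assumes "f \<in> schwartz"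
  shows "hs_approximates p (\<lambda>_. f) (mfun_of f)"
proof -
  have z: "l2 (\<lambda>x::real^'n. 0) = 0"
    by (simp add: l2_def)
  have "schwartz_norm p (\<lambda>x. f x - f x) = 0"
    using schwartz_norm_cmult[OF assms, of p 0] by simp
  then show ?thesis
    using assms by (simp add: hs_approximates_mfun_of schwartz_borel schwartz_L2fun schwartz_Cauchy_def z)
qed

lemma schwartz_in_hermite_sobolev: "f \<in> schwartz \<Longrightarrow> mfun_of f \<in> hermite_sobolev p"
  using hs_approximates_const by (auto simp: hermite_sobolev_def)

lemma hs_inner_schwartz: "f \<in> schwartz \<Longrightarrow> hs_inner p (mfun_of f) (mfun_of f) = (schwartz_norm p f)\<^sup>2"
  using hs_inner_eq_limit[OF hs_approximates_const, of f p] by (simp add: schwartz_norm_square LIMSEQ_const_iff)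

lemma hermite_sobolev_diff:
  assumes "u \<in> hermite_sobolev p" "v \<in> hermite_sobolev p"
  shows "u - v \<in> hermite_sobolev p"
proof -
  obtain f where f: "f \<in> borel_measurable borel" "u = mfun_of f" by (rule mfun_cases)
  obtain g where g: "g \<in> borel_measurable borel" "v = mfun_of g" by (rule mfun_cases)
  obtain \<phi> \<psi> where "hs_approximates p \<phi> u" "hs_approximates p \<psi> v"
    using assms by (auto simp: hermite_sobolev_def)
  note a = this(1)[unfolded f(2) hs_approximates_mfun_of[OF f(1)]]
    and b = this(2)[unfolded g(2) hs_approximates_mfun_of[OF g(1)]]
  have S: "\<phi> n \<in> L2fun" "\<psi> n \<in> L2fun" for n
    using a b by (auto intro: schwartz_L2fun schwartz_CauchyD)
  have "(\<lambda>n. l2 (\<lambda>x. (\<phi> n x - \<psi> n x) - (f x - g x))) \<longlonglongrightarrow> 0"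
  proof (rule Lim_null_comparison)
    have "norm (l2 (\<lambda>x. (\<phi> n x - \<psi> n x) - (f x - g x))) \<le> l2 (\<lambda>x. \<phi> n x - f x) + l2 (\<lambda>x. \<psi> n x - g x)" for n
      using l2_diff_diff_le[OF S(1)[of n] _ S(2)[of n], of f g] a b by simp
    then show "\<forall>\<^sub>F n in sequentially. norm (l2 (\<lambda>x. (\<phi> n x - \<psi> n x) - (f x - g x))) \<le> l2 (\<lambda>x. \<phi> n x - f x) + l2 (\<lambda>x. \<psi> n x - g x)"
      by simp
    show "(\<lambda>n. l2 (\<lambda>x. \<phi> n x - f x) + l2 (\<lambda>x. \<psi> n x - g x)) \<longlonglongrightarrow> 0"
      using tendsto_add[OF a[THEN conjunct2, THEN conjunct2] b[THEN conjunct2, THEN conjunct2]] by simp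
  qed
  then have "hs_approximates p (\<lambda>n x. \<phi> n x - \<psi> n x) (mfun_of (\<lambda>x. f x - g x))"
    using a b f(1) g(1) by (subst hs_approximates_mfun_of) (auto intro: schwartz_Cauchy_diff L2fun_diff)
  then show ?thesis
    using f g by (auto simp: hermite_sobolev_def mfun_of_diff)
qed

lemma hermite_sobolev_scaleR:
  assumes "u \<in> hermite_sobolev p"
  shows "c *\<^sub>R u \<in> hermite_sobolev p"
proof -
  obtain f where f: "f \<in> borel_measurable borel" "u = mfun_of f" by (rule mfun_cases)
  obtain \<phi> where "hs_approximates p \<phi> u"
    using assms by (auto simp: hermite_sobolev_def)
  note a = this[unfolded f(2) hs_approximates_mfun_of[OF f(1)]]
  have S: "\<phi> n \<in> schwartz" for n
    using a by (auto intro: schwartz_CauchyD)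
  have "schwartz_Cauchy p (\<lambda>n x. c * \<phi> n x)"
    unfolding schwartz_Cauchy_def
  proof (intro conjI allI impI)
    fix e :: real assume "e > 0"
    have "schwartz_norm p (\<lambda>x. c * \<phi> m x - c * \<phi> n x) \<le> \<bar>c\<bar> * schwartz_norm p (\<lambda>x. \<phi> m x - \<phi> n x)" for m n
      using schwartz_norm_cmult[OF schwartz_diff[OF S S], of p c m n] by (simp add: right_diff_distrib)
    from schwartz_Cauchy_dominates[OF conjunct1[OF a] abs_ge_zero \<open>e > 0\<close> this]
    show "\<exists>N. \<forall>m\<ge>N. \<forall>n\<ge>N. schwartz_norm p (\<lambda>x. c * \<phi> m x - c * \<phi> n x) < e" .
  qed (intro schwartz_cmult S)
  moreover have "l2 (\<lambda>x. c * \<phi> n x - c * f x) = \<bar>c\<bar> * l2 (\<lambda>x. \<phi> n x - f x)" for n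
    using l2_cmult[of c "\<lambda>x. \<phi> n x - f x"] by (simp add: right_diff_distrib)
  then have "(\<lambda>n. l2 (\<lambda>x. c * \<phi> n x - c * f x)) \<longlonglongrightarrow> 0"
    using tendsto_mult_right_zero[OF a[THEN conjunct2, THEN conjunct2], of "\<bar>c\<bar>"] by simp
  ultimately have "hs_approximates p (\<lambda>n x. c * \<phi> n x) (mfun_of (\<lambda>x. c * f x))"
    using a f(1) by (subst hs_approximates_mfun_of) (auto intro: L2fun_cmult)
  then show ?thesis
    using f by (auto simp: hermite_sobolev_def mfun_of_scaleR)
qed

lemma subspace_hermite_sobolev: "subspace (hermite_sobolev p)"
proof (rule subspaceI)
  show "0 \<in> hermite_sobolev p"
    unfolding zero_mfun_def by (rule schwartz_in_hermite_sobolev[OF schwartz_0])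
  then show "u + v \<in> hermite_sobolev p" if "u \<in> hermite_sobolev p" "v \<in> hermite_sobolev p" for u v
    using hermite_sobolev_diff[OF that(1) hermite_sobolev_diff[OF _ that(2)], of 0] by simp
qed (rule hermite_sobolev_scaleR)

lemma l2_eq_0_imp_AE:
  assumes "f \<in> L2fun" "l2 f = 0"
  shows "AE x in lborel. f x = 0"
proof -
  have "(\<integral>x. (f x)\<^sup>2 \<partial>lborel) = 0"
    using assms(2) by (simp add: l2_def)
  then show ?thesis
    by (subst (asm) integral_nonneg_eq_0_iff_AE) (auto simp: L2fun_square_integrable assms(1))
qed

text \<open>The difference of \<open>u\<close> and \<open>v\<close> is orthogonal to the Schwartz functions and at the same time an \<open>L\<^sup>2\<close> limit of
such functions, hence orthogonal to itself.\<close>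

lemma hermite_sobolev_0_eqI:
  assumes "u \<in> hermite_sobolev 0" "v \<in> hermite_sobolev 0"
    and eq: "\<And>\<phi>. \<phi> \<in> schwartz \<Longrightarrow> L2_inner u (mfun_of \<phi>) = L2_inner v (mfun_of \<phi>)"
  shows "u = v"
proof -
  obtain f where f: "f \<in> borel_measurable borel" "u = mfun_of f" by (rule mfun_cases)
  obtain g where g: "g \<in> borel_measurable borel" "v = mfun_of g" by (rule mfun_cases)
  have uv: "u - v = mfun_of (\<lambda>x. f x - g x)"
    using f g by (simp add: mfun_of_diff)
  obtain \<phi> where "hs_approximates 0 \<phi> (u - v)"
    using hermite_sobolev_diff[OF assms(1,2)] by (auto simp: hermite_sobolev_def)
  then have a: "schwartz_Cauchy 0 \<phi>" "(\<lambda>x. f x - g x) \<in> L2fun" "(\<lambda>n. l2 (\<lambda>x. \<phi> n x - (f x - g x))) \<longlonglongrightarrow> 0"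
    unfolding uv using hs_approximates_mfun_of[of "\<lambda>x. f x - g x"] f(1) g(1) by auto
  note S = schwartz_CauchyD[OF a(1)]
  have L2: "f \<in> L2fun" "g \<in> L2fun"
    using assms(1,2)[THEN hermite_sobolev_subset_L2] f g by (simp_all add: mfun_of_in_L2)
  have orth: "(\<integral>x. (f x - g x) * \<phi> n x \<partial>lborel) = 0" for n
    using eq[OF S, of n] f g schwartz_borel[OF S, of n]
      L2fun_mult_integrable[OF L2(1) schwartz_L2fun[OF S], of n] L2fun_mult_integrable[OF L2(2) schwartz_L2fun[OF S], of n]
    by (simp add: L2_inner_mfun_of left_diff_distrib)
  have "(l2 (\<lambda>x. f x - g x))\<^sup>2 \<le> l2 (\<lambda>x. f x - g x) * l2 (\<lambda>x. \<phi> n x - (f x - g x))" for n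
  proof -
    have "(l2 (\<lambda>x. f x - g x))\<^sup>2 = (\<integral>x. (f x - g x) * \<phi> n x - (f x - g x) * (\<phi> n x - (f x - g x)) \<partial>lborel)"
      unfolding l2_square by (intro Bochner_Integration.integral_cong) (simp_all add: algebra_simps power2_eq_square)
    also have "\<dots> = - (\<integral>x. (f x - g x) * (\<phi> n x - (f x - g x)) \<partial>lborel)"
      using orth L2fun_mult_integrable[OF a(2) schwartz_L2fun[OF S]]
        L2fun_mult_integrable[OF a(2) L2fun_diff[OF schwartz_L2fun[OF S] a(2)]]
      by (subst Bochner_Integration.integral_diff) simp_all
    also have "\<dots> \<le> l2 (\<lambda>x. f x - g x) * l2 (\<lambda>x. \<phi> n x - (f x - g x))"
      using L2_cauchy_schwarz[OF a(2) L2fun_diff[OF schwartz_L2fun[OF S] a(2)], of n] by (simp add: abs_le_iff)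
    finally show ?thesis .
  qed
  then have "(l2 (\<lambda>x. f x - g x))\<^sup>2 \<le> l2 (\<lambda>x. f x - g x) * 0"
    by (intro LIMSEQ_le_const[OF tendsto_mult[OF tendsto_const a(3)]]) auto
  then have "AE x in lborel. f x - g x = 0"
    by (intro l2_eq_0_imp_AE a(2)) simp
  then have "AE x in lborel. f x = g x"
    by simp
  then show ?thesis
    unfolding f(2) g(2) by (rule mfun_of_eqI[OF f(1) g(1)])
qed

text \<open>The classical derivative is a candidate by integration by parts, and the only one by the previous lemma.\<close>

lemma dist_partial_schwartz:
  assumes "f \<in> schwartz"
  shows "dist_partial j (mfun_of f) = mfun_of (partial_deriv j f)"
  unfolding dist_partial_def
proof (rule the_equality)
  have *: "L2_inner (mfun_of (partial_deriv j f)) (mfun_of \<phi>) = - L2_inner (mfun_of f) (mfun_of (partial_deriv j \<phi>))"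
    if "\<phi> \<in> schwartz" for \<phi>
    using schwartz_integration_by_parts[OF assms that]
    by (simp add: L2_inner_mfun_of schwartz_borel schwartz_partial_deriv assms that)
  have mem: "mfun_of (partial_deriv j f) \<in> hermite_sobolev 0"
    by (intro schwartz_in_hermite_sobolev schwartz_partial_deriv assms)
  with * show "mfun_of (partial_deriv j f) \<in> hermite_sobolev 0 \<and>
    (\<forall>\<phi>\<in>schwartz. L2_inner (mfun_of (partial_deriv j f)) (mfun_of \<phi>) = - L2_inner (mfun_of f) (mfun_of (partial_deriv j \<phi>)))"
    by blast
  fix g
  assume "g \<in> hermite_sobolev 0 \<and> (\<forall>\<phi>\<in>schwartz. L2_inner g (mfun_of \<phi>) = - L2_inner (mfun_of f) (mfun_of (partial_deriv j \<phi>)))"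
  then show "g = mfun_of (partial_deriv j f)"
    using * mem by (intro hermite_sobolev_0_eqI) auto
qed

section \<open>The Schwartz space as the intersection of the Hermite-Sobolev spaces\<close>

lemma schwartz_Cauchy_uniform_limit:
  fixes \<phi> :: "nat \<Rightarrow> real^'n::finite \<Rightarrow> real"
  assumes "schwartz_Cauchy CARD('n) \<phi>"
  obtains g where "uniform_limit UNIV \<phi> g sequentially"
proof -
  note S = schwartz_CauchyD[OF assms]
  obtain C where C: "C \<ge> 0" "\<And>f x. f \<in> schwartz \<Longrightarrow> \<bar>f (x::real^'n)\<bar> \<le> C * schwartz_norm CARD('n) f"
    using schwartz_sup_le_norm by blast
  have "uniformly_Cauchy_on UNIV \<phi>"
  proof (rule uniformly_Cauchy_onI)
    fix e :: real assume "e > 0"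
    from schwartz_Cauchy_dominates[OF assms C(1) this order_refl]
    obtain N where "\<And>m n. m \<ge> N \<Longrightarrow> n \<ge> N \<Longrightarrow> C * schwartz_norm CARD('n) (\<lambda>x. \<phi> m x - \<phi> n x) < e"
      by blast
    moreover have "dist (\<phi> m x) (\<phi> n x) \<le> C * schwartz_norm CARD('n) (\<lambda>x. \<phi> m x - \<phi> n x)" for m n x
      using C(2)[OF schwartz_diff[OF S S]] by (simp add: dist_real_def)
    ultimately show "\<exists>M. \<forall>x\<in>UNIV. \<forall>m\<ge>M. \<forall>n\<ge>M. dist (\<phi> m x) (\<phi> n x) < e"
      by (intro exI[of _ N] ballI allI impI) (rule order_le_less_trans)
  qed
  then have "uniformly_convergent_on UNIV \<phi>"
    by (rule Cauchy_uniformly_convergent)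
  then show ?thesis
    using that by (auto simp: uniformly_convergent_on_def)
qed

text \<open>One order above the Sobolev inequality the first derivatives converge uniformly, which allows
differentiation of the limit.\<close>

lemma schwartz_Cauchy_limit_derivative:
  fixes \<phi> :: "nat \<Rightarrow> real^'n::finite \<Rightarrow> real"
  assumes "schwartz_Cauchy (Suc CARD('n)) \<phi>" and lim: "\<And>x. (\<lambda>n. \<phi> n x) \<longlonglongrightarrow> g x"
  shows "g differentiable (at x)" and "(\<lambda>n. partial_deriv j (\<phi> n) x) \<longlonglongrightarrow> partial_deriv j g x"
proof -
  note S = schwartz_CauchyD[OF assms(1)]
  have "\<exists>D. uniform_limit UNIV (\<lambda>n. partial_deriv j (\<phi> n)) D sequentially" for j
    using schwartz_Cauchy_uniform_limit[OF schwartz_Cauchy_partial_deriv[OF assms(1)]] by blast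
  then obtain D where D: "\<And>j. uniform_limit UNIV (\<lambda>n. partial_deriv j (\<phi> n)) (D j) sequentially"
    by metis
  have "\<exists>g'. \<forall>x\<in>UNIV. (\<lambda>n. \<phi> n x) \<longlonglongrightarrow> g' x \<and> (g' has_derivative (\<lambda>h. \<Sum>j\<in>UNIV. h $ j * D j x)) (at x within UNIV)"
  proof (rule has_derivative_sequence)
    show "(\<phi> n has_derivative (\<lambda>h. \<Sum>j\<in>UNIV. h $ j * partial_deriv j (\<phi> n) x)) (at x within UNIV)" for n x
      by (intro has_derivative_partials schwartz_differentiable S)
    show "(\<lambda>n. \<phi> n 0) \<longlonglongrightarrow> g 0"
      by (rule lim)
    fix e :: real assume "e > 0"
    define e' where "e' = e / CARD('n)"
    have e': "e' > 0" using \<open>e > 0\<close> by (simp add: e'_def)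
    have "\<forall>\<^sub>F n in sequentially. \<forall>j\<in>UNIV. \<forall>x\<in>UNIV. dist (partial_deriv j (\<phi> n) x) (D j x) < e'"
      by (rule eventually_ball_finite) (use D e' in \<open>auto simp: uniform_limit_iff\<close>)
    then show "\<forall>\<^sub>F n in sequentially. \<forall>x\<in>UNIV. \<forall>h. norm ((\<Sum>j\<in>UNIV. h $ j * partial_deriv j (\<phi> n) x) - (\<Sum>j\<in>UNIV. h $ j * D j x)) \<le> e * norm h"
    proof (eventually_elim, intro ballI allI)
      fix n x and h :: "real^'n"
      assume *: "\<forall>j\<in>UNIV. \<forall>x\<in>UNIV. dist (partial_deriv j (\<phi> n) x) (D j x) < e'"
      have "norm ((\<Sum>j\<in>UNIV. h $ j * partial_deriv j (\<phi> n) x) - (\<Sum>j\<in>UNIV. h $ j * D j x))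
          \<le> (\<Sum>j\<in>UNIV. \<bar>h $ j * (partial_deriv j (\<phi> n) x - D j x)\<bar>)"
        by (simp add: sum_subtractf[symmetric] right_diff_distrib[symmetric] del: sum_subtractf)
      also have "\<dots> \<le> (\<Sum>j\<in>(UNIV::'n set). norm h * e')"
        unfolding abs_mult using * component_le_norm_cart[of h]
        by (intro sum_mono mult_mono) (auto simp: dist_real_def less_imp_le)
      also have "\<dots> = e * norm h"
        by (simp add: e'_def)
      finally show "norm ((\<Sum>j\<in>UNIV. h $ j * partial_deriv j (\<phi> n) x) - (\<Sum>j\<in>UNIV. h $ j * D j x)) \<le> e * norm h" .
    qed
  qed auto
  then obtain g' where g': "\<And>x. (\<lambda>n. \<phi> n x) \<longlonglongrightarrow> g' x"
    "\<And>x. (g' has_derivative (\<lambda>h. \<Sum>j\<in>UNIV. h $ j * D j x)) (at x)"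
    by auto
  have "g' = g"
    using LIMSEQ_unique[OF g'(1) lim] by blast
  note der = g'(2)[unfolded this]
  show "g differentiable (at x)"
    using der[of x] by (auto simp: differentiable_def)
  have "partial_deriv j g x = D j x"
    using partial_deriv_eq_derivative[OF der, of j x]
    by (simp add: axis_def if_distrib[of "\<lambda>c. c * _"] cong: if_cong)
  then show "(\<lambda>n. partial_deriv j (\<phi> n) x) \<longlonglongrightarrow> partial_deriv j g x"
    using tendsto_uniform_limitI[OF D, of x j] by simp
qed

text \<open>By coinduction: the set of all such limits is closed under derivatives because the order in the
hypothesis is arbitrary. The approximating sequence may depend on the order.\<close>

lemma schwartz_of_pointwise_limits:
  fixes f :: "real^'n::finite \<Rightarrow> real"
  assumes "\<And>p. \<exists>\<phi>. schwartz_Cauchy p \<phi> \<and> (\<forall>x. (\<lambda>n. \<phi> n x) \<longlonglongrightarrow> f x)"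
  shows "f \<in> schwartz"
proof -
  let ?A = "{g :: real^'n \<Rightarrow> real. \<forall>p. \<exists>\<phi>. schwartz_Cauchy p \<phi> \<and> (\<forall>x. (\<lambda>n. \<phi> n x) \<longlonglongrightarrow> g x)}"
  show ?thesis
  proof (rule schwartz_coinduct[of f ?A])
    show "f \<in> ?A" using assms by blast
  next
    fix g :: "real^'n \<Rightarrow> real" and x :: "real^'n" assume "g \<in> ?A"
    then obtain \<phi> where "schwartz_Cauchy (Suc CARD('n)) \<phi>" "\<And>x. (\<lambda>n. \<phi> n x) \<longlonglongrightarrow> g x"
      by blast
    then show "g differentiable (at x)"
      by (rule schwartz_Cauchy_limit_derivative)
  next
    fix g :: "real^'n \<Rightarrow> real" and j assume g: "g \<in> ?A"
    have "\<exists>\<psi>. schwartz_Cauchy p \<psi> \<and> (\<forall>x. (\<lambda>n. \<psi> n x) \<longlonglongrightarrow> partial_deriv j g x)" for p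
    proof -
      from g obtain \<phi> where \<phi>: "schwartz_Cauchy (Suc (max p CARD('n))) \<phi>" "\<And>x. (\<lambda>n. \<phi> n x) \<longlonglongrightarrow> g x"
        by blast
      have "schwartz_Cauchy (Suc CARD('n)) \<phi>" "schwartz_Cauchy (Suc p) \<phi>"
        using \<phi>(1) by (auto intro: schwartz_Cauchy_mono)
      then show ?thesis
        using schwartz_Cauchy_limit_derivative(2)[OF _ \<phi>(2)] schwartz_Cauchy_partial_deriv
        by (intro exI[of _ "\<lambda>n. partial_deriv j (\<phi> n)"]) auto
    qed
    then show "partial_deriv j g \<in> ?A"
      by blast
  next
    fix g :: "real^'n \<Rightarrow> real" and \<alpha> :: "'n \<Rightarrow> nat" assume g: "g \<in> ?A"
    obtain p C where C: "C \<ge> 0" "\<And>f x. f \<in> schwartz \<Longrightarrow> \<bar>multi_power x \<alpha> * f x\<bar> \<le> C * schwartz_norm p f"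
      using schwartz_sup_multi_power_le_norm[of \<alpha>] by blast
    from g obtain \<phi> where \<phi>: "schwartz_Cauchy p \<phi>" "\<And>x. (\<lambda>n. \<phi> n x) \<longlonglongrightarrow> g x"
      by blast
    obtain K where K: "\<And>n. schwartz_norm p (\<phi> n) \<le> K"
      using schwartz_Cauchy_bounded[OF \<phi>(1)] by blast
    have "\<bar>multi_power x \<alpha> * g x\<bar> \<le> C * K" for x
    proof (rule LIMSEQ_le_const2)
      show "(\<lambda>n. \<bar>multi_power x \<alpha> * \<phi> n x\<bar>) \<longlonglongrightarrow> \<bar>multi_power x \<alpha> * g x\<bar>"
        by (intro tendsto_intros \<phi>(2))
      have "\<bar>multi_power x \<alpha> * \<phi> n x\<bar> \<le> C * K" for n
        using C(2)[OF schwartz_CauchyD[OF \<phi>(1)], of x n] mult_left_mono[OF K C(1), of n] by linarith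
      then show "\<exists>N. \<forall>n\<ge>N. \<bar>multi_power x \<alpha> * \<phi> n x\<bar> \<le> C * K" by blast
    qed
    then show "bounded (range (\<lambda>x. multi_power x \<alpha> * g x))"
      by (auto simp: bounded_iff)
  qed
qed

text \<open>By Fatou's lemma \<open>\<parallel>f - g\<parallel>\<^sup>2\<close> is at most the lower limit of \<open>\<parallel>\<phi> n - g\<parallel>\<^sup>2\<close>, which is zero.\<close>

lemma AE_eq_of_l2_limit:
  assumes "\<And>n. \<phi> n \<in> L2fun" "f \<in> borel_measurable borel" "g \<in> L2fun"
    and lim: "\<And>x. (\<lambda>n. \<phi> n x) \<longlonglongrightarrow> f x" and l2: "(\<lambda>n. l2 (\<lambda>x. \<phi> n x - g x)) \<longlonglongrightarrow> 0"
  shows "AE x in lborel. f x = g x"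
proof -
  have meas: "\<phi> n \<in> borel_measurable borel" "g \<in> borel_measurable borel" for n
    by (intro L2fun_borel assms)+
  have "(\<integral>\<^sup>+x. ennreal ((\<phi> n x - g x)\<^sup>2) \<partial>lborel) = ennreal ((l2 (\<lambda>x. \<phi> n x - g x))\<^sup>2)" for n
    unfolding l2_square by (intro nn_integral_eq_integral L2fun_square_integrable L2fun_diff assms) simp
  moreover have "(\<lambda>n. ennreal ((l2 (\<lambda>x. \<phi> n x - g x))\<^sup>2)) \<longlonglongrightarrow> ennreal (0\<^sup>2)"
    by (intro tendsto_ennrealI tendsto_power l2)
  ultimately have "liminf (\<lambda>n. \<integral>\<^sup>+x. ennreal ((\<phi> n x - g x)\<^sup>2) \<partial>lborel) = 0"
    by (intro lim_imp_Liminf) simp_all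
  moreover have "(\<integral>\<^sup>+x. liminf (\<lambda>n. ennreal ((\<phi> n x - g x)\<^sup>2)) \<partial>lborel)
      \<le> liminf (\<lambda>n. \<integral>\<^sup>+x. ennreal ((\<phi> n x - g x)\<^sup>2) \<partial>lborel)"
    using meas by (intro nn_integral_liminf) simp
  moreover have "liminf (\<lambda>n. ennreal ((\<phi> n x - g x)\<^sup>2)) = ennreal ((f x - g x)\<^sup>2)" for x
    by (intro lim_imp_Liminf tendsto_ennrealI tendsto_intros lim) simp
  ultimately have "(\<integral>\<^sup>+x. ennreal ((f x - g x)\<^sup>2) \<partial>lborel) = 0"
    by simp
  then have "AE x in lborel. ennreal ((f x - g x)\<^sup>2) = 0"
    using meas assms(2) by (subst (asm) nn_integral_0_iff_AE) auto
  then show ?thesis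
    by eventually_elim simp
qed

text \<open>Each order comes with its own approximating sequence. By \<open>hs_approximates_diff_tendsto_0\<close> and the Sobolev
inequality, any two of them have the same pointwise limit, which is therefore a single function
approximated in every order, and it represents \<open>u\<close>.\<close>

theorem hermite_sobolev_Inter:
  fixes u :: "'n::finite mfun"
  assumes "\<And>p. u \<in> hermite_sobolev p"
  shows "u \<in> mfun_of ` schwartz"
proof -
  obtain f where f: "f \<in> borel_measurable borel" "u = mfun_of f" by (rule mfun_cases)
  obtain \<phi> where \<phi>: "\<And>p. hs_approximates p (\<phi> p) u"
    using assms unfolding hermite_sobolev_def mem_Collect_eq by metis
  let ?d = "CARD('n)"
  obtain g where g: "uniform_limit UNIV (\<phi> ?d) g sequentially"
    using schwartz_Cauchy_uniform_limit[OF hs_approximates_Cauchy[OF \<phi>]] by blast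
  have lim: "(\<lambda>n. \<phi> ?d n x) \<longlonglongrightarrow> g x" for x
    using tendsto_uniform_limitI[OF g] by simp
  obtain C where C: "C \<ge> 0" "\<And>f x. f \<in> schwartz \<Longrightarrow> \<bar>f (x::real^'n)\<bar> \<le> C * schwartz_norm ?d f"
    using schwartz_sup_le_norm by blast
  have "g \<in> schwartz"
  proof (rule schwartz_of_pointwise_limits)
    fix p
    let ?q = "max p ?d"
    note S = \<phi>[THEN hs_approximates_Cauchy, THEN schwartz_CauchyD]
    have "(\<lambda>n. \<phi> ?q n x - \<phi> ?d n x) \<longlonglongrightarrow> 0" for x
    proof (rule Lim_null_comparison)
      show "\<forall>\<^sub>F n in sequentially. norm (\<phi> ?q n x - \<phi> ?d n x) \<le> C * schwartz_norm ?d (\<lambda>x. \<phi> ?q n x - \<phi> ?d n x)"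
        using C(2)[OF schwartz_diff[OF S S]] by simp
      show "(\<lambda>n. C * schwartz_norm ?d (\<lambda>x. \<phi> ?q n x - \<phi> ?d n x)) \<longlonglongrightarrow> 0"
        by (intro tendsto_mult_right_zero hs_approximates_diff_tendsto_0[OF \<phi> \<phi>]) auto
    qed
    then have "(\<lambda>n. (\<phi> ?q n x - \<phi> ?d n x) + \<phi> ?d n x) \<longlonglongrightarrow> 0 + g x" for x
      by (intro tendsto_add lim)
    then have "(\<lambda>n. \<phi> ?q n x) \<longlonglongrightarrow> g x" for x
      by simp
    moreover have "schwartz_Cauchy p (\<phi> ?q)"
      by (rule schwartz_Cauchy_mono[OF hs_approximates_Cauchy[OF \<phi>]]) simp
    ultimately show "\<exists>\<phi>. schwartz_Cauchy p \<phi> \<and> (\<forall>x. (\<lambda>n. \<phi> n x) \<longlonglongrightarrow> g x)"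
      by blast
  qed
  moreover have "AE x in lborel. g x = f x"
    using \<phi>[of ?d] unfolding f(2) hs_approximates_mfun_of[OF f(1)]
    by (intro AE_eq_of_l2_limit[of "\<phi> ?d"] lim schwartz_borel \<open>g \<in> schwartz\<close>) (auto intro: schwartz_L2fun schwartz_CauchyD)
  then have "mfun_of g = u"
    unfolding f(2) by (intro mfun_of_eqI f(1) schwartz_borel \<open>g \<in> schwartz\<close>)
  ultimately show ?thesis by blast
qed

section \<open>Testing a Bochner integral with a functional\<close>

lemma sum_in_subspace_linear_on:
  fixes l :: "'b::real_vector \<Rightarrow> real"
  assumes "subspace X" "finite A" "\<And>y. y \<in> A \<Longrightarrow> y \<in> X"
    and "\<And>y z. y \<in> X \<Longrightarrow> z \<in> X \<Longrightarrow> l (y + z) = l y + l z"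
    and "\<And>c y. y \<in> X \<Longrightarrow> l (c *\<^sub>R y) = c * l y"
  shows "(\<Sum>y\<in>A. c y *\<^sub>R y) \<in> X \<and> l (\<Sum>y\<in>A. c y *\<^sub>R y) = (\<Sum>y\<in>A. c y * l y)"
  using assms(2,3)
proof (induction A rule: finite_induct)
  case empty
  have "l (0 *\<^sub>R 0) = 0 * l 0"
    by (rule assms(5)[OF subspace_0[OF assms(1)]])
  then show ?case using subspace_0[OF assms(1)] by simp
next
  case (insert a A)
  then have "c a *\<^sub>R a \<in> X" using subspace_scale[OF assms(1)] by simp
  with insert show ?case using subspace_add[OF assms(1)] assms(4,5) by simp
qed

text \<open>The simple functions approximating \<open>f\<close> are mapped by \<open>l\<close> to real simple functions approximating
\<open>l \<circ> f\<close>. Linearity is asked on \<open>X\<close> because an \<open>L\<^sup>2\<close> pairing on \<open>mfun\<close> is not linear outside \<open>L2\<close>.\<close>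

lemma has_bochner_integral_in_functional:
  fixes l :: "'b::real_vector \<Rightarrow> real"
  assumes int: "has_bochner_integral_in X N M f x" and X: "subspace X"
    and add: "\<And>y z. y \<in> X \<Longrightarrow> z \<in> X \<Longrightarrow> l (y + z) = l y + l z"
    and scale: "\<And>c y. y \<in> X \<Longrightarrow> l (c *\<^sub>R y) = c * l y"
    and bound: "\<And>y. y \<in> X \<Longrightarrow> \<bar>l y\<bar> \<le> C * N y" and C: "C > 0"
    and meas: "(\<lambda>t. l (f t)) \<in> borel_measurable M"
  shows "has_bochner_integral M (\<lambda>t. l (f t)) (l x)"
proof -
  obtain s where f: "\<And>t. t \<in> space M \<Longrightarrow> f t \<in> X" and x: "x \<in> X"
    and s: "\<And>i. Bochner_Integration.simple_bochner_integrable M (s i)" "\<And>i t. t \<in> space M \<Longrightarrow> s i t \<in> X"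
    and lim1: "(\<lambda>i. \<integral>\<^sup>+t. ennreal (N (f t - s i t)) \<partial>M) \<longlonglongrightarrow> 0"
    and lim2: "(\<lambda>i. N (Bochner_Integration.simple_bochner_integral M (s i) - x)) \<longlonglongrightarrow> 0"
    using int unfolding has_bochner_integral_in_def by blast
  let ?J = "\<lambda>i. Bochner_Integration.simple_bochner_integral M (s i)"
  have diff: "l (y - z) = l y - l z" if "y \<in> X" "z \<in> X" for y z
    using add[OF that(1) subspace_scale[OF X that(2), of "-1"]] scale[OF that(2), of "-1"] by simp
  have l0: "l 0 = 0"
    using scale[OF subspace_0[OF X], of 0] by simp
  have sf: "simple_function M (s i)" "emeasure M {t \<in> space M. s i t \<noteq> 0} \<noteq> \<infinity>" for i
    using s(1)[of i] by (auto elim: Bochner_Integration.simple_bochner_integrable.cases)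
  have sf': "simple_function M (\<lambda>t. l (s i t))" for i
    using simple_function_compose[OF sf(1), of l] by (simp add: comp_def)
  have sbi: "Bochner_Integration.simple_bochner_integrable M (\<lambda>t. l (s i t))" for i
  proof (rule Bochner_Integration.simple_bochner_integrable.intros[OF sf'])
    have "emeasure M {t \<in> space M. l (s i t) \<noteq> 0} \<le> emeasure M {t \<in> space M. s i t \<noteq> 0}"
      using l0 measurable_simple_function[OF sf(1)] by (intro emeasure_mono) (auto)
    then show "emeasure M {t \<in> space M. l (s i t) \<noteq> 0} \<noteq> \<infinity>"
      using sf(2)[of i] by (auto simp: top_unique)
  qed
  have integral: "?J i \<in> X"
    "Bochner_Integration.simple_bochner_integral M (\<lambda>t. l (s i t)) = l (?J i)" for i
  proof -
    have "finite (s i ` space M)"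
      using sf(1) by (simp add: simple_function_def)
    then have *: "(\<Sum>y\<in>s i ` space M. measure M {t \<in> space M. s i t = y} *\<^sub>R y) \<in> X \<and>
        l (\<Sum>y\<in>s i ` space M. measure M {t \<in> space M. s i t = y} *\<^sub>R y)
          = (\<Sum>y\<in>s i ` space M. measure M {t \<in> space M. s i t = y} * l y)"
      by (rule sum_in_subspace_linear_on[OF X _ _ add scale]) (use s(2) in auto)
    show "?J i \<in> X"
      unfolding Bochner_Integration.simple_bochner_integral_def using * by blast
    have "Bochner_Integration.simple_bochner_integral M (\<lambda>t. l (s i t))
        = (\<Sum>y\<in>s i ` space M. measure M {t \<in> space M. s i t = y} *\<^sub>R l y)"
      by (rule simple_bochner_integral_partition[OF sbi sf(1)]) auto
    then show "Bochner_Integration.simple_bochner_integral M (\<lambda>t. l (s i t)) = l (?J i)"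
      unfolding Bochner_Integration.simple_bochner_integral_def[of M "s i"] using * by simp
  qed
  show ?thesis
  proof (rule has_bochner_integral.intros[OF meas sbi])
    show "(\<lambda>i. \<integral>\<^sup>+t. ennreal (norm (l (f t) - l (s i t))) \<partial>M) \<longlonglongrightarrow> 0"
    proof (rule tendsto_sandwich[OF _ _ tendsto_const])
      have [measurable]: "(\<lambda>t. l (s i t)) \<in> borel_measurable M" for i
        by (rule borel_measurable_simple_function[OF sf'])
      have "(\<integral>\<^sup>+t. ennreal (norm (l (f t) - l (s i t))) \<partial>M)
          \<le> ennreal C * (\<integral>\<^sup>+t. ennreal (N (f t - s i t)) \<partial>M)" for i
      proof -
        \<comment> \<open>\<open>N (f t - s i t)\<close> need not be measurable, so \<open>C\<close> is taken out of the integral of the left-hand side.\<close>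
        have "ennreal (norm (l (f t) - l (s i t))) = ennreal C * ennreal (norm (l (f t) - l (s i t)) / C)" for t
          using C by (simp add: ennreal_mult[symmetric])
        then have "(\<integral>\<^sup>+t. ennreal (norm (l (f t) - l (s i t))) \<partial>M)
            = ennreal C * (\<integral>\<^sup>+t. ennreal (norm (l (f t) - l (s i t)) / C) \<partial>M)"
          using meas by (simp add: nn_integral_cmult)
        also have "\<dots> \<le> ennreal C * (\<integral>\<^sup>+t. ennreal (N (f t - s i t)) \<partial>M)"
        proof (intro mult_left_mono nn_integral_mono ennreal_leI)
          fix t assume t: "t \<in> space M"
          have "norm (l (f t) - l (s i t)) \<le> C * N (f t - s i t)"
            using bound[OF subspace_diff[OF X f[OF t] s(2)[OF t]], of i] diff[OF f[OF t] s(2)[OF t]] by simp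
          then show "norm (l (f t) - l (s i t)) / C \<le> N (f t - s i t)"
            using C by (simp add: pos_divide_le_eq mult.commute)
        qed simp
        finally show ?thesis .
      qed
      then show "\<forall>\<^sub>F i in sequentially. (\<integral>\<^sup>+t. ennreal (norm (l (f t) - l (s i t))) \<partial>M)
          \<le> ennreal C * (\<integral>\<^sup>+t. ennreal (N (f t - s i t)) \<partial>M)" by simp
      show "(\<lambda>i. ennreal C * (\<integral>\<^sup>+t. ennreal (N (f t - s i t)) \<partial>M)) \<longlonglongrightarrow> 0"
        using ennreal_tendsto_cmult[OF _ lim1, of "ennreal C"] by simp
    qed simp
    have "(\<lambda>i. l (?J i) - l x) \<longlonglongrightarrow> 0"
    proof (rule Lim_null_comparison)
      show "\<forall>\<^sub>F i in sequentially. norm (l (?J i) - l x)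
          \<le> C * N (?J i - x)"
        using bound[OF subspace_diff[OF X integral(1) x]] diff[OF integral(1) x] by simp
      show "(\<lambda>i. C * N (?J i - x)) \<longlonglongrightarrow> 0"
        using tendsto_mult_right_zero[OF lim2] .
    qed
    then show "(\<lambda>i. Bochner_Integration.simple_bochner_integral M (\<lambda>t. l (s i t))) \<longlonglongrightarrow> l x"
      by (simp add: integral(2) LIM_zero_iff)
  qed
qed

lemma hs_norm_vec_bounds:
  assumes "u \<in> hermite_sobolev_vec p"
  shows "L2_norm (u $ k) \<le> hs_norm_vec p u" "f \<in> schwartz \<Longrightarrow> u $ k = mfun_of f \<Longrightarrow> schwartz_norm p f \<le> hs_norm_vec p u"
proof -
  have "u $ k \<in> hermite_sobolev p" for k
    using assms by (simp add: hermite_sobolev_vec_def)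
  then have "hs_inner p (u $ k) (u $ k) \<le> hs_inner_vec p u u"
    unfolding hs_inner_vec_def by (intro member_le_sum) (auto intro: hs_inner_nonneg)
  then have *: "sqrt (hs_inner p (u $ k) (u $ k)) \<le> hs_norm_vec p u"
    by (simp add: hs_norm_vec_def)
  show "L2_norm (u $ k) \<le> hs_norm_vec p u"
    using real_le_rsqrt[OF L2_norm_le_hs_norm[OF \<open>\<And>k. u $ k \<in> hermite_sobolev p\<close>, of k]] * by linarith
  show "schwartz_norm p f \<le> hs_norm_vec p u" if "f \<in> schwartz" "u $ k = mfun_of f"
    using * that by (simp add: hs_inner_schwartz)
qed

lemma subspace_hermite_sobolev_vec: "subspace (hermite_sobolev_vec p)"
  using subspace_hermite_sobolev[of p]
  by (auto simp: hermite_sobolev_vec_def subspace_def)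

section \<open>Square-integrable vector fields\<close>

text \<open>The \<open>L\<^sup>2\<close> inner product and norm of vector fields, on representatives.\<close>

definition pairing :: "('n \<Rightarrow> real^'n::finite \<Rightarrow> real) \<Rightarrow> ('n \<Rightarrow> real^'n \<Rightarrow> real) \<Rightarrow> real" where
  "pairing F \<phi> = (\<Sum>k\<in>UNIV. \<integral>x. F k x * \<phi> k x \<partial>lborel)"

definition l2_vec :: "('n \<Rightarrow> real^'n::finite \<Rightarrow> real) \<Rightarrow> real" where
  "l2_vec F = L2_set (\<lambda>k. l2 (F k)) UNIV"

lemma l2_vec_nonneg [simp]: "0 \<le> l2_vec F"
  by (simp add: l2_vec_def)

lemma l2_vec_square: "(l2_vec F)\<^sup>2 = pairing F F"
  by (simp add: l2_vec_def L2_set_def sum_nonneg pairing_def l2_square flip: power2_eq_square)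

lemma l2_le_l2_vec: "l2 (F k) \<le> l2_vec F"
  unfolding l2_vec_def by (rule member_le_L2_set) auto

lemma l2_vec_le_sum: "l2_vec F \<le> (\<Sum>k\<in>UNIV. l2 (F k))"
  unfolding l2_vec_def by (rule L2_set_le_sum) simp

lemma pairing_cauchy_schwarz:
  assumes "\<And>k. F k \<in> L2fun" "\<And>k. \<phi> k \<in> L2fun"
  shows "\<bar>pairing F \<phi>\<bar> \<le> l2_vec F * l2_vec \<phi>"
proof -
  have "\<bar>pairing F \<phi>\<bar> \<le> (\<Sum>k\<in>UNIV. \<bar>l2 (F k)\<bar> * \<bar>l2 (\<phi> k)\<bar>)"
    unfolding pairing_def
    by (rule order_trans[OF sum_abs], rule sum_mono) (simp add: L2_cauchy_schwarz assms)
  also have "\<dots> \<le> l2_vec F * l2_vec \<phi>"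
    unfolding l2_vec_def by (rule L2_set_mult_ineq)
  finally show ?thesis .
qed

lemma pairing_commute: "pairing F \<phi> = pairing \<phi> F"
  by (simp add: pairing_def mult.commute)

lemma pairing_diff_left:
  assumes "\<And>k. F k \<in> L2fun" "\<And>k. G k \<in> L2fun" "\<And>k. \<phi> k \<in> L2fun"
  shows "pairing (\<lambda>k x. F k x - G k x) \<phi> = pairing F \<phi> - pairing G \<phi>"
  unfolding pairing_def left_diff_distrib sum_subtractf[symmetric]
  by (intro sum.cong refl Bochner_Integration.integral_diff L2fun_mult_integrable assms)

lemma pairing_diff_right:
  assumes "\<And>k. F k \<in> L2fun" "\<And>k. G k \<in> L2fun" "\<And>k. \<phi> k \<in> L2fun"
  shows "pairing \<phi> (\<lambda>k x. F k x - G k x) = pairing \<phi> F - pairing \<phi> G"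
  using pairing_diff_left[OF assms] by (simp add: pairing_commute)

lemma bochner_integral_in_pairing:
  fixes \<phi> :: "'n::finite \<Rightarrow> real^'n \<Rightarrow> real"
  assumes int: "has_bochner_integral_in (hermite_sobolev_vec p) (hs_norm_vec p) M f x"
    and \<phi>: "\<And>k. \<phi> k \<in> schwartz"
    and f: "\<And>t k. t \<in> space M \<Longrightarrow> f t $ k = mfun_of (F t k)" "\<And>t k. t \<in> space M \<Longrightarrow> F t k \<in> L2fun"
    and x: "\<And>k. x $ k = mfun_of (Z k)" "\<And>k. Z k \<in> L2fun"
    and meas: "(\<lambda>t. pairing (F t) \<phi>) \<in> borel_measurable M"
  shows "has_bochner_integral M (\<lambda>t. pairing (F t) \<phi>) (pairing Z \<phi>)"
proof -
  let ?X = "hermite_sobolev_vec p :: ('n mfun ^ 'n) set"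
  define l where "l y = (\<Sum>k\<in>UNIV. L2_inner (y $ k) (mfun_of (\<phi> k)))" for y :: "'n mfun ^ 'n"
  have l_pairing: "l y = pairing Y \<phi>" if "\<And>k. y $ k = mfun_of (Y k)" "\<And>k. Y k \<in> L2fun" for y Y
    by (simp add: l_def pairing_def that L2_inner_mfun_of L2fun_borel schwartz_borel[OF \<phi>])
  have rep: "\<exists>Y. (\<forall>k. y $ k = mfun_of (Y k)) \<and> (\<forall>k. Y k \<in> L2fun)" if "y \<in> ?X" for y
  proof -
    have "\<exists>g. y $ k = mfun_of g \<and> g \<in> L2fun" for k
    proof -
      obtain g where g: "g \<in> borel_measurable borel" "y $ k = mfun_of g" by (rule mfun_cases)
      moreover have "y $ k \<in> L2"
        using that by (auto simp: hermite_sobolev_vec_def intro: hermite_sobolev_subset_L2)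
      ultimately show ?thesis using mfun_of_in_L2 by auto
    qed
    then show ?thesis by metis
  qed
  define C where "C = (\<Sum>k\<in>UNIV. l2 (\<phi> k)) + 1"
  have C: "C > 0"
    by (simp add: C_def add_nonneg_pos sum_nonneg)
  have "has_bochner_integral M (\<lambda>t. l (f t)) (l x)"
  proof (rule has_bochner_integral_in_functional[OF int subspace_hermite_sobolev_vec _ _ _ C])
    fix y z assume y: "y \<in> ?X" and z: "z \<in> ?X"
    obtain Y where Y: "\<And>k. y $ k = mfun_of (Y k)" "\<And>k. Y k \<in> L2fun" using rep[OF y] by blast
    obtain Z where Z: "\<And>k. z $ k = mfun_of (Z k)" "\<And>k. Z k \<in> L2fun" using rep[OF z] by blast
    have "l (y + z) = pairing (\<lambda>k x. Y k x + Z k x) \<phi>"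
      using Y Z by (intro l_pairing) (auto simp: mfun_of_add L2fun_borel intro: L2fun_add)
    also have "\<dots> = l y + l z"
      unfolding l_pairing[OF Y] l_pairing[OF Z] pairing_def distrib_right sum.distrib[symmetric]
      by (intro sum.cong refl Bochner_Integration.integral_add L2fun_mult_integrable Y Z schwartz_L2fun \<phi>)
    finally show "l (y + z) = l y + l z" .
  next
    fix c y assume y: "y \<in> ?X"
    obtain Y where Y: "\<And>k. y $ k = mfun_of (Y k)" "\<And>k. Y k \<in> L2fun" using rep[OF y] by blast
    have "l (c *\<^sub>R y) = pairing (\<lambda>k x. c * Y k x) \<phi>"
      using Y by (intro l_pairing) (auto simp: mfun_of_scaleR L2fun_borel intro: L2fun_cmult)
    also have "\<dots> = c * l y"
      unfolding l_pairing[OF Y] pairing_def by (simp add: sum_distrib_left mult.assoc)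
    finally show "l (c *\<^sub>R y) = c * l y" .
  next
    fix y assume y: "y \<in> ?X"
    obtain Y where Y: "\<And>k. y $ k = mfun_of (Y k)" "\<And>k. Y k \<in> L2fun" using rep[OF y] by blast
    have "\<bar>l y\<bar> \<le> (\<Sum>k\<in>UNIV. l2 (Y k) * l2 (\<phi> k))"
      unfolding l_pairing[OF Y] pairing_def
      by (rule order_trans[OF sum_abs], rule sum_mono) (intro L2_cauchy_schwarz Y schwartz_L2fun \<phi>)
    also have "\<dots> \<le> (\<Sum>k\<in>UNIV. hs_norm_vec p y * l2 (\<phi> k))"
      using hs_norm_vec_bounds(1)[OF y] Y by (intro sum_mono mult_right_mono) (simp_all add: L2_norm_mfun_of L2fun_borel)
    also have "\<dots> \<le> C * hs_norm_vec p y"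
    proof -
      have "0 \<le> hs_norm_vec p y"
        using hs_norm_vec_bounds(1)[OF y, of undefined] Y l2_nonneg order_trans
        by (metis L2_norm_mfun_of L2fun_borel)
      then show ?thesis
        by (simp add: C_def sum_distrib_left[symmetric] algebra_simps)
    qed
    finally show "\<bar>l y\<bar> \<le> C * hs_norm_vec p y" .
  next
    show "(\<lambda>t. l (f t)) \<in> borel_measurable M"
      using meas by (rule measurable_cong[THEN iffD1, rotated]) (use l_pairing f in metis)
  qed
  moreover have "l (f t) = pairing (F t) \<phi>" if "t \<in> space M" for t
    using f[OF that] by (rule l_pairing)
  ultimately show ?thesis
    using l_pairing[OF x] by (simp cong: has_bochner_integral_cong)
qed

lemma l2_vec_triangle:
  assumes "\<And>k. F k \<in> L2fun" "\<And>k. G k \<in> L2fun"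
  shows "l2_vec F \<le> l2_vec G + l2_vec (\<lambda>k x. F k x - G k x)"
proof -
  have "l2 (F k) \<le> l2 (G k) + l2 (\<lambda>x. F k x - G k x)" for k
    using l2_add_le[OF assms(2) L2fun_diff[OF assms], of k k k] by simp
  then show ?thesis
    unfolding l2_vec_def by (intro order_trans[OF L2_set_mono L2_set_triangle_ineq]) auto
qed

lemma l2_vec_diff_tendsto_0:
  assumes "\<And>k. ((\<lambda>s. l2 (\<lambda>x. F s k x - G k x)) \<longlongrightarrow> 0) net"
  shows "((\<lambda>s. l2_vec (\<lambda>k x. F s k x - G k x)) \<longlongrightarrow> 0) net"
proof (rule Lim_null_comparison)
  show "\<forall>\<^sub>F s in net. norm (l2_vec (\<lambda>k x. F s k x - G k x)) \<le> (\<Sum>k\<in>UNIV. l2 (\<lambda>x. F s k x - G k x))"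
    using l2_vec_le_sum by (auto intro!: always_eventually)
  show "((\<lambda>s. \<Sum>k\<in>UNIV. l2 (\<lambda>x. F s k x - G k x)) \<longlongrightarrow> 0) net"
    by (rule tendsto_null_sum) (rule assms)
qed

lemma continuous_on_l2_vec:
  fixes F :: "real \<Rightarrow> 'n::finite \<Rightarrow> real^'n \<Rightarrow> real"
  assumes L2: "\<And>t k. t \<in> I \<Longrightarrow> F t k \<in> L2fun"
    and cont: "\<And>t k. t \<in> I \<Longrightarrow> ((\<lambda>s. l2 (\<lambda>x. F s k x - F t k x)) \<longlongrightarrow> 0) (at t within I)"
  shows "continuous_on I (\<lambda>t. l2_vec (F t))"
  unfolding continuous_on_def
proof
  fix t assume t: "t \<in> I"
  have "((\<lambda>s. l2_vec (F s) - l2_vec (F t)) \<longlongrightarrow> 0) (at t within I)"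
  proof (rule Lim_null_comparison[OF _ l2_vec_diff_tendsto_0[OF cont[OF t]]])
    have "norm (l2_vec (F s) - l2_vec (F t)) \<le> l2_vec (\<lambda>k x. F s k x - F t k x)" if "s \<in> I" for s
    proof -
      have "l2_vec (\<lambda>k x. F t k x - F s k x) = l2_vec (\<lambda>k x. F s k x - F t k x)"
        unfolding l2_vec_def by (subst l2_minus_commute) (rule refl)
      then show ?thesis
        using l2_vec_triangle[of "F s" "F t", OF L2[OF that] L2[OF t]]
          l2_vec_triangle[of "F t" "F s", OF L2[OF t] L2[OF that]] by simp
    qed
    then show "\<forall>\<^sub>F s in at t within I. norm (l2_vec (F s) - l2_vec (F t)) \<le> l2_vec (\<lambda>k x. F s k x - F t k x)"
      by (auto simp: eventually_at_filter)
  qed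
  then show "((\<lambda>s. l2_vec (F s)) \<longlongrightarrow> l2_vec (F t)) (at t within I)"
    by (simp add: LIM_zero_iff)
qed

lemma continuous_on_pairing:
  fixes F :: "real \<Rightarrow> 'n::finite \<Rightarrow> real^'n \<Rightarrow> real"
  assumes L2: "\<And>t k. t \<in> I \<Longrightarrow> F t k \<in> L2fun" and \<phi>: "\<And>k. \<phi> k \<in> L2fun"
    and cont: "\<And>t k. t \<in> I \<Longrightarrow> ((\<lambda>s. l2 (\<lambda>x. F s k x - F t k x)) \<longlongrightarrow> 0) (at t within I)"
  shows "continuous_on I (\<lambda>t. pairing (F t) \<phi>)"
  unfolding continuous_on_def
proof
  fix t assume t: "t \<in> I"
  have "((\<lambda>s. pairing (F s) \<phi> - pairing (F t) \<phi>) \<longlongrightarrow> 0) (at t within I)"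
  proof (rule Lim_null_comparison[OF _ tendsto_mult_left_zero[OF l2_vec_diff_tendsto_0[OF cont[OF t]]]])
    have "norm (pairing (F s) \<phi> - pairing (F t) \<phi>) \<le> l2_vec (\<lambda>k x. F s k x - F t k x) * l2_vec \<phi>" if "s \<in> I" for s
      using pairing_cauchy_schwarz[of "\<lambda>k x. F s k x - F t k x" \<phi>, OF L2fun_diff[OF L2[OF that] L2[OF t]] \<phi>]
        pairing_diff_left[of "F s" "F t" \<phi>, OF L2[OF that] L2[OF t] \<phi>] by simp
    then show "\<forall>\<^sub>F s in at t within I. norm (pairing (F s) \<phi> - pairing (F t) \<phi>) \<le> l2_vec (\<lambda>k x. F s k x - F t k x) * l2_vec \<phi>"
      by (auto simp: eventually_at_filter)
  qed
  then show "((\<lambda>s. pairing (F s) \<phi>) \<longlongrightarrow> pairing (F t) \<phi>) (at t within I)"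
    by (simp add: LIM_zero_iff)
qed

section \<open>From an energy estimate to uniqueness\<close>

text \<open>Here \<open>W\<close> solves \<open>W' = G\<close>, \<open>W 0 = 0\<close> weakly, that is, after testing with fixed Schwartz fields. The energy
\<open>m t = \<parallel>W t\<parallel>\<^sup>2\<close> is differentiable with \<open>m' = 2 \<langle>G, W\<rangle> \<le> 2 C m\<close>, and \<open>exp (- 2 C t) m t\<close> is
nonincreasing.\<close>

lemma energy_gronwall:
  fixes W G :: "real \<Rightarrow> 'n::finite \<Rightarrow> real^'n \<Rightarrow> real"
  assumes T: "T \<ge> 0"
    and W: "\<And>t k. t \<in> {0..T} \<Longrightarrow> W t k \<in> schwartz"
    and G: "\<And>t k. t \<in> {0..T} \<Longrightarrow> G t k \<in> L2fun"
    and contW: "\<And>t k. t \<in> {0..T} \<Longrightarrow> ((\<lambda>s. l2 (\<lambda>x. W s k x - W t k x)) \<longlongrightarrow> 0) (at t within {0..T})"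
    and contG: "\<And>t k. t \<in> {0..T} \<Longrightarrow> ((\<lambda>s. l2 (\<lambda>x. G s k x - G t k x)) \<longlongrightarrow> 0) (at t within {0..T})"
    and eq: "\<And>\<phi> t. (\<And>k. \<phi> k \<in> schwartz) \<Longrightarrow> t \<in> {0..T} \<Longrightarrow>
      ((\<lambda>s. pairing (G s) \<phi>) has_integral pairing (W t) \<phi>) {0..t}"
    and energy: "\<And>t. t \<in> {0..T} \<Longrightarrow> pairing (G t) (W t) \<le> C * (l2_vec (W t))\<^sup>2"
  shows "l2_vec (W T) = 0"
proof -
  let ?I = "{0..T}"
  define m where "m t = (l2_vec (W t))\<^sup>2" for t
  note W2 = schwartz_L2fun[OF W]
  have m0: "m 0 = 0"
  proof -
    have "((\<lambda>s. pairing (G s) (W 0)) has_integral pairing (W 0) (W 0)) {0..0}"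
      using T by (intro eq W) auto
    then show ?thesis
      by (simp add: m_def l2_vec_square has_integral_refl has_integral_unique)
  qed
  have cont_m: "continuous_on ?I m"
    unfolding m_def by (intro continuous_intros continuous_on_l2_vec W2 contW)
  have "compact ((\<lambda>t. l2_vec (G t)) ` ?I)"
    by (intro compact_continuous_image continuous_on_l2_vec G contG) auto
  from compact_imp_bounded[OF this] have "\<exists>K. \<forall>t\<in>?I. l2_vec (G t) \<le> K"
    by (simp add: bounded_iff)
  then obtain K where K: "\<And>t. t \<in> ?I \<Longrightarrow> l2_vec (G t) \<le> K"
    by blast
  have J: "((\<lambda>r. pairing (W r) \<phi>) has_real_derivative pairing (G t) \<phi>) (at t within ?I)"
    if \<phi>: "\<And>k. \<phi> k \<in> schwartz" and t: "t \<in> ?I" for \<phi> t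
  proof -
    have "continuous_on ?I (\<lambda>s. pairing (G s) \<phi>)"
      by (intro continuous_on_pairing G contG schwartz_L2fun \<phi>)
    from integral_has_real_derivative[OF this t] show ?thesis
    proof (rule has_field_derivative_transform_within[OF _ zero_less_one t])
      fix r assume "r \<in> ?I"
      from integral_unique[OF eq[OF \<phi> this]] show "integral {0..r} (\<lambda>s. pairing (G s) \<phi>) = pairing (W r) \<phi>" .
    qed
  qed
  \<comment> \<open>Testing with \<open>W r - W t\<close> itself gives \<open>\<parallel>W r - W t\<parallel>\<^sup>2 \<le> K \<parallel>W r - W t\<parallel> \<bar>r - t\<bar>\<close>.\<close>
  have lip: "(l2_vec (\<lambda>k x. W r k x - W t k x))\<^sup>2 \<le> K * l2_vec (\<lambda>k x. W r k x - W t k x) * \<bar>r - t\<bar>"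
    if r: "r \<in> ?I" and t: "t \<in> ?I" for r t
  proof -
    let ?\<phi> = "\<lambda>k x. W r k x - W t k x"
    have \<phi>: "?\<phi> k \<in> schwartz" for k by (intro schwartz_diff W r t)
    have "norm (pairing (W r) ?\<phi> - pairing (W t) ?\<phi>) \<le> K * l2_vec ?\<phi> * norm (r - t)"
    proof (rule field_differentiable_bound[of ?I])
      show "((\<lambda>r. pairing (W r) ?\<phi>) has_field_derivative pairing (G s) ?\<phi>) (at s within ?I)" if "s \<in> ?I" for s
        using \<phi> that by (rule J)
      show "norm (pairing (G s) ?\<phi>) \<le> K * l2_vec ?\<phi>" if "s \<in> ?I" for s
        using pairing_cauchy_schwarz[of "G s" ?\<phi>, OF G[OF that] schwartz_L2fun[OF \<phi>]]
          mult_right_mono[OF K[OF that] l2_vec_nonneg[of ?\<phi>]] by simp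
    qed (use r t in auto)
    moreover have "pairing (W r) ?\<phi> - pairing (W t) ?\<phi> = (l2_vec ?\<phi>)\<^sup>2"
      unfolding l2_vec_square
      by (rule pairing_diff_left[of "W r" "W t" ?\<phi>, OF W2[OF r] W2[OF t] schwartz_L2fun[OF \<phi>], symmetric])
    ultimately show ?thesis by simp
  qed
  have der_m: "(m has_real_derivative 2 * pairing (G t) (W t)) (at t within ?I)" if t: "t \<in> ?I" for t
  proof -
    \<comment> \<open>\<open>m r = m t + 2 \<langle>W r - W t, W t\<rangle> + q r\<close>: the middle term is differentiated by the weak equation with
      the fixed test field \<open>W t\<close>, and \<open>q\<close> has derivative zero because \<open>W\<close> is Lipschitz in \<open>L\<^sup>2\<close>.\<close>
    define q where "q r = (l2_vec (\<lambda>k x. W r k x - W t k x))\<^sup>2" for r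
    have q: "m r = q r + 2 * pairing (W r) (W t) - m t" if r: "r \<in> ?I" for r
    proof -
      have "q r = pairing (W r) (\<lambda>k x. W r k x - W t k x) - pairing (W t) (\<lambda>k x. W r k x - W t k x)"
        unfolding q_def l2_vec_square
        by (intro pairing_diff_left W2 r t L2fun_diff)
      also have "\<dots> = m r - pairing (W r) (W t) - (pairing (W t) (W r) - m t)"
        unfolding m_def l2_vec_square
        by (simp add: pairing_diff_right[OF W2[OF r] W2[OF t] W2[OF r]] pairing_diff_right[OF W2[OF r] W2[OF t] W2[OF t]])
      finally show ?thesis
        by (simp add: pairing_commute[of "W t" "W r"])
    qed
    have "(q has_real_derivative 0) (at t within ?I)"
      unfolding has_field_derivative_iff
    proof (rule Lim_null_comparison)
      have qt: "q t = 0"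
        by (simp add: q_def l2_vec_def l2_def L2_set_def)
      have "norm ((q r - q t) / (r - t)) \<le> K * l2_vec (\<lambda>k x. W r k x - W t k x)" if "r \<in> ?I" "r \<noteq> t" for r
        using lip[OF that(1) t] that(2) unfolding qt by (simp add: q_def pos_divide_le_eq)
      then show "\<forall>\<^sub>F r in at t within ?I. norm ((q r - q t) / (r - t)) \<le> K * l2_vec (\<lambda>k x. W r k x - W t k x)"
        by (auto simp: eventually_at_filter)
      show "((\<lambda>r. K * l2_vec (\<lambda>k x. W r k x - W t k x)) \<longlongrightarrow> 0) (at t within ?I)"
        by (intro tendsto_mult_right_zero l2_vec_diff_tendsto_0 contW t)
    qed
    then have "((\<lambda>r. q r + 2 * pairing (W r) (W t) - m t) has_real_derivative 2 * pairing (G t) (W t)) (at t within ?I)"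
      using W[OF t] t by (auto intro!: derivative_eq_intros J)
    then show ?thesis
      by (rule has_field_derivative_transform_within[OF _ zero_less_one t]) (simp add: q)
  qed
  have "m T = 0"
  proof (cases "T = 0")
    case False
    define f where "f t = exp (- 2 * C * t) * m t" for t
    have "f T \<le> f 0"
    proof (rule DERIV_nonpos_imp_decreasing_open[of 0 T f])
      show "0 \<le> T" by (rule T)
      show "continuous_on ?I f"
        unfolding f_def by (intro continuous_intros cont_m)
      fix t assume t: "0 < t" "t < T"
      then have "(m has_real_derivative 2 * pairing (G t) (W t)) (at t)"
        using der_m[of t] by (simp add: at_within_Icc_at)
      then have "(f has_real_derivative exp (- 2 * C * t) * (2 * pairing (G t) (W t) - 2 * C * m t)) (at t)"
        unfolding f_def by (auto intro!: derivative_eq_intros simp: algebra_simps)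
      moreover have "exp (- 2 * C * t) * (2 * pairing (G t) (W t) - 2 * C * m t) \<le> 0"
        using energy[of t] t by (intro mult_nonneg_nonpos) (simp_all add: m_def)
      ultimately show "\<exists>y. (f has_real_derivative y) (at t) \<and> y \<le> 0"
        by blast
    qed
    then have "m T \<le> 0"
      by (simp add: f_def m0 mult_le_0_iff not_le[symmetric])
    then show ?thesis by (simp add: m_def)
  qed (use m0 in simp)
  then show ?thesis by (simp add: m_def)
qed

section \<open>The Burgers nonlinearity on Schwartz fields\<close>

definition burgers_fun :: "('n::finite \<Rightarrow> real^'n \<Rightarrow> real) \<Rightarrow> 'n \<Rightarrow> real^'n \<Rightarrow> real" where
  "burgers_fun f k x = 1 / 2 * (\<Sum>j\<in>UNIV. partial_deriv j (partial_deriv j (f k)) x)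
     + (\<Sum>j\<in>UNIV. f j x * partial_deriv j (f k) x)"

lemma burgers_rhs_schwartz:
  assumes f: "\<And>k. f k \<in> schwartz" "\<And>k. u $ k = mfun_of (f k)"
  shows "burgers_rhs u $ k = mfun_of (burgers_fun f k)"
proof -
  have b: "f j \<in> borel_measurable borel" "partial_deriv j (f k) \<in> borel_measurable borel"
    "partial_deriv j (partial_deriv j (f k)) \<in> borel_measurable borel" for j
    by (intro schwartz_borel schwartz_partial_deriv f)+
  have lap: "laplacian u $ k = mfun_of (\<lambda>x. \<Sum>j\<in>UNIV. partial_deriv j (partial_deriv j (f k)) x)"
    by (simp add: laplacian_def f dist_partial_schwartz schwartz_partial_deriv mfun_of_sum b)
  have adv: "advection u u $ k = mfun_of (\<lambda>x. \<Sum>j\<in>UNIV. f j x * partial_deriv j (f k) x)"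
    by (simp add: advection_def f dist_partial_schwartz mfun_of_mult mfun_of_sum b borel_measurable_times)
  have m1: "(\<lambda>x. \<Sum>j\<in>UNIV. partial_deriv j (partial_deriv j (f k)) x) \<in> borel_measurable borel"
    and m2: "(\<lambda>x. \<Sum>j\<in>UNIV. f j x * partial_deriv j (f k) x) \<in> borel_measurable borel"
    by (intro borel_measurable_sum borel_measurable_times b)+
  show ?thesis
    unfolding burgers_rhs_def vector_add_component vector_scaleR_component lap adv
      mfun_of_scaleR[OF m1] mfun_of_add[OF borel_measurable_times[OF borel_measurable_const m1] m2]
      burgers_fun_def[abs_def] ..
qed

lemma schwartz_bounded:
  assumes "f \<in> schwartz"
  shows "\<exists>M\<ge>0. \<forall>x. \<bar>f x\<bar> \<le> M"
proof -
  obtain C where C: "C \<ge> 0" "\<And>x. \<bar>f x\<bar> \<le> C * decay_weight x"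
    using schwartz_decay[OF assms] by blast
  have "\<bar>f x\<bar> \<le> C" for x
    using C(2)[of x] mult_left_mono[OF decay_weight_le_1 C(1), of x] by simp
  with C(1) show ?thesis by blast
qed

lemma schwartz_mult_L2fun:
  assumes "f \<in> schwartz" "g \<in> schwartz"
  shows "(\<lambda>x. f x * g x) \<in> L2fun"
proof -
  obtain M where "\<And>x. \<bar>f x\<bar> \<le> M"
    using schwartz_bounded[OF assms(1)] by blast
  then show ?thesis
    by (rule L2fun_bounded_mult[OF schwartz_L2fun[OF assms(2)] schwartz_borel[OF assms(1)]])
qed

lemma burgers_fun_L2fun:
  assumes "\<And>k. f k \<in> schwartz"
  shows "burgers_fun f k \<in> L2fun"
  unfolding burgers_fun_def[abs_def]
  by (intro L2fun_add L2fun_cmult L2fun_sum schwartz_mult_L2fun schwartz_L2fun schwartz_partial_deriv assms)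

lemma young_product: "\<bar>a * b\<bar> \<le> (a\<^sup>2 + b\<^sup>2) / (2::real)"
  using zero_le_power2[of "\<bar>a\<bar> - \<bar>b\<bar>"] by (simp add: power2_diff abs_mult)

lemma burgers_fun_diff:
  fixes f g :: "'n::finite \<Rightarrow> real^'n \<Rightarrow> real"
  assumes "\<And>k. f k \<in> schwartz" "\<And>k. g k \<in> schwartz"
  defines "w \<equiv> \<lambda>k x. f k x - g k x"
  shows "burgers_fun f k x - burgers_fun g k x = (\<Sum>j\<in>UNIV. 1 / 2 * partial_deriv j (partial_deriv j (w k)) x
    + partial_deriv j (f k) x * w j x + g j x * partial_deriv j (w k) x)"
  unfolding burgers_fun_def sum_distrib_left sum.distrib[symmetric] sum_subtractf[symmetric]
proof (intro sum.cong refl)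
  fix j
  have Dw: "partial_deriv j (w k) = (\<lambda>x. partial_deriv j (f k) x - partial_deriv j (g k) x)"
    unfolding w_def by (rule partial_deriv_diff_schwartz[OF assms(1,2)])
  have DDw: "partial_deriv j (partial_deriv j (w k)) x
      = partial_deriv j (partial_deriv j (f k)) x - partial_deriv j (partial_deriv j (g k)) x"
    unfolding Dw partial_deriv_diff_schwartz[OF schwartz_partial_deriv[OF assms(1)] schwartz_partial_deriv[OF assms(2)]] ..
  have w: "w j x = f j x - g j x"
    by (simp add: w_def)
  show "1 / 2 * partial_deriv j (partial_deriv j (f k)) x + f j x * partial_deriv j (f k) x
      - (1 / 2 * partial_deriv j (partial_deriv j (g k)) x + g j x * partial_deriv j (g k) x)
    = 1 / 2 * partial_deriv j (partial_deriv j (w k)) x + partial_deriv j (f k) x * w j x + g j x * partial_deriv j (w k) x"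
    unfolding w DDw fun_cong[OF Dw, of x] by (simp add: algebra_simps)
qed

text \<open>The nonlinear terms of the difference are \<open>w \<cdot> \<nabla>f + g \<cdot> \<nabla>w\<close>. Every coordinate direction of the
Laplacian contributes \<open>- 1/2 \<parallel>\<partial>\<^sub>j w k\<parallel>\<^sup>2\<close> after integration by parts, exactly what Young's inequality
needs to absorb \<open>\<langle>w k, g j \<partial>\<^sub>j w k\<rangle>\<close>.\<close>

lemma burgers_energy_estimate:
  fixes f g :: "'n::finite \<Rightarrow> real^'n \<Rightarrow> real"
  assumes f: "\<And>k. f k \<in> schwartz" and g: "\<And>k. g k \<in> schwartz"
    and Mf: "\<And>j k x. \<bar>partial_deriv j (f k) x\<bar> \<le> M" and Mg: "\<And>j x. \<bar>g j x\<bar> \<le> M"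
  defines "w \<equiv> \<lambda>k x. f k x - g k x"
  shows "pairing (\<lambda>k x. burgers_fun f k x - burgers_fun g k x) w
    \<le> real CARD('n) * (M + M\<^sup>2 / 2) * (l2_vec w)\<^sup>2"
proof -
  have w: "w k \<in> schwartz" for k
    unfolding w_def by (intro schwartz_diff f g)
  have w2: "w k \<in> L2fun" for k by (intro schwartz_L2fun w)
  let ?D = "\<lambda>j. partial_deriv j"
  let ?a = "\<lambda>k j. (l2 (w k))\<^sup>2 + (l2 (w j))\<^sup>2"
  have Df: "(\<lambda>x. ?D j (f k) x * w i x) \<in> L2fun" for i j k
    by (intro schwartz_mult_L2fun w schwartz_partial_deriv f)
  have gD: "(\<lambda>x. g j x * ?D j (w k) x) \<in> L2fun" for j k
    by (intro schwartz_mult_L2fun w schwartz_partial_deriv g)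
  have DD: "?D j (?D j (w k)) \<in> L2fun" for j k
    by (intro schwartz_L2fun schwartz_partial_deriv w)
  have split: "burgers_fun f k x - burgers_fun g k x
      = (\<Sum>j\<in>UNIV. 1 / 2 * ?D j (?D j (w k)) x + ?D j (f k) x * w j x + g j x * ?D j (w k) x)" for k x
    unfolding w_def by (rule burgers_fun_diff[OF f g])
  have summand_le: "(\<integral>x. (1 / 2 * ?D j (?D j (w k)) x + ?D j (f k) x * w j x + g j x * ?D j (w k) x) * w k x \<partial>lborel)
      \<le> M / 2 * ?a k j + M\<^sup>2 / 2 * (l2 (w k))\<^sup>2" for j k
  proof -
    have M: "M \<ge> 0" using Mg[of undefined undefined] by linarith
    have i1: "(\<integral>x. ?D j (?D j (w k)) x * w k x \<partial>lborel) = - (l2 (?D j (w k)))\<^sup>2"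
      using schwartz_integration_by_parts[OF schwartz_partial_deriv[OF w[of k], of j] w[of k], of j]
      unfolding l2_square by (simp only: power2_eq_square)
    have i2: "(\<integral>x. (?D j (f k) x * w j x) * w k x \<partial>lborel) \<le> M / 2 * ?a k j"
    proof -
      have "(\<integral>x. (?D j (f k) x * w j x) * w k x \<partial>lborel) \<le> l2 (\<lambda>x. ?D j (f k) x * w j x) * l2 (w k)"
        using L2_cauchy_schwarz[OF Df w2] by (simp add: abs_le_iff)
      also have "\<dots> \<le> (M * l2 (w j)) * l2 (w k)"
        by (intro mult_right_mono l2_bounded_mult_le w2 schwartz_borel schwartz_partial_deriv f Mf) simp
      also have "\<dots> = M * (l2 (w j) * l2 (w k))" by simp
      also have "\<dots> \<le> M * (?a k j / 2)"
        using young_product[of "l2 (w j)" "l2 (w k)"] M by (intro mult_left_mono) (auto simp: abs_le_iff add.commute)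
      finally show ?thesis by simp
    qed
    have i3: "(\<integral>x. (g j x * ?D j (w k) x) * w k x \<partial>lborel) \<le> 1 / 2 * (l2 (?D j (w k)))\<^sup>2 + M\<^sup>2 / 2 * (l2 (w k))\<^sup>2"
    proof -
      have "(\<integral>x. (g j x * ?D j (w k) x) * w k x \<partial>lborel) \<le> l2 (\<lambda>x. g j x * ?D j (w k) x) * l2 (w k)"
        using L2_cauchy_schwarz[OF gD w2] by (simp add: abs_le_iff)
      also have "\<dots> \<le> (M * l2 (?D j (w k))) * l2 (w k)"
        by (intro mult_right_mono l2_bounded_mult_le schwartz_L2fun schwartz_partial_deriv w schwartz_borel g Mg) simp
      also have "\<dots> = l2 (?D j (w k)) * (M * l2 (w k))" by simp
      also have "\<dots> \<le> ((l2 (?D j (w k)))\<^sup>2 + (M * l2 (w k))\<^sup>2) / 2"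
        using young_product[of "l2 (?D j (w k))" "M * l2 (w k)"] by (simp add: abs_le_iff)
      finally show ?thesis by (simp add: power_mult_distrib add_divide_distrib)
    qed
    have "(\<integral>x. (1 / 2 * ?D j (?D j (w k)) x + ?D j (f k) x * w j x + g j x * ?D j (w k) x) * w k x \<partial>lborel)
      = (\<integral>x. 1 / 2 * (?D j (?D j (w k)) x * w k x) + (?D j (f k) x * w j x) * w k x + (g j x * ?D j (w k) x) * w k x \<partial>lborel)"
      by (simp add: algebra_simps)
    also have "\<dots> = 1 / 2 * (\<integral>x. ?D j (?D j (w k)) x * w k x \<partial>lborel) + (\<integral>x. (?D j (f k) x * w j x) * w k x \<partial>lborel)
        + (\<integral>x. (g j x * ?D j (w k) x) * w k x \<partial>lborel)"
      using L2fun_mult_integrable[OF DD w2, of j k k] L2fun_mult_integrable[OF Df w2, of j k j k] L2fun_mult_integrable[OF gD w2, of j k k]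
      by simp
    finally show ?thesis
      using i1 i2 i3 by simp
  qed
  have "pairing (\<lambda>k x. burgers_fun f k x - burgers_fun g k x) w
      = (\<Sum>k\<in>UNIV. \<Sum>j\<in>UNIV. \<integral>x. (1 / 2 * ?D j (?D j (w k)) x + ?D j (f k) x * w j x + g j x * ?D j (w k) x) * w k x \<partial>lborel)"
    unfolding pairing_def split sum_distrib_right
    by (intro sum.cong refl Bochner_Integration.integral_sum L2fun_mult_integrable L2fun_add L2fun_cmult DD Df gD w2)
  also have "\<dots> \<le> (\<Sum>k\<in>UNIV. \<Sum>j\<in>UNIV. M / 2 * ?a k j + M\<^sup>2 / 2 * (l2 (w k))\<^sup>2)"
    by (intro sum_mono summand_le)
  also have "\<dots> = real CARD('n) * (M + M\<^sup>2 / 2) * (\<Sum>k\<in>UNIV. (l2 (w k))\<^sup>2)"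
  proof -
    let ?S = "\<Sum>k\<in>UNIV. (l2 (w k))\<^sup>2"
    have "(\<Sum>k\<in>UNIV. \<Sum>j\<in>(UNIV::'n set). (l2 (w k))\<^sup>2) = real CARD('n) * ?S" "(\<Sum>k\<in>(UNIV::'n set). ?S) = real CARD('n) * ?S"
      by (simp_all add: sum_distrib_left)
    then show ?thesis
      unfolding sum.distrib distrib_left sum_distrib_left[symmetric] by (simp add: algebra_simps)
  qed
  also have "(\<Sum>k\<in>UNIV. (l2 (w k))\<^sup>2) = (l2_vec w)\<^sup>2"
    by (simp add: l2_vec_def L2_set_def sum_nonneg)
  finally show ?thesis .
qed

lemma l2_partials_le_schwartz_norm:
  fixes f :: "real^'n::finite \<Rightarrow> real"
  assumes "f \<in> schwartz" "length js \<le> 2 * p"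
  shows "l2 (partials js f) \<le> schwartz_norm p f"
proof -
  have "sum (count_list js) UNIV = length js"
    by (rule sum_count_set) auto
  then have "(\<lambda>_. 0, count_list js) \<in> multi_index_pairs (2 * p)"
    using assms(2) by (simp add: multi_index_pairs_def)
  from l2_weighted_deriv_le[OF this, of f] show ?thesis
    by (simp add: weighted_deriv_def[abs_def] partials_eq_multi_deriv[OF schwartz_smooth[OF assms(1)], of js])
qed

text \<open>The order \<open>Suc CARD('n)\<close> is one above that of the Sobolev inequality, to include first derivatives.\<close>

lemma schwartz_C1_bound:
  "\<exists>C\<ge>0. \<forall>h\<in>schwartz. \<forall>x::real^'n::finite. \<bar>h x\<bar> \<le> C * schwartz_norm (Suc CARD('n)) h \<and>
     (\<forall>j. \<bar>partial_deriv j h x\<bar> \<le> C * schwartz_norm (Suc CARD('n)) h)"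
proof -
  let ?d = "CARD('n)"
  obtain C where C: "C \<ge> 0" "\<And>h x. h \<in> schwartz \<Longrightarrow> \<bar>h (x::real^'n)\<bar> \<le> C * schwartz_norm ?d h"
    using schwartz_sup_le_norm by blast
  have "\<exists>A. A \<ge> 0 \<and> (\<forall>h\<in>schwartz. schwartz_norm ?d (partial_deriv j h) \<le> A * schwartz_norm (Suc ?d) h)" for j :: 'n
    using schwartz_norm_partial_deriv_le by blast
  then obtain A where A: "\<And>j::'n. A j \<ge> 0"
    "\<And>j h. h \<in> schwartz \<Longrightarrow> schwartz_norm ?d (partial_deriv j h) \<le> A j * schwartz_norm (Suc ?d) h"
    by metis
  define B where "B = C * (1 + (\<Sum>j\<in>UNIV. A j))"
  have sum_nn: "0 \<le> (\<Sum>j\<in>UNIV. A j)" and A_le: "A j \<le> (\<Sum>j\<in>UNIV. A j)" for j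
    using A(1) by (auto intro: sum_nonneg member_le_sum)
  have B: "C \<le> B" "C * A j \<le> B" for j
    unfolding B_def using C(1) sum_nn A_le[of j] mult_left_mono[of 1 "1 + (\<Sum>j\<in>UNIV. A j)" C]
    by (auto intro!: mult_left_mono)
  have "\<bar>h x\<bar> \<le> B * schwartz_norm (Suc ?d) h" "\<bar>partial_deriv j h x\<bar> \<le> B * schwartz_norm (Suc ?d) h"
    if h: "h \<in> schwartz" for h :: "real^'n \<Rightarrow> real" and x j
  proof -
    have "\<bar>h x\<bar> \<le> C * schwartz_norm ?d h"
      by (rule C(2)[OF h])
    also have "\<dots> \<le> B * schwartz_norm (Suc ?d) h"
      using B(1) C(1) by (intro mult_mono schwartz_norm_mono) auto
    finally show "\<bar>h x\<bar> \<le> B * schwartz_norm (Suc ?d) h" .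
    have "\<bar>partial_deriv j h x\<bar> \<le> C * schwartz_norm ?d (partial_deriv j h)"
      by (rule C(2)[OF schwartz_partial_deriv[OF h]])
    also have "\<dots> \<le> C * (A j * schwartz_norm (Suc ?d) h)"
      by (intro mult_left_mono A(2) h C(1))
    also have "\<dots> \<le> B * schwartz_norm (Suc ?d) h"
      unfolding mult.assoc[symmetric] by (intro mult_right_mono B(2)) simp
    finally show "\<bar>partial_deriv j h x\<bar> \<le> B * schwartz_norm (Suc ?d) h" .
  qed
  moreover have "B \<ge> 0" using C(1) B(1) by linarith
  ultimately show ?thesis by blast
qed

text \<open>The right-hand side tends to zero when \<open>f\<close> tends to \<open>g\<close> in the norm of order \<open>p\<close>: in each product one
factor is bounded in supremum norm and the other in \<open>L\<^sup>2\<close>.\<close>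

lemma l2_burgers_fun_diff_le:
  fixes f g :: "'n::finite \<Rightarrow> real^'n \<Rightarrow> real"
  assumes f: "\<And>k. f k \<in> schwartz" and g: "\<And>k. g k \<in> schwartz"
    and C: "\<And>h x. h \<in> schwartz \<Longrightarrow> \<bar>h (x::real^'n)\<bar> \<le> C * schwartz_norm p h" and p: "p \<ge> 1"
  shows "l2 (\<lambda>x. burgers_fun f k x - burgers_fun g k x) \<le> (\<Sum>j\<in>UNIV.
      schwartz_norm p (\<lambda>x. f k x - g k x)
      + C * schwartz_norm p (\<lambda>x. f j x - g j x) * (schwartz_norm p (g k) + schwartz_norm p (\<lambda>x. f k x - g k x))
      + C * schwartz_norm p (g j) * schwartz_norm p (\<lambda>x. f k x - g k x))"
proof -
  let ?D = "\<lambda>j. partial_deriv j" and ?N = "schwartz_norm p"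
  let ?w = "\<lambda>k x. f k x - g k x"
  have w: "?w k \<in> schwartz" for k
    by (intro schwartz_diff f g)
  let ?t = "\<lambda>j x. 1 / 2 * ?D j (?D j (?w k)) x + ?D j (f k) x * ?w j x + g j x * ?D j (?w k) x"
  have L1: "(\<lambda>x. 1 / 2 * ?D j (?D j (?w k)) x) \<in> L2fun" for j
    by (intro L2fun_cmult schwartz_L2fun schwartz_partial_deriv w)
  have L2: "(\<lambda>x. ?D j (f k) x * ?w j x) \<in> L2fun" for j
    by (intro schwartz_mult_L2fun schwartz_partial_deriv w f)
  have L3: "(\<lambda>x. g j x * ?D j (?w k) x) \<in> L2fun" for j
    by (intro schwartz_mult_L2fun schwartz_partial_deriv w g)
  have D_le: "l2 (?D j h) \<le> ?N h" if "h \<in> schwartz" for j and h :: "real^'n \<Rightarrow> real"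
    using l2_partials_le_schwartz_norm[OF that, of "[j]" p] p by simp
  have "l2 (?t j) \<le> ?N (?w k) + C * ?N (?w j) * (?N (g k) + ?N (?w k)) + C * ?N (g j) * ?N (?w k)" for j
  proof -
    have CN: "0 \<le> C * ?N h" if "h \<in> schwartz" for h :: "real^'n \<Rightarrow> real"
      using C[OF that, of 0] by linarith
    have "l2 (\<lambda>x. 1 / 2 * ?D j (?D j (?w k)) x) \<le> ?N (?w k)"
    proof -
      have "l2 (\<lambda>x. 1 / 2 * ?D j (?D j (?w k)) x) = 1 / 2 * l2 (?D j (?D j (?w k)))"
        using l2_cmult[of "1 / 2" "?D j (?D j (?w k))"] by simp
      also have "\<dots> \<le> 1 * ?N (?w k)"
        using l2_partials_le_schwartz_norm[OF w, of "[j, j]" p k] p by (intro mult_mono) auto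
      finally show ?thesis by simp
    qed
    moreover have "l2 (\<lambda>x. ?D j (f k) x * ?w j x) \<le> C * ?N (?w j) * (?N (g k) + ?N (?w k))"
    proof -
      have "l2 (\<lambda>x. ?D j (f k) x * ?w j x) \<le> C * ?N (?w j) * l2 (?D j (f k))"
        unfolding mult.commute[of "partial_deriv j (f k) x" for x]
        by (intro l2_bounded_mult_le schwartz_L2fun schwartz_partial_deriv f schwartz_borel w C)
      also have "\<dots> \<le> C * ?N (?w j) * (?N (g k) + ?N (?w k))"
        by (intro mult_left_mono CN w order_trans[OF D_le[OF f] schwartz_norm_le_add_diff] f g)
      finally show ?thesis .
    qed
    moreover have "l2 (\<lambda>x. g j x * ?D j (?w k) x) \<le> C * ?N (g j) * ?N (?w k)"
    proof -
      have "l2 (\<lambda>x. g j x * ?D j (?w k) x) \<le> C * ?N (g j) * l2 (?D j (?w k))"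
        by (intro l2_bounded_mult_le schwartz_L2fun schwartz_partial_deriv w schwartz_borel g C)
      also have "\<dots> \<le> C * ?N (g j) * ?N (?w k)"
        by (intro mult_left_mono CN g D_le w)
      finally show ?thesis .
    qed
    ultimately show ?thesis
      using l2_add_le[OF L2fun_add[OF L1 L2] L3, of j j j] l2_add_le[OF L1 L2, of j j] by linarith
  qed
  moreover have "l2 (\<lambda>x. \<Sum>j\<in>UNIV. ?t j x) \<le> (\<Sum>j\<in>UNIV. l2 (?t j))"
    by (intro l2_sum_le L2fun_add L1 L2 L3)
  ultimately show ?thesis
    unfolding burgers_fun_diff[OF f g] by (meson order_trans sum_mono)
qed

lemma burgers_fun_tendsto_l2:
  fixes U :: "'a::topological_space \<Rightarrow> 'n::finite \<Rightarrow> real^'n \<Rightarrow> real"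
  assumes U: "\<And>s k. s \<in> I \<Longrightarrow> U s k \<in> schwartz" and t: "t \<in> I"
    and lim: "\<And>p k. ((\<lambda>s. schwartz_norm p (\<lambda>x. U s k x - U t k x)) \<longlongrightarrow> 0) (at t within I)"
  shows "((\<lambda>s. l2 (\<lambda>x. burgers_fun (U s) k x - burgers_fun (U t) k x)) \<longlongrightarrow> 0) (at t within I)"
proof -
  obtain C where C: "\<And>h x. h \<in> schwartz \<Longrightarrow> \<bar>h (x::real^'n)\<bar> \<le> C * schwartz_norm CARD('n) h"
    using schwartz_sup_le_norm by blast
  let ?N = "schwartz_norm CARD('n)"
  let ?w = "\<lambda>s k x. U s k x - U t k x"
  let ?b = "\<lambda>s. \<Sum>j\<in>UNIV. ?N (?w s k) + C * ?N (?w s j) * (?N (U t k) + ?N (?w s k)) + C * ?N (U t j) * ?N (?w s k)"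
  show ?thesis
  proof (rule tendsto_0_withinI)
    show "norm (l2 (\<lambda>x. burgers_fun (U s) k x - burgers_fun (U t) k x)) \<le> ?b s" if "s \<in> I" for s
      using l2_burgers_fun_diff_le[of "U s" "U t", OF U[OF that] U[OF t] C, of k] by simp
    have "(?b \<longlongrightarrow> (\<Sum>j\<in>(UNIV::'n set). 0 + C * 0 * (?N (U t k) + 0) + C * ?N (U t j) * 0)) (at t within I)"
      by (intro tendsto_intros lim)
    then show "(?b \<longlongrightarrow> 0) (at t within I)"
      by simp
  qed
qed

section \<open>Uniqueness of local solutions\<close>

text \<open>The shift makes the order admissible whatever \<open>p\<close> is; as the norms increase with the order, this
gives access to every order.\<close>

lemma schwartz_local_solution_order:
  fixes u0 :: "'n::finite mfun ^ 'n"
  assumes "schwartz_local_solution u0 u \<tau>"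
  shows "hs_local_solution (p + CARD('n) + 2) u0 u \<tau>"
proof -
  have "admissible_order TYPE('n) (p + CARD('n) + 2)"
    by (simp add: admissible_order_def)
  with assms show ?thesis
    unfolding schwartz_local_solution_def by blast
qed

lemma hermite_sobolev_antimono:
  assumes "u \<in> hermite_sobolev q" "p \<le> q"
  shows "u \<in> hermite_sobolev p"
proof -
  obtain f where f: "f \<in> borel_measurable borel" "u = mfun_of f" by (rule mfun_cases)
  obtain \<phi> where "hs_approximates q \<phi> u"
    using assms(1) by (auto simp: hermite_sobolev_def)
  then have "hs_approximates p \<phi> u"
    unfolding f(2) hs_approximates_mfun_of[OF f(1)] using schwartz_Cauchy_mono assms(2) by blast
  then show ?thesis
    by (auto simp: hermite_sobolev_def)
qed

lemma schwartz_local_solution_representation: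
  fixes u0 :: "'n::finite mfun ^ 'n"
  assumes sol: "schwartz_local_solution u0 u \<tau>"
  obtains U where "\<And>t k. t \<in> {0..<\<tau>} \<Longrightarrow> U t k \<in> schwartz"
    and "\<And>t k. t \<in> {0..<\<tau>} \<Longrightarrow> u t $ k = mfun_of (U t k)"
    and "\<And>p t k. t \<in> {0..<\<tau>} \<Longrightarrow>
      ((\<lambda>s. schwartz_norm p (\<lambda>x. U s k x - U t k x)) \<longlongrightarrow> 0) (at t within {0..<\<tau>})"
proof -
  let ?q = "\<lambda>p. p + CARD('n) + 2"
  have mem: "u t \<in> hermite_sobolev_vec (?q p)" if "t \<in> {0..<\<tau>}" for t p
    using schwartz_local_solution_order[OF sol, of p] that by (auto simp: hs_local_solution_def)
  have "u t $ k \<in> mfun_of ` schwartz" if "t \<in> {0..<\<tau>}" for t k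
  proof (rule hermite_sobolev_Inter)
    show "u t $ k \<in> hermite_sobolev p" for p
      using mem[OF that, of p] by (intro hermite_sobolev_antimono[of _ "?q p" p]) (auto simp: hermite_sobolev_vec_def)
  qed
  then have "\<forall>t k. \<exists>f. t \<in> {0..<\<tau>} \<longrightarrow> f \<in> schwartz \<and> u t $ k = mfun_of f"
    by blast
  then obtain U where U: "\<And>t k. t \<in> {0..<\<tau>} \<Longrightarrow> U t k \<in> schwartz" "\<And>t k. t \<in> {0..<\<tau>} \<Longrightarrow> u t $ k = mfun_of (U t k)"
    by metis
  have "((\<lambda>s. schwartz_norm p (\<lambda>x. U s k x - U t k x)) \<longlongrightarrow> 0) (at t within {0..<\<tau>})" if t: "t \<in> {0..<\<tau>}" for p t k
  proof (rule Lim_null_comparison)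
    show "((\<lambda>s. hs_norm_vec (?q p) (u s - u t)) \<longlongrightarrow> 0) (at t within {0..<\<tau>})"
      using schwartz_local_solution_order[OF sol, of p] t by (auto simp: hs_local_solution_def)
    have "norm (schwartz_norm p (\<lambda>x. U s k x - U t k x)) \<le> hs_norm_vec (?q p) (u s - u t)" if s: "s \<in> {0..<\<tau>}" for s
    proof -
      have "schwartz_norm p (\<lambda>x. U s k x - U t k x) \<le> schwartz_norm (?q p) (\<lambda>x. U s k x - U t k x)"
        by (rule schwartz_norm_mono) simp
      also have "\<dots> \<le> hs_norm_vec (?q p) (u s - u t)"
      proof (rule hs_norm_vec_bounds(2))
        show "u s - u t \<in> hermite_sobolev_vec (?q p)"
          by (intro subspace_diff subspace_hermite_sobolev_vec mem s t)
        show "(u s - u t) $ k = mfun_of (\<lambda>x. U s k x - U t k x)"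
          by (simp add: U(2)[OF s] U(2)[OF t] mfun_of_diff schwartz_borel[OF U(1)[OF s]] schwartz_borel[OF U(1)[OF t]])
      qed (intro schwartz_diff U s t)
      finally show ?thesis by simp
    qed
    then show "\<forall>\<^sub>F s in at t within {0..<\<tau>}. norm (schwartz_norm p (\<lambda>x. U s k x - U t k x)) \<le> hs_norm_vec (?q p) (u s - u t)"
      by (auto simp: eventually_at_filter)
  qed
  with U show ?thesis
    by (rule that)
qed

text \<open>Continuity in time makes the tested right-hand side continuous and thus measurable.\<close>

lemma schwartz_local_solution_weak:
  fixes u0 :: "'n::finite mfun ^ 'n"
  assumes sol: "schwartz_local_solution u0 u \<tau>"
    and U: "\<And>t k. t \<in> {0..<\<tau>} \<Longrightarrow> U t k \<in> schwartz" "\<And>t k. t \<in> {0..<\<tau>} \<Longrightarrow> u t $ k = mfun_of (U t k)"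
    and cont: "\<And>p t k. t \<in> {0..<\<tau>} \<Longrightarrow>
      ((\<lambda>s. schwartz_norm p (\<lambda>x. U s k x - U t k x)) \<longlongrightarrow> 0) (at t within {0..<\<tau>})"
    and U0: "\<And>k. U0 k \<in> schwartz" "\<And>k. u0 $ k = mfun_of (U0 k)"
    and \<phi>: "\<And>k. \<phi> k \<in> schwartz" and t: "t \<in> {0..<\<tau>}"
  shows "((\<lambda>s. pairing (burgers_fun (U s)) \<phi>) has_integral pairing (\<lambda>k x. U t k x - U0 k x) \<phi>) {0..t}"
proof -
  let ?q = "0 + CARD('n) + 2"
  have sub: "{0..t} \<subseteq> {0..<\<tau>}" using t by auto
  have "continuous_on {0..<\<tau>} (\<lambda>s. pairing (burgers_fun (U s)) \<phi>)"
    by (intro continuous_on_pairing burgers_fun_tendsto_l2 cont burgers_fun_L2fun U(1) schwartz_L2fun \<phi>)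
  then have "continuous_on {0..t} (\<lambda>s. pairing (burgers_fun (U s)) \<phi>)"
    by (rule continuous_on_subset[OF _ sub])
  then have meas: "(\<lambda>s. pairing (burgers_fun (U s)) \<phi>) \<in> borel_measurable (lebesgue_on {0..t})"
    by (rule continuous_imp_measurable_on_sets_lebesgue) simp
  have "has_bochner_integral (lebesgue_on {0..t}) (\<lambda>s. pairing (burgers_fun (U s)) \<phi>) (pairing (\<lambda>k x. U t k x - U0 k x) \<phi>)"
  proof (rule bochner_integral_in_pairing[OF _ \<phi> _ _ _ _ meas])
    show "has_bochner_integral_in (hermite_sobolev_vec (?q - 1)) (hs_norm_vec (?q - 1)) (lebesgue_on {0..t})
        (\<lambda>s. burgers_rhs (u s)) (u t - u0)"
      using schwartz_local_solution_order[OF sol, of 0] t unfolding hs_local_solution_def by blast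
    show "burgers_rhs (u s) $ k = mfun_of (burgers_fun (U s) k)" "burgers_fun (U s) k \<in> L2fun"
      if "s \<in> space (lebesgue_on {0..t})" for s k
    proof -
      have s: "s \<in> {0..<\<tau>}" using that sub by auto
      show "burgers_rhs (u s) $ k = mfun_of (burgers_fun (U s) k)"
        by (rule burgers_rhs_schwartz[OF U(1)[OF s] U(2)[OF s]])
      show "burgers_fun (U s) k \<in> L2fun"
        by (rule burgers_fun_L2fun[OF U(1)[OF s]])
    qed
    show "(u t - u0) $ k = mfun_of (\<lambda>x. U t k x - U0 k x)" for k
      by (simp add: U(2)[OF t] U0 mfun_of_diff schwartz_borel[OF U(1)[OF t]] schwartz_borel[OF U0(1)])
    show "(\<lambda>x. U t k x - U0 k x) \<in> L2fun" for k
      by (intro schwartz_L2fun schwartz_diff U t U0)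
  qed
  then show ?thesis
    using has_integral_integral_lebesgue_on[of "{0..t}" "\<lambda>s. pairing (burgers_fun (U s)) \<phi>"]
    by (simp add: has_bochner_integral_iff)
qed

text \<open>By continuity in time the norms are bounded on the compact interval, and they control values and
gradients.\<close>

lemma schwartz_path_C1_bound:
  fixes U :: "real \<Rightarrow> 'n::finite \<Rightarrow> real^'n \<Rightarrow> real"
  assumes U: "\<And>t k. t \<in> {0..T} \<Longrightarrow> U t k \<in> schwartz"
    and cont: "\<And>p t k. t \<in> {0..T} \<Longrightarrow>
      ((\<lambda>s. schwartz_norm p (\<lambda>x. U s k x - U t k x)) \<longlongrightarrow> 0) (at t within {0..T})"
  shows "\<exists>M. \<forall>t\<in>{0..T}. \<forall>k x. \<bar>U t k x\<bar> \<le> M \<and> (\<forall>j. \<bar>partial_deriv j (U t k) x\<bar> \<le> M)"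
proof -
  let ?N = "schwartz_norm (Suc CARD('n)) :: (real^'n \<Rightarrow> real) \<Rightarrow> real"
  obtain C where C: "C \<ge> 0" "\<And>h x. h \<in> schwartz \<Longrightarrow> \<bar>h (x::real^'n)\<bar> \<le> C * ?N h"
    "\<And>h x j. h \<in> schwartz \<Longrightarrow> \<bar>partial_deriv j h (x::real^'n)\<bar> \<le> C * ?N h"
    using schwartz_C1_bound by blast
  have "continuous_on {0..T} (\<lambda>t. ?N (U t k))" for k
    unfolding continuous_on_def
  proof
    fix t assume t: "t \<in> {0..T}"
    have "((\<lambda>s. ?N (U s k) - ?N (U t k)) \<longlongrightarrow> 0) (at t within {0..T})"
    proof (rule Lim_null_comparison[OF _ cont[OF t]])
      have "norm (?N (U s k) - ?N (U t k)) \<le> ?N (\<lambda>x. U s k x - U t k x)" if "s \<in> {0..T}" for s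
        using schwartz_norm_reverse_triangle[OF U[OF that] U[OF t]] by simp
      then show "\<forall>\<^sub>F s in at t within {0..T}. norm (?N (U s k) - ?N (U t k)) \<le> ?N (\<lambda>x. U s k x - U t k x)"
        by (auto simp: eventually_at_filter)
    qed
    then show "((\<lambda>s. ?N (U s k)) \<longlongrightarrow> ?N (U t k)) (at t within {0..T})"
      by (simp add: LIM_zero_iff)
  qed
  then have "bounded ((\<lambda>t. ?N (U t k)) ` {0..T})" for k
    by (intro compact_imp_bounded compact_continuous_image) auto
  then have "\<forall>k. \<exists>K. \<forall>t\<in>{0..T}. ?N (U t k) \<le> K"
    by (simp add: bounded_iff)
  then obtain K where K: "\<And>t k. t \<in> {0..T} \<Longrightarrow> ?N (U t k) \<le> K k"
    by metis
  have "C * ?N (U t k) \<le> C * (\<Sum>k\<in>UNIV. \<bar>K k\<bar>)" if "t \<in> {0..T}" for t k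
  proof (rule mult_left_mono[OF _ C(1)])
    have "\<bar>K k\<bar> \<le> (\<Sum>k\<in>UNIV. \<bar>K k\<bar>)"
      by (rule member_le_sum) auto
    with K[OF that, of k] show "?N (U t k) \<le> (\<Sum>k\<in>UNIV. \<bar>K k\<bar>)"
      by linarith
  qed
  then show ?thesis
    using C(2,3)[OF U] by (intro exI[of _ "C * (\<Sum>k\<in>UNIV. \<bar>K k\<bar>)"]) (meson order_trans)
qed

lemma tendsto_l2_diff:
  fixes F H :: "'a::topological_space \<Rightarrow> real^'n::finite \<Rightarrow> real"
  assumes F: "((\<lambda>s. l2 (\<lambda>x. F s x - F' x)) \<longlongrightarrow> 0) (at t within I)"
    and H: "((\<lambda>s. l2 (\<lambda>x. H s x - H' x)) \<longlongrightarrow> 0) (at t within I)"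
    and L2: "\<And>s. s \<in> I \<Longrightarrow> F s \<in> L2fun" "\<And>s. s \<in> I \<Longrightarrow> H s \<in> L2fun" "F' \<in> L2fun" "H' \<in> L2fun"
  shows "((\<lambda>s. l2 (\<lambda>x. (F s x - H s x) - (F' x - H' x))) \<longlongrightarrow> 0) (at t within I)"
proof (rule Lim_null_comparison)
  show "((\<lambda>s. l2 (\<lambda>x. F s x - F' x) + l2 (\<lambda>x. H s x - H' x)) \<longlongrightarrow> 0) (at t within I)"
    using tendsto_add[OF F H] by simp
  have "norm (l2 (\<lambda>x. (F s x - H s x) - (F' x - H' x))) \<le> l2 (\<lambda>x. F s x - F' x) + l2 (\<lambda>x. H s x - H' x)" if "s \<in> I" for s
    using l2_diff_diff_le[OF L2(1)[OF that] L2(3) L2(2)[OF that] L2(4)] by simp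
  then show "\<forall>\<^sub>F s in at t within I. norm (l2 (\<lambda>x. (F s x - H s x) - (F' x - H' x))) \<le> l2 (\<lambda>x. F s x - F' x) + l2 (\<lambda>x. H s x - H' x)"
    by (auto simp: eventually_at_filter)
qed

lemma tendsto_l2_of_schwartz_norm:
  fixes F :: "'a::topological_space \<Rightarrow> real^'n::finite \<Rightarrow> real"
  assumes F: "\<And>s. s \<in> I \<Longrightarrow> F s \<in> schwartz" and t: "t \<in> I"
    and lim: "((\<lambda>s. schwartz_norm 0 (\<lambda>x. F s x - F t x)) \<longlongrightarrow> 0) (at t within I)"
  shows "((\<lambda>s. l2 (\<lambda>x. F s x - F t x)) \<longlongrightarrow> 0) (at t within I)"
proof (rule Lim_null_comparison[OF _ lim])
  have "norm (l2 (\<lambda>x. F s x - F t x)) \<le> schwartz_norm 0 (\<lambda>x. F s x - F t x)" if "s \<in> I" for s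
    using l2_le_schwartz_norm[OF schwartz_diff[OF F[OF that] F[OF t]]] by simp
  then show "\<forall>\<^sub>F s in at t within I. norm (l2 (\<lambda>x. F s x - F t x)) \<le> schwartz_norm 0 (\<lambda>x. F s x - F t x)"
    by (auto simp: eventually_at_filter)
qed

theorem theorem3p11:
  fixes u0 :: "'n::finite mfun ^ 'n"
    and u v :: "real \<Rightarrow> 'n mfun ^ 'n"
    and \<tau>1 \<tau>2 :: real
  assumes "u0 \<in> schwartz_vec"
    and "schwartz_local_solution u0 u \<tau>1"
    and "schwartz_local_solution u0 v \<tau>2"
  shows "\<forall>t. 0 \<le> t \<and> t < min \<tau>1 \<tau>2 \<longrightarrow> u t = v t"
proof (intro allI impI)
  fix T assume T: "0 \<le> T \<and> T < min \<tau>1 \<tau>2"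
  let ?I = "{0..T}"
  have sub: "?I \<subseteq> {0..<\<tau>1}" "?I \<subseteq> {0..<\<tau>2}" using T by auto
  have "\<forall>k. \<exists>f. f \<in> schwartz \<and> u0 $ k = mfun_of f"
    using assms(1) by (auto simp: schwartz_vec_def)
  then obtain U0 where U0: "\<And>k. U0 k \<in> schwartz" "\<And>k. u0 $ k = mfun_of (U0 k)"
    by metis
  obtain U where U: "\<And>t k. t \<in> {0..<\<tau>1} \<Longrightarrow> U t k \<in> schwartz" "\<And>t k. t \<in> {0..<\<tau>1} \<Longrightarrow> u t $ k = mfun_of (U t k)"
    and Uc: "\<And>p t k. t \<in> {0..<\<tau>1} \<Longrightarrow> ((\<lambda>s. schwartz_norm p (\<lambda>x. U s k x - U t k x)) \<longlongrightarrow> 0) (at t within {0..<\<tau>1})"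
    using schwartz_local_solution_representation[OF assms(2)] by blast
  obtain V where V: "\<And>t k. t \<in> {0..<\<tau>2} \<Longrightarrow> V t k \<in> schwartz" "\<And>t k. t \<in> {0..<\<tau>2} \<Longrightarrow> v t $ k = mfun_of (V t k)"
    and Vc: "\<And>p t k. t \<in> {0..<\<tau>2} \<Longrightarrow> ((\<lambda>s. schwartz_norm p (\<lambda>x. V s k x - V t k x)) \<longlongrightarrow> 0) (at t within {0..<\<tau>2})"
    using schwartz_local_solution_representation[OF assms(3)] by blast
  have UT: "U t k \<in> schwartz" and VT: "V t k \<in> schwartz" if "t \<in> ?I" for t k
    using U(1) V(1) that sub by blast+
  have UcT: "((\<lambda>s. schwartz_norm p (\<lambda>x. U s k x - U t k x)) \<longlongrightarrow> 0) (at t within ?I)"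
    and VcT: "((\<lambda>s. schwartz_norm p (\<lambda>x. V s k x - V t k x)) \<longlongrightarrow> 0) (at t within ?I)" if "t \<in> ?I" for p t k
    using that sub tendsto_within_subset[OF Uc sub(1)] tendsto_within_subset[OF Vc sub(2)] by blast+
  obtain M1 where M1: "\<forall>t\<in>?I. \<forall>k x. \<bar>U t k x\<bar> \<le> M1 \<and> (\<forall>j. \<bar>partial_deriv j (U t k) x\<bar> \<le> M1)"
    using schwartz_path_C1_bound[of T U, OF UT UcT] by blast
  obtain M2 where M2: "\<forall>t\<in>?I. \<forall>k x. \<bar>V t k x\<bar> \<le> M2 \<and> (\<forall>j. \<bar>partial_deriv j (V t k) x\<bar> \<le> M2)"
    using schwartz_path_C1_bound[of T V, OF VT VcT] by blast
  define M where "M = max M1 M2"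
  define W where "W t k x = U t k x - V t k x" for t k x
  define G where "G t k x = burgers_fun (U t) k x - burgers_fun (V t) k x" for t k x
  have W_eq: "W t = (\<lambda>k x. U t k x - V t k x)" "W t k = (\<lambda>x. U t k x - V t k x)"
    and G_eq: "G t = (\<lambda>k x. burgers_fun (U t) k x - burgers_fun (V t) k x)"
      "G t k = (\<lambda>x. burgers_fun (U t) k x - burgers_fun (V t) k x)" for t k
    by (simp_all add: W_def G_def fun_eq_iff)
  have "l2_vec (W T) = 0"
  proof (rule energy_gronwall)
    show "0 \<le> T" using T by simp
    show "W t k \<in> schwartz" if "t \<in> ?I" for t k
      unfolding W_eq by (intro schwartz_diff UT VT that)
    show "G t k \<in> L2fun" if "t \<in> ?I" for t k
      unfolding G_eq by (intro L2fun_diff burgers_fun_L2fun UT VT that)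
    show "((\<lambda>s. l2 (\<lambda>x. W s k x - W t k x)) \<longlongrightarrow> 0) (at t within ?I)" if "t \<in> ?I" for t k
      unfolding W_def by (intro tendsto_l2_diff tendsto_l2_of_schwartz_norm UcT VcT UT VT schwartz_L2fun that)
    show "((\<lambda>s. l2 (\<lambda>x. G s k x - G t k x)) \<longlongrightarrow> 0) (at t within ?I)" if t: "t \<in> ?I" for t k
      unfolding G_def
      by (intro tendsto_l2_diff burgers_fun_tendsto_l2 burgers_fun_L2fun UT VT UcT VcT t)
    show "((\<lambda>s. pairing (G s) \<phi>) has_integral pairing (W t) \<phi>) {0..t}"
      if \<phi>: "\<And>k. \<phi> k \<in> schwartz" and t: "t \<in> ?I" for \<phi> t
    proof -
      note t1 = subsetD[OF sub(1) t] and t2 = subsetD[OF sub(2) t]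
      note \<phi>2 = schwartz_L2fun[OF \<phi>]
      have int: "((\<lambda>s. pairing (burgers_fun (U s)) \<phi> - pairing (burgers_fun (V s)) \<phi>) has_integral
          pairing (\<lambda>k x. U t k x - U0 k x) \<phi> - pairing (\<lambda>k x. V t k x - U0 k x) \<phi>) {0..t}"
        by (intro has_integral_diff schwartz_local_solution_weak[OF assms(2) U Uc U0 \<phi> t1]
            schwartz_local_solution_weak[OF assms(3) V Vc U0 \<phi> t2])
      have eq1: "pairing (burgers_fun (U s)) \<phi> - pairing (burgers_fun (V s)) \<phi> = pairing (G s) \<phi>" if "s \<in> {0..t}" for s
      proof -
        have s: "s \<in> ?I" using that t by auto
        show ?thesis
          unfolding G_eq
          by (rule pairing_diff_left[symmetric]) (intro burgers_fun_L2fun UT VT s \<phi>2)+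
      qed
      have eq2: "pairing (\<lambda>k x. U t k x - U0 k x) \<phi> - pairing (\<lambda>k x. V t k x - U0 k x) \<phi> = pairing (W t) \<phi>"
      proof -
        have "pairing (W t) \<phi> = pairing (\<lambda>k x. (U t k x - U0 k x) - (V t k x - U0 k x)) \<phi>"
          by (simp add: W_eq)
        also have "\<dots> = pairing (\<lambda>k x. U t k x - U0 k x) \<phi> - pairing (\<lambda>k x. V t k x - U0 k x) \<phi>"
          by (rule pairing_diff_left) (intro L2fun_diff schwartz_L2fun UT VT U0 t \<phi>)+
        finally show ?thesis ..
      qed
      show ?thesis
        using has_integral_eq[OF eq1 int] unfolding eq2 .
    qed
    show "pairing (G t) (W t) \<le> (real CARD('n) * (M + M\<^sup>2 / 2)) * (l2_vec (W t))\<^sup>2" if t: "t \<in> ?I" for t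
      unfolding G_eq W_eq
    proof (rule burgers_energy_estimate)
      show "\<bar>partial_deriv j (U t k) x\<bar> \<le> M" for j k x
        using M1 t by (auto simp: M_def intro: max.coboundedI1)
      show "\<bar>V t j x\<bar> \<le> M" for j x
        using M2 t by (auto simp: M_def intro: max.coboundedI2)
    qed (intro UT VT t)+
  qed
  then have "l2 (W T k) = 0" for k
    using l2_le_l2_vec[of "W T" k] l2_nonneg[of "W T k"] by linarith
  moreover have T_mem: "T \<in> ?I" using T by simp
  have "W T k \<in> L2fun" for k
    unfolding W_eq by (intro schwartz_L2fun schwartz_diff UT VT T_mem)
  ultimately have "AE x in lborel. W T k x = 0" for k
    by (intro l2_eq_0_imp_AE)
  then have "mfun_of (U T k) = mfun_of (V T k)" for k
    by (intro mfun_of_eqI schwartz_borel UT VT T_mem) (simp add: W_def)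
  then show "u T = v T"
    using U(2)[OF subsetD[OF sub(1) T_mem]] V(2)[OF subsetD[OF sub(2) T_mem]] by (simp add: vec_eq_iff)
qed

end
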